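(* Let $\alpha_1,\alpha_2,\alpha_3\in\mathbb{Z}$ be such that $\alpha_1-\alpha_3$ and $\alpha_2-\alpha_3$ are relatively prime, and let $\Sigma_M\subset\mathbb{C}P^2$ be a Hamiltonian minimal Lagrangian torus obtained from the construction described in the context (for some admissible real parameters $a_1>a_2>0$, a real root $c_2$, and some $\tau$ satisfying the rationality condition). Then $$E(\Sigma_M)>E(\Sigma_{Cl})=\frac{4\pi^2}{3\sqrt3}.$$
   Context: $\mathbb{C}P^2$ carries the Fubini–Study metric for which the Hopf projection $\mathcal{H}:S^5\to\mathbb{C}P^2$ is a Riemannian submersion. For an immersed Lagrangian torus $\Sigma\subset\mathbb{C}P^2$ the energy is $E(\Sigma)=A(\Sigma)+\frac18 W(\Sigma)$, where $A(\Sigma)=\int_\Sigma d\sigma$ is the area and $W(\Sigma)=\int_\Sigma|H|^2\,d\sigma$ with $H$ the mean curvature vector and $d\sigma$ the induced area element (integrals taken over the torus parametrized by a fundamental domain of the period lattice of the immersion). The Clifford torus $\Sigma_{Cl}$ is the image under $\mathcal{H}$ of $r(x,y)=\frac1{\sqrt3}\bigl(e^{2\pi i x},e^{2\pi i(-x/2+\sqrt3 y/2)},e^{2\pi i(-x/2-\sqrt3y/2)}\bigr)$, and $E(\Sigma_{Cl})=\frac{4\pi^2}{3\sqrt3}$. Construction of $\Sigma_M$: put $b=-\alpha_1-\alpha_2-\alpha_3$, $c=\alpha_1\alpha_2+\alpha_1\alpha_3+\alpha_2\alpha_3$, $c_1=-\alpha_1\alpha_2\alpha_3$. Let $a_1>a_2>0$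 be reals with $P:=a_1^3a_2^2+a_1^2a_2^3+(a_1^2a_2+a_1a_2^2)bc_1+(a_1^2+a_2^2)c_1^2+2a_1^2a_2^2c\le 0$ and $P^2-(a_1-a_2)^2\bigl((a_1+a_2)c_1^2-a_1^2a_2^2+a_1a_2bc_1\bigr)^2\ge0$. Let $c_2$ be a real root of $(a_1-a_2)^2x^4+2Px^2+\bigl((a_1+a_2)c_1^2-a_1^2a_2^2+a_1a_2bc_1\bigr)^2=0$, and set $a_3=\frac{c_1^2+c_2^2}{a_1a_2}$, $a=\frac{bc_1+a_1a_3+a_2a_3-a_1a_2}{c_2}$. Define $v$ by $2e^{v(x)}=a_1\bigl(1-\frac{a_1-a_2}{a_1}\mathrm{sn}^2(x\sqrt{a_1+a_3},k)\bigr)$ with $k=\frac{a_1-a_2}{a_1+a_3}$, where $\mathrm{sn}(u,k)=\sin\theta$ for $u=\int_0^\theta\frac{d\phi}{\sqrt{1-k^2\sin^2\phi}}$; $v$ has period $T=2u(\pi/2)/\sqrt{a_1+a_3}$. For $i$ modulo 3 let $F_i=\sqrt{\frac{2e^v+\alpha_{i+1}\alpha_{i+2}}{(\alpha_i-\alpha_{i+1})(\alpha_i-\alpha_{i+2})}}$, $G_i(x)=\alpha_i\int_0^x\frac{c_2-ae^{v}}{2\alpha_ie^{v}-c_1}dz$, and $\psi(x,y)=\bigl(F_1e^{i(G_1+\alpha_1y)}:F_2e^{i(G_2+\alpha_2y)}:F_3e^{i(G_3+\alpha_3y)}\bigr)$; this is a conformal Hamiltonian minimal Lagrangian immersion $\mathbb{R}^2\to\mathbb{C}P^2$.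 Assume there is $\tau\in\mathbb{R}$ with $\frac{G_1(T)-G_3(T)+(\alpha_1-\alpha_3)\tau}{2\pi}\in\mathbb{Q}$ and $\frac{G_2(T)-G_3(T)+(\alpha_2-\alpha_3)\tau}{2\pi}\in\mathbb{Q}$; then $\psi$ is doubly periodic and $\Sigma_M=\psi(\mathbb{R}^2)$ is an immersed torus. *)

theory Defs
  imports "HOL-Analysis.Analysis"
begin

definition sint :: "(real \<Rightarrow> real) \<Rightarrow> real \<Rightarrow> real \<Rightarrow> real" where
  "sint f a b = (if a \<le> b then integral {a..b} f else - integral {b..a} f)"

definition ellF :: "real \<Rightarrow> real \<Rightarrow> real" where
  "ellF k \<theta> = sint (\<lambda>\<phi>. 1 / sqrt (1 - k\<^sup>2 * (sin \<phi>)\<^sup>2)) 0 \<theta>"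

definition am :: "real \<Rightarrow> real \<Rightarrow> real" where
  "am u k = (THE \<theta>. ellF k \<theta> = u)"

definition sn :: "real \<Rightarrow> real \<Rightarrow> real" where
  "sn u k = sin (am u k)"

text \<open>A point of CP^2 given by homogeneous coordinates z (z \<noteq> 0) is identified with
  the Hermitian projector z z^*/|z|^2. The map z \<mapsto> (1/sqrt 2) z z^*/|z|^2 is an isometric
  embedding of CP^2 with the Fubini--Study metric for which the Hopf map from the
  unit sphere S^5 is a Riemannian submersion into the space of complex 3x3 matrices
  with the real inner product Re tr(A B^*).\<close>

definition proj :: "complex^3 \<Rightarrow> complex^3^3" where
  "proj z = (\<chi> i j. z$i * cnj (z$j) / complex_of_real ((norm z)\<^sup>2))"

definition emb :: "complex^3 \<Rightarrow> complex^3^3" where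
  "emb z = (1 / sqrt 2) *\<^sub>R proj z"

text \<open>Orthogonal projection of a matrix onto the tangent space of the embedded CP^2 at the
  projector P: A \<mapsto> P A (I-P) + (I-P) A P.\<close>
definition tproj :: "complex^3^3 \<Rightarrow> complex^3^3 \<Rightarrow> complex^3^3" where
  "tproj P A = P ** A ** (mat 1 - P) + (mat 1 - P) ** A ** P"

definition px :: "(real \<times> real \<Rightarrow> 'a::real_normed_vector) \<Rightarrow> real \<times> real \<Rightarrow> 'a" where
  "px f p = vector_derivative (\<lambda>t. f (t, snd p)) (at (fst p))"

definition py :: "(real \<times> real \<Rightarrow> 'a::real_normed_vector) \<Rightarrow> real \<times> real \<Rightarrow> 'a" where
  "py f p = vector_derivative (\<lambda>t. f (fst p, t)) (at (snd p))"

text \<open>Surface in CP^2 given by a lift (homogeneous coordinates) Psi : R^2 \<rightarrow> C^3.\<close>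

definition gE :: "(real \<times> real \<Rightarrow> complex^3) \<Rightarrow> real \<times> real \<Rightarrow> real" where
  "gE \<Psi> p = inner (px (emb \<circ> \<Psi>) p) (px (emb \<circ> \<Psi>) p)"

definition gF :: "(real \<times> real \<Rightarrow> complex^3) \<Rightarrow> real \<times> real \<Rightarrow> real" where
  "gF \<Psi> p = inner (px (emb \<circ> \<Psi>) p) (py (emb \<circ> \<Psi>) p)"

definition gG :: "(real \<times> real \<Rightarrow> complex^3) \<Rightarrow> real \<times> real \<Rightarrow> real" where
  "gG \<Psi> p = inner (py (emb \<circ> \<Psi>) p) (py (emb \<circ> \<Psi>) p)"

definition gdet :: "(real \<times> real \<Rightarrow> complex^3) \<Rightarrow> real \<times> real \<Rightarrow> real" where
  "gdet \<Psi> p = gE \<Psi> p * gG \<Psi> p - (gF \<Psi> p)\<^sup>2"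

definition area_dens :: "(real \<times> real \<Rightarrow> complex^3) \<Rightarrow> real \<times> real \<Rightarrow> real" where
  "area_dens \<Psi> p = sqrt (gdet \<Psi> p)"

text \<open>Laplace--Beltrami operator of the induced metric applied to the embedding
  (divergence form, inverse metric (1/det g) [[G,-F],[-F,E]]).\<close>
definition lapl :: "(real \<times> real \<Rightarrow> complex^3) \<Rightarrow> real \<times> real \<Rightarrow> complex^3^3" where
  "lapl \<Psi> p = (1 / area_dens \<Psi> p) *\<^sub>R
     (px (\<lambda>q. (area_dens \<Psi> q / gdet \<Psi> q) *\<^sub>R
              (gG \<Psi> q *\<^sub>R px (emb \<circ> \<Psi>) q - gF \<Psi> q *\<^sub>R py (emb \<circ> \<Psi>) q)) p
    + py (\<lambda>q. (area_dens \<Psi> q / gdet \<Psi> q) *\<^sub>R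
              (gE \<Psi> q *\<^sub>R py (emb \<circ> \<Psi>) q - gF \<Psi> q *\<^sub>R px (emb \<circ> \<Psi>) q)) p)"

text \<open>Mean curvature vector in CP^2 (trace of the second fundamental form): the part of
  the ambient Laplacian tangent to CP^2.\<close>
definition mcurv :: "(real \<times> real \<Rightarrow> complex^3) \<Rightarrow> real \<times> real \<Rightarrow> complex^3^3" where
  "mcurv \<Psi> p = tproj (proj (\<Psi> p)) (lapl \<Psi> p)"

definition energy_dens :: "(real \<times> real \<Rightarrow> complex^3) \<Rightarrow> real \<times> real \<Rightarrow> real" where
  "energy_dens \<Psi> p = area_dens \<Psi> p + (1/8) * (norm (mcurv \<Psi> p))\<^sup>2 * area_dens \<Psi> p"

definition period_lattice :: "(real \<times> real \<Rightarrow> complex^3) \<Rightarrow> (real \<times> real) set" where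
  "period_lattice \<Psi> = {w. \<forall>p. proj (\<Psi> (p + w)) = proj (\<Psi> p)}"

definition lattice_basis :: "(real \<times> real) set \<Rightarrow> real \<times> real \<Rightarrow> real \<times> real \<Rightarrow> bool" where
  "lattice_basis L w1 w2 \<longleftrightarrow>
     fst w1 * snd w2 - snd w1 * fst w2 \<noteq> 0 \<and>
     L = {of_int m *\<^sub>R w1 + of_int n *\<^sub>R w2 | m n. True}"

definition fund_par :: "real \<times> real \<Rightarrow> real \<times> real \<Rightarrow> (real \<times> real) set" where
  "fund_par w1 w2 = {s *\<^sub>R w1 + t *\<^sub>R w2 | s t. 0 \<le> s \<and> s \<le> 1 \<and> 0 \<le> t \<and> t \<le> 1}"

definition energy :: "(real \<times> real \<Rightarrow> complex^3) \<Rightarrow> real \<times> real \<Rightarrow> real \<times> real \<Rightarrow> real" where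
  "energy \<Psi> w1 w2 = integral (fund_par w1 w2) (energy_dens \<Psi>)"

definition vec3 :: "complex \<Rightarrow> complex \<Rightarrow> complex \<Rightarrow> complex^3" where
  "vec3 z1 z2 z3 = (\<chi> i. if i = 1 then z1 else if i = 2 then z2 else z3)"

definition clifford_lift :: "real \<times> real \<Rightarrow> complex^3" where
  "clifford_lift p = (let x = fst p; y = snd p in
     (1 / sqrt 3) *\<^sub>R vec3 (cis (2*pi*x)) (cis (2*pi*(-x/2 + sqrt 3 * y / 2)))
                           (cis (2*pi*(-x/2 - sqrt 3 * y / 2))))"

definition Mb :: "real \<Rightarrow> real \<Rightarrow> real \<Rightarrow> real" where
  "Mb al1 al2 al3 = - al1 - al2 - al3"
definition Mc :: "real \<Rightarrow> real \<Rightarrow> real \<Rightarrow> real" where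
  "Mc al1 al2 al3 = al1*al2 + al1*al3 + al2*al3"
definition Mc1 :: "real \<Rightarrow> real \<Rightarrow> real \<Rightarrow> real" where
  "Mc1 al1 al2 al3 = - al1*al2*al3"

definition MP :: "real \<Rightarrow> real \<Rightarrow> real \<Rightarrow> real \<Rightarrow> real \<Rightarrow> real" where
  "MP al1 al2 al3 a1 a2 = (let b = Mb al1 al2 al3; c = Mc al1 al2 al3; c1 = Mc1 al1 al2 al3 in
     a1^3*a2^2 + a1^2*a2^3 + (a1^2*a2 + a1*a2^2)*b*c1 + (a1^2 + a2^2)*c1^2 + 2*a1^2*a2^2*c)"

definition MQ :: "real \<Rightarrow> real \<Rightarrow> real \<Rightarrow> real \<Rightarrow> real \<Rightarrow> real" where
  "MQ al1 al2 al3 a1 a2 = (let b = Mb al1 al2 al3; c1 = Mc1 al1 al2 al3 in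
     (a1 + a2)*c1^2 - a1^2*a2^2 + a1*a2*b*c1)"

definition Ma3 :: "real \<Rightarrow> real \<Rightarrow> real \<Rightarrow> real \<Rightarrow> real \<Rightarrow> real \<Rightarrow> real" where
  "Ma3 al1 al2 al3 a1 a2 c2 = ((Mc1 al1 al2 al3)^2 + c2^2) / (a1*a2)"

definition Ma :: "real \<Rightarrow> real \<Rightarrow> real \<Rightarrow> real \<Rightarrow> real \<Rightarrow> real \<Rightarrow> real" where
  "Ma al1 al2 al3 a1 a2 c2 = (let a3 = Ma3 al1 al2 al3 a1 a2 c2 in
     (Mb al1 al2 al3 * Mc1 al1 al2 al3 + a1*a3 + a2*a3 - a1*a2) / c2)"

definition Mk :: "real \<Rightarrow> real \<Rightarrow> real \<Rightarrow> real \<Rightarrow> real \<Rightarrow> real \<Rightarrow> real" where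
  "Mk al1 al2 al3 a1 a2 c2 = (a1 - a2) / (a1 + Ma3 al1 al2 al3 a1 a2 c2)"

definition Mev :: "real \<Rightarrow> real \<Rightarrow> real \<Rightarrow> real \<Rightarrow> real \<Rightarrow> real \<Rightarrow> real \<Rightarrow> real" where
  "Mev al1 al2 al3 a1 a2 c2 x = a1 / 2 * (1 - (a1 - a2) / a1 *
     (sn (x * sqrt (a1 + Ma3 al1 al2 al3 a1 a2 c2)) (Mk al1 al2 al3 a1 a2 c2))\<^sup>2)"

definition MT :: "real \<Rightarrow> real \<Rightarrow> real \<Rightarrow> real \<Rightarrow> real \<Rightarrow> real \<Rightarrow> real" where
  "MT al1 al2 al3 a1 a2 c2 = 2 * ellF (Mk al1 al2 al3 a1 a2 c2) (pi/2)
     / sqrt (a1 + Ma3 al1 al2 al3 a1 a2 c2)"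

text \<open>Radicand of F_i, with (ai,aj,ak) = (alpha_i, alpha_{i+1}, alpha_{i+2}).\<close>
definition Mrad :: "real \<Rightarrow> real \<Rightarrow> real \<Rightarrow> real \<Rightarrow> real \<Rightarrow> real \<Rightarrow> real \<Rightarrow> real" where
  "Mrad ai aj ak a1 a2 c2 x = (2 * Mev ai aj ak a1 a2 c2 x + aj * ak) / ((ai - aj) * (ai - ak))"

definition MF :: "real \<Rightarrow> real \<Rightarrow> real \<Rightarrow> real \<Rightarrow> real \<Rightarrow> real \<Rightarrow> real \<Rightarrow> real" where
  "MF ai aj ak a1 a2 c2 x = sqrt (Mrad ai aj ak a1 a2 c2 x)"

text \<open>G_i(x) = alpha_i int_0^x (c2 - a e^v)/(2 alpha_i e^v - c1) dz.
  (All symmetric quantities b, c, c1, a3, a, v are invariant under cyclic permutation.)\<close>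
definition MG :: "real \<Rightarrow> real \<Rightarrow> real \<Rightarrow> real \<Rightarrow> real \<Rightarrow> real \<Rightarrow> real \<Rightarrow> real" where
  "MG ai aj ak a1 a2 c2 x = ai * sint (\<lambda>z.
     (c2 - Ma ai aj ak a1 a2 c2 * Mev ai aj ak a1 a2 c2 z)
     / (2 * ai * Mev ai aj ak a1 a2 c2 z - Mc1 ai aj ak)) 0 x"

definition Mcomp :: "real \<Rightarrow> real \<Rightarrow> real \<Rightarrow> real \<Rightarrow> real \<Rightarrow> real \<Rightarrow> real \<times> real \<Rightarrow> complex" where
  "Mcomp ai aj ak a1 a2 c2 p =
     complex_of_real (MF ai aj ak a1 a2 c2 (fst p)) * cis (MG ai aj ak a1 a2 c2 (fst p) + ai * snd p)"

definition M_lift :: "real \<Rightarrow> real \<Rightarrow> real \<Rightarrow> real \<Rightarrow> real \<Rightarrow> real \<Rightarrow> real \<times> real \<Rightarrow> complex^3" where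
  "M_lift al1 al2 al3 a1 a2 c2 p =
     vec3 (Mcomp al1 al2 al3 a1 a2 c2 p) (Mcomp al2 al3 al1 a1 a2 c2 p) (Mcomp al3 al1 al2 a1 a2 c2 p)"

end

theory Submission
  imports Defs
begin

text \<open>
  Write \<open>h = 2 e\<^sup>v\<close>. For every function \<open>h\<close> the lift is horizontal of norm 1, its coordinate fields are orthogonal,
  the surface is Lagrangian, and the metric is \<open>h w\<^sup>2 dx\<^sup>2 + h dy\<^sup>2\<close>. The modulus in the construction is
  \<open>(a\<^sub>1 - a\<^sub>2) / (a\<^sub>1 + a\<^sub>3)\<close> and not its square root, so \<open>h\<close> solves the conformality equation only
  approximately: \<open>w\<^sup>2 = 1 + \<rho> / R\<close> with \<open>R = - \<Prod> (h + \<alpha>\<^sub>j \<alpha>\<^sub>k) > 0\<close> and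
  \<open>\<rho> = (1 - k) (a\<^sub>1 - h)\<^sup>2 (h - a\<^sub>2) \<ge> 0\<close>. The mean curvature is controlled by the gradient \<open>(\<beta>, - b)\<close> of the
  Lagrangian angle, which bounds the energy density from below by
  \<open>h w + b\<^sup>2 w / 8 + \<beta>\<^sup>2 / (8 w)\<close>.

  Periods \<open>(0, y)\<close> have \<open>y \<in> 2 \<pi> \<int>\<close> because the differences of the \<open>\<alpha>\<^sub>i\<close> are coprime, so a fundamental domain
  has area at least \<open>2 \<pi> T\<close>. Put \<open>X = a\<^sub>1 + a\<^sub>2 + b\<^sup>2 / 4\<close> and \<open>A = a\<^sup>2 / 4\<close>. Integrality of the \<open>\<alpha>\<^sub>i\<close> gives
  \<open>X > 2\<close> and \<open>a\<^sub>1 + a\<^sub>3 \<le> X + A\<close>. If \<open>A \<le> X\<^sup>2\<close>, the terms \<open>h + b\<^sup>2 / 8\<close> already suffice. Otherwise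
  \<open>a\<^sub>3 \<ge> 3 A / 4\<close>, hence \<open>w\<close> is close to 1 and \<open>\<beta>\<close> is close to \<open>- a\<close> away from the minima of \<open>h\<close>, and
  the term \<open>\<beta>\<^sup>2 / (8 w)\<close> supplies the rest.
\<close>

section \<open>Integrals over period parallelograms\<close>

text \<open>The derivative of the amplitude \<open>th\<close> is \<open>LL * dn0 k (th x)\<close>
  with \<open>LL^2 = a1 + a3\<close>. Hence a density bound \<open>P + Q * cos^2 (th x)\<close>,
  weighted by \<open>dn0 k (th x) <= 1\<close>, integrates over one period to
  \<open>(P + Q / 2) * pi / LL\<close>, without any estimate of the complete elliptic integral in
  \<open>T\<close>. With the area bound for the fundamental domain, the claim becomes the algebraic
  inequality \<open>(P + Q / 2)^2 > 4/27 * (a1 + a3)\<close>. The terms \<open>h + b^2 / 8\<close>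
  give \<open>P + Q / 2 = X / 2\<close>, so they must beat \<open>4/27 * (X + A)\<close>; for
  \<open>A <= X^2\<close> they do, because \<open>X > 2\<close>. The obstacle is large
  \<open>A\<close>, where the mean curvature has to contribute a multiple of \<open>A\<close>. For
  the conformal modulus \<open>beta\<close> would be the constant \<open>-a\<close>. Here the
  deviation \<open>beta + a\<close> is controlled only after multiplication by
  \<open>cos (th x)\<close>, which vanishes at the minima of \<open>h\<close>; this is why the
  bounds have the shape \<open>P + Q * cos^2\<close>.\<close>

lemma nn_integral_lborel_linear_aux:
  fixes f :: "real \<times> real \<Rightarrow> ennreal" and x1 y1 x2 y2 :: real
  assumes f: "f \<in> borel_measurable borel"
    and det: "x1 * y2 - y1 * x2 \<noteq> 0" and x1: "x1 \<noteq> 0"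
  shows "(\<integral>\<^sup>+p. f p \<partial>lborel) = ennreal \<bar>x1 * y2 - y1 * x2\<bar> *
     (\<integral>\<^sup>+p. f (fst p * x1 + snd p * x2, fst p * y1 + snd p * y2) \<partial>lborel)"
proof -
  \<comment> \<open>Eliminating the first coordinate splits the map into a scaling by
    \<open>x1\<close> and, after a shear, a scaling by the pivot \<open>d\<close>; their product is
    the determinant.\<close>
  define d where "d = (x1 * y2 - y1 * x2) / x1"
  have d: "d \<noteq> 0" using det x1 by (simp add: d_def)
  have [measurable]: "f \<in> borel_measurable (borel \<Otimes>\<^sub>M borel)"
    using f by (simp add: borel_prod)
  have slice_s: "(\<integral>\<^sup>+s. f (s * x1 + t * x2, s * y1 + t * y2) \<partial>lborel)
      = ennreal (1 / \<bar>x1\<bar>) * (\<integral>\<^sup>+x. f (x, x * y1 / x1 + d * t) \<partial>lborel)" for t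
  proof -
    have "(\<integral>\<^sup>+x. f (x, x * y1 / x1 + d * t) \<partial>lborel) = ennreal \<bar>x1\<bar> *
       (\<integral>\<^sup>+s. f (t * x2 + x1 * s, (t * x2 + x1 * s) * y1 / x1 + d * t) \<partial>lborel)"
      by (rule nn_integral_real_affine) (use x1 in auto)
    also have "(\<lambda>s. f (t * x2 + x1 * s, (t * x2 + x1 * s) * y1 / x1 + d * t))
       = (\<lambda>s. f (s * x1 + t * x2, s * y1 + t * y2))"
      using x1 by (auto simp: d_def field_simps intro!: arg_cong[where f=f])
    finally have "ennreal (1 / \<bar>x1\<bar>) * (\<integral>\<^sup>+x. f (x, x * y1 / x1 + d * t) \<partial>lborel)
      = ennreal (1 / \<bar>x1\<bar>) * ennreal \<bar>x1\<bar> * (\<integral>\<^sup>+s. f (s * x1 + t * x2, s * y1 + t * y2) \<partial>lborel)"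
      by (simp add: mult.assoc)
    also have "ennreal (1 / \<bar>x1\<bar>) * ennreal \<bar>x1\<bar> = 1"
      using x1 by (simp add: ennreal_mult[symmetric])
    finally show ?thesis by simp
  qed
  have slice_t: "(\<integral>\<^sup>+t. f (x, x * y1 / x1 + d * t) \<partial>lborel) = ennreal (1 / \<bar>d\<bar>) * (\<integral>\<^sup>+y. f (x, y) \<partial>lborel)" for x
  proof -
    have "(\<integral>\<^sup>+y. f (x, y) \<partial>lborel) = ennreal \<bar>d\<bar> * (\<integral>\<^sup>+t. f (x, x * y1 / x1 + d * t) \<partial>lborel)"
      by (rule nn_integral_real_affine) (use d in auto)
    then have "ennreal (1 / \<bar>d\<bar>) * (\<integral>\<^sup>+y. f (x, y) \<partial>lborel)
      = ennreal (1 / \<bar>d\<bar>) * ennreal \<bar>d\<bar> * (\<integral>\<^sup>+t. f (x, x * y1 / x1 + d * t) \<partial>lborel)"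
      by (simp add: mult.assoc)
    also have "ennreal (1 / \<bar>d\<bar>) * ennreal \<bar>d\<bar> = 1"
      using d by (simp add: ennreal_mult[symmetric])
    finally show ?thesis by simp
  qed
  have "(\<integral>\<^sup>+p. f (fst p * x1 + snd p * x2, fst p * y1 + snd p * y2) \<partial>lborel)
     = (\<integral>\<^sup>+t. \<integral>\<^sup>+s. f (s * x1 + t * x2, s * y1 + t * y2) \<partial>lborel \<partial>lborel)"
    by (subst lborel_prod[symmetric], subst lborel_pair.nn_integral_snd[symmetric]) auto
  also have "\<dots> = ennreal (1 / \<bar>x1\<bar>) * (\<integral>\<^sup>+t. \<integral>\<^sup>+x. f (x, x * y1 / x1 + d * t) \<partial>lborel \<partial>lborel)"
    unfolding slice_s by (rule nn_integral_cmult) measurable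
  also have "(\<integral>\<^sup>+t. \<integral>\<^sup>+x. f (x, x * y1 / x1 + d * t) \<partial>lborel \<partial>lborel)
     = (\<integral>\<^sup>+x. \<integral>\<^sup>+t. f (x, x * y1 / x1 + d * t) \<partial>lborel \<partial>lborel)"
    by (rule lborel_pair.Fubini') measurable
  also have "\<dots> = ennreal (1 / \<bar>d\<bar>) * (\<integral>\<^sup>+x. \<integral>\<^sup>+y. f (x, y) \<partial>lborel \<partial>lborel)"
    unfolding slice_t by (rule nn_integral_cmult) measurable
  also have "(\<integral>\<^sup>+x. \<integral>\<^sup>+y. f (x, y) \<partial>lborel \<partial>lborel) = (\<integral>\<^sup>+p. f p \<partial>lborel)"
    using lborel.nn_integral_fst[of f lborel] f by (simp add: lborel_prod)
  finally have "ennreal \<bar>x1 * y2 - y1 * x2\<bar> *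
     (\<integral>\<^sup>+p. f (fst p * x1 + snd p * x2, fst p * y1 + snd p * y2) \<partial>lborel)
    = ennreal \<bar>x1 * y2 - y1 * x2\<bar> * ennreal (1 / \<bar>x1\<bar>) * ennreal (1 / \<bar>d\<bar>) * (\<integral>\<^sup>+p. f p \<partial>lborel)"
    by (simp add: mult.assoc)
  also have "ennreal \<bar>x1 * y2 - y1 * x2\<bar> * ennreal (1 / \<bar>x1\<bar>) * ennreal (1 / \<bar>d\<bar>) = 1"
    using x1 d det by (simp add: ennreal_mult[symmetric] d_def abs_divide)
  finally show ?thesis by simp
qed

lemma nn_integral_lborel_swap:
  fixes f :: "real \<times> real \<Rightarrow> ennreal"
  assumes f: "f \<in> borel_measurable borel"
  shows "(\<integral>\<^sup>+p. f (snd p, fst p) \<partial>lborel) = (\<integral>\<^sup>+p. f p \<partial>lborel)"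
proof -
  have [measurable]: "f \<in> borel_measurable (borel \<Otimes>\<^sub>M borel)"
    using f by (simp add: borel_prod)
  have "(\<integral>\<^sup>+p. f (snd p, fst p) \<partial>lborel) = (\<integral>\<^sup>+x. \<integral>\<^sup>+y. f (y, x) \<partial>lborel \<partial>lborel)"
    by (subst lborel_prod[symmetric], subst lborel.nn_integral_fst[symmetric]) auto
  also have "\<dots> = (\<integral>\<^sup>+p. f p \<partial>lborel)"
    using lborel_pair.nn_integral_snd[of f] f by (simp add: lborel_prod)
  finally show ?thesis .
qed

lemma nn_integral_lborel_linear:
  fixes f :: "real \<times> real \<Rightarrow> ennreal" and w1 w2 :: "real \<times> real"
  assumes f: "f \<in> borel_measurable borel"
    and det: "fst w1 * snd w2 - snd w1 * fst w2 \<noteq> 0"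
  shows "(\<integral>\<^sup>+p. f p \<partial>lborel) = ennreal \<bar>fst w1 * snd w2 - snd w1 * fst w2\<bar> *
     (\<integral>\<^sup>+p. f (fst p *\<^sub>R w1 + snd p *\<^sub>R w2) \<partial>lborel)"
proof (cases "fst w1 = 0")
  case False
  then show ?thesis
    using nn_integral_lborel_linear_aux[OF f det] by (cases w1; cases w2) simp
next
  \<comment> \<open>A vanishing pivot is repaired by exchanging \<open>w1\<close> and
    \<open>w2\<close>, which only changes the sign of the determinant.\<close>
  case True
  have det': "fst w2 * snd w1 - snd w2 * fst w1 \<noteq> 0" "fst w2 \<noteq> 0"
    using True det by (auto simp: mult.commute)
  have "(\<integral>\<^sup>+p. f p \<partial>lborel) = ennreal \<bar>fst w2 * snd w1 - snd w2 * fst w1\<bar> *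
     (\<integral>\<^sup>+p. f (fst p *\<^sub>R w2 + snd p *\<^sub>R w1) \<partial>lborel)"
    using nn_integral_lborel_linear_aux[OF f det'] by (cases w1; cases w2) simp
  also have "(\<integral>\<^sup>+p. f (fst p *\<^sub>R w2 + snd p *\<^sub>R w1) \<partial>lborel)
     = (\<integral>\<^sup>+p. f (fst p *\<^sub>R w1 + snd p *\<^sub>R w2) \<partial>lborel)"
    by (subst nn_integral_lborel_swap[symmetric])
      (auto simp: add.commute intro!: measurable_compose[where g=f, OF _ f]
        borel_measurable_continuous_onI[where f="\<lambda>p. fst p *\<^sub>R w2 + snd p *\<^sub>R w1"] continuous_intros)
  also have "\<bar>fst w2 * snd w1 - snd w2 * fst w1\<bar> = \<bar>fst w1 * snd w2 - snd w1 * fst w2\<bar>"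
    by (simp add: abs_minus_commute mult.commute)
  finally show ?thesis .
qed

text \<open>As an equality of measures, the change of variables also acts on Bochner integrals of
  functions of either sign.\<close>

lemma lborel_eq_density_distr_linear:
  fixes w1 w2 :: "real \<times> real"
  assumes det: "fst w1 * snd w2 - snd w1 * fst w2 \<noteq> 0"
  shows "lborel = density (distr lborel borel (\<lambda>p. fst p *\<^sub>R w1 + snd p *\<^sub>R w2))
      (\<lambda>_. ennreal \<bar>fst w1 * snd w2 - snd w1 * fst w2\<bar>)" (is "_ = density (distr _ _ ?L) _")
proof (rule measure_eqI)
  fix A :: "(real \<times> real) set" assume "A \<in> sets lborel"
  then have A[measurable]: "A \<in> sets borel" by simp
  have [measurable]: "?L \<in> borel_measurable borel"
    by (intro borel_measurable_continuous_onI continuous_intros)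
  have "emeasure (distr lborel borel ?L) A = (\<integral>\<^sup>+p. indicator A p \<partial>distr lborel borel ?L)"
    by simp
  also have "\<dots> = (\<integral>\<^sup>+p. indicator A (?L p) \<partial>lborel)"
    by (rule nn_integral_distr) auto
  finally show "emeasure lborel A = emeasure (density (distr lborel borel ?L)
      (\<lambda>_. ennreal \<bar>fst w1 * snd w2 - snd w1 * fst w2\<bar>)) A"
    using nn_integral_lborel_linear[OF _ det, of "indicator A"]
    by (simp add: emeasure_density nn_integral_cmult_indicator)
qed simp

lemma compact_fund_par: "compact (fund_par w1 w2)"
proof -
  have "fund_par w1 w2 = (\<lambda>p. fst p *\<^sub>R w1 + snd p *\<^sub>R w2) ` ({0..1} \<times> {0..1})"
    by (force simp: fund_par_def image_iff)
  then show ?thesis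
    by (auto intro!: compact_continuous_image continuous_intros compact_Times)
qed

lemma integrable_on_fund_par:
  fixes f :: "real \<times> real \<Rightarrow> real"
  assumes "continuous_on UNIV f"
  shows "f integrable_on fund_par w1 w2"
proof -
  have "set_integrable lborel (fund_par w1 w2) f"
    unfolding set_integrable_def
    by (rule borel_integrable_compact[OF compact_fund_par continuous_on_subset[OF assms]]) auto
  then show ?thesis by (rule set_borel_integral_eq_integral)
qed

lemma integral_fund_par:
  fixes f :: "real \<times> real \<Rightarrow> real"
  assumes f: "continuous_on UNIV f"
    and det: "fst w1 * snd w2 - snd w1 * fst w2 \<noteq> 0"
  shows "integral (fund_par w1 w2) f = \<bar>fst w1 * snd w2 - snd w1 * fst w2\<bar> *
    integral (cbox (0, 0) (1, 1)) (\<lambda>p. f (fst p *\<^sub>R w1 + snd p *\<^sub>R w2))"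
proof -
  let ?d = "fst w1 * snd w2 - snd w1 * fst w2" and ?L = "\<lambda>p. fst p *\<^sub>R w1 + snd p *\<^sub>R w2"
  let ?g = "\<lambda>p. indicator (fund_par w1 w2) p *\<^sub>R f p"
  have [measurable]: "?L \<in> borel_measurable borel"
    by (intro borel_measurable_continuous_onI continuous_intros)
  have [measurable]: "f \<in> borel_measurable borel"
    using f by (rule borel_measurable_continuous_onI)
  have [measurable]: "fund_par w1 w2 \<in> sets borel"
    by (simp add: borel_compact compact_fund_par)
  have inv: "?L p \<in> fund_par w1 w2 \<longleftrightarrow> p \<in> cbox (0, 0) (1, 1)" for p
  proof
    assume "?L p \<in> fund_par w1 w2"
    then obtain s t where st: "?L p = s *\<^sub>R w1 + t *\<^sub>R w2" "0 \<le> s" "s \<le> 1" "0 \<le> t" "t \<le> 1"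
      by (auto simp: fund_par_def)
    have x: "(fst p - s) * fst w1 + (snd p - t) * fst w2 = 0"
      and y: "(fst p - s) * snd w1 + (snd p - t) * snd w2 = 0"
      using arg_cong[OF st(1), of fst] arg_cong[OF st(1), of snd] by (auto simp: algebra_simps)
    \<comment> \<open>Cramer's rule: coordinates with respect to \<open>w1\<close>,
      \<open>w2\<close> are unique, so the preimage of the parallelogram is exactly the unit
      square.\<close>
    have "(fst p - s) * ?d = ((fst p - s) * fst w1 + (snd p - t) * fst w2) * snd w2
       - ((fst p - s) * snd w1 + (snd p - t) * snd w2) * fst w2"
      "(snd p - t) * ?d = ((fst p - s) * snd w1 + (snd p - t) * snd w2) * fst w1
       - ((fst p - s) * fst w1 + (snd p - t) * fst w2) * snd w1"
      by (simp_all add: algebra_simps)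
    then have "(fst p - s) * ?d = 0" "(snd p - t) * ?d = 0"
      unfolding x y by simp_all
    then have "fst p = s" "snd p = t" using det by auto
    then show "p \<in> cbox (0, 0) (1, 1)" using st by (cases p) auto
  next
    assume "p \<in> cbox (0, 0) (1, 1)"
    then show "?L p \<in> fund_par w1 w2" by (cases p) (force simp: fund_par_def)
  qed
  have int1: "set_integrable lborel (fund_par w1 w2) f"
    unfolding set_integrable_def
    by (rule borel_integrable_compact[OF compact_fund_par continuous_on_subset[OF f]]) auto
  have int2: "set_integrable lborel (cbox (0, 0) (1, 1)) (\<lambda>p. f (?L p))"
    unfolding set_integrable_def
    by (rule borel_integrable_compact)
      (auto intro!: continuous_on_compose2[OF f] continuous_intros)
  have "integral (fund_par w1 w2) f = (\<integral>p. ?g p \<partial>lborel)"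
    using set_borel_integral_eq_integral(2)[OF int1] by (simp add: set_lebesgue_integral_def)
  also have "\<dots> = (\<integral>p. ?g p \<partial>density (distr lborel borel ?L) (\<lambda>_. ennreal \<bar>?d\<bar>))"
    using lborel_eq_density_distr_linear[OF det] by simp
  also have "\<dots> = (\<integral>p. \<bar>?d\<bar> *\<^sub>R ?g p \<partial>distr lborel borel ?L)"
    by (rule integral_density) auto
  also have "\<dots> = \<bar>?d\<bar> * (\<integral>p. ?g (?L p) \<partial>lborel)"
    by (subst integral_distr) auto
  also have "(\<lambda>p. ?g (?L p)) = (\<lambda>p. indicator (cbox (0, 0) (1, 1)) p *\<^sub>R f (?L p))"
    using inv by (auto simp: indicator_def)
  also have "(\<integral>p. indicator (cbox (0, 0) (1, 1)) p *\<^sub>R f (?L p) \<partial>lborel)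
      = integral (cbox (0, 0) (1, 1)) (\<lambda>p. f (?L p))"
    using set_borel_integral_eq_integral(2)[OF int2] by (simp add: set_lebesgue_integral_def)
  finally show ?thesis .
qed

lemma integral_fund_par_const:
  assumes "fst w1 * snd w2 - snd w1 * fst w2 \<noteq> 0"
  shows "integral (fund_par w1 w2) (\<lambda>_. c) = \<bar>fst w1 * snd w2 - snd w1 * fst w2\<bar> * (c::real)"
  by (subst integral_fund_par[OF _ assms]) (auto simp: content_Pair)

section \<open>Integrands that are periodic in the first coordinate\<close>

lemma quasiperiodic_multiple:
  fixes \<Xi> :: "real \<Rightarrow> real" and n :: int
  assumes per: "\<And>x. \<Xi> (x + T) = \<Xi> x + C"
  shows "\<Xi> (x + of_int n * T) = \<Xi> x + of_int n * C"
proof (induction n rule: int_induct[where k=0])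
  case (step1 i)
  then show ?case using per[of "x + of_int i * T"] by (simp add: algebra_simps)
next
  case (step2 i)
  then show ?case using per[of "x + of_int (i - 1) * T"] by (simp add: algebra_simps)
qed simp

text \<open>The antiderivative \<open>\<Xi>\<close> gains \<open>C\<close> per period, so over a
  nonzero, possibly negative, number of whole periods the mean of \<open>\<phi>\<close> is
  \<open>C / T\<close> whatever the starting point.\<close>

lemma integral_periodic_affine:
  fixes \<phi> \<Xi> :: "real \<Rightarrow> real" and n :: int
  assumes der: "\<And>x. (\<Xi> has_real_derivative \<phi> x) (at x)"
    and per: "\<And>x. \<Xi> (x + T) = \<Xi> x + C" and T: "T > 0" and n: "n \<noteq> 0"
  shows "integral {0..1} (\<lambda>s. \<phi> (c + s * (of_int n * T))) = C / T"
proof -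
  have "((\<lambda>s. \<phi> (c + s * (of_int n * T))) has_integral
      \<Xi> (c + 1 * (of_int n * T)) / (of_int n * T) - \<Xi> (c + 0 * (of_int n * T)) / (of_int n * T)) {0..1}"
  proof (rule fundamental_theorem_of_calculus)
    fix s :: real
    have "((\<lambda>s. \<Xi> (c + s * (of_int n * T)) / (of_int n * T)) has_real_derivative
        \<phi> (c + s * (of_int n * T))) (at s within {0..1})"
      using T n by (auto intro!: derivative_eq_intros DERIV_chain2[OF der])
    then show "((\<lambda>s. \<Xi> (c + s * (of_int n * T)) / (of_int n * T)) has_vector_derivative
        \<phi> (c + s * (of_int n * T))) (at s within {0..1})"
      by (simp add: has_real_derivative_iff_has_vector_derivative)
  qed simp
  then have "integral {0..1} (\<lambda>s. \<phi> (c + s * (of_int n * T)))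
     = (\<Xi> (c + of_int n * T) - \<Xi> c) / (of_int n * T)"
    by (simp add: integral_unique diff_divide_distrib)
  also have "\<dots> = C / T"
    using quasiperiodic_multiple[of \<Xi> T C c n] per T n by (simp add: field_simps)
  finally show ?thesis .
qed

text \<open>In unit square coordinates the integrand depends on a linear form whose coefficients are
  integer multiples of \<open>T\<close>. Integrating first along a side with nonzero coefficient
  already gives the constant mean \<open>C / T\<close>.\<close>

lemma integral_fund_par_periodic:
  fixes \<phi> \<Xi> :: "real \<Rightarrow> real" and n1 n2 :: int
  assumes der: "\<And>x. (\<Xi> has_real_derivative \<phi> x) (at x)"
    and cont: "continuous_on UNIV \<phi>"
    and per: "\<And>x. \<Xi> (x + T) = \<Xi> x + C" and T: "T > 0"
    and w: "fst w1 = of_int n1 * T" "fst w2 = of_int n2 * T"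
    and det: "fst w1 * snd w2 - snd w1 * fst w2 \<noteq> 0"
  shows "integral (fund_par w1 w2) (\<lambda>p. \<phi> (fst p))
     = \<bar>fst w1 * snd w2 - snd w1 * fst w2\<bar> * (C / T)"
proof -
  let ?I = "\<lambda>p. \<phi> (fst p * (of_int n1 * T) + snd p * (of_int n2 * T))"
  have c: "continuous_on A ?I" for A
    by (intro continuous_on_compose2[OF cont] continuous_intros) auto
  have "integral (cbox (0, 0) (1, 1)) ?I = C / T"
  proof (cases "n1 = 0")
    case False
    have "integral (cbox (0, 0) (1, 1)) ?I = integral (cbox (0, 0) (1, 1)) (\<lambda>(x, y). ?I (x, y))"
      by (rule arg_cong[where f="integral _"]) auto
    also have "\<dots> = integral (cbox (0, 0) (1, 1)) (\<lambda>(x, y). ?I (y, x))"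
      by (rule integral_swap_2dim) (use c in \<open>simp add: split_beta\<close>)
    also have "\<dots> = integral (cbox 0 1) (\<lambda>y. integral (cbox 0 1) (\<lambda>x. ?I (x, y)))"
      by (subst integral_prod_continuous)
        (auto simp: split_beta intro!: continuous_on_compose2[OF cont] continuous_intros)
    also have "\<dots> = integral {0..1} (\<lambda>y::real. C / T)"
      using integral_periodic_affine[OF der per T False, of "_ * (of_int n2 * T)"]
      by (simp add: add.commute)
    finally show ?thesis by simp
  next
    case True
    then have n2: "n2 \<noteq> 0" using det w by auto
    have "integral (cbox (0, 0) (1, 1)) ?I = integral (cbox 0 1) (\<lambda>x. integral (cbox 0 1) (\<lambda>y. ?I (x, y)))"
      by (rule integral_prod_continuous[OF c])
    also have "\<dots> = integral {0..1} (\<lambda>x::real. C / T)"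
      using integral_periodic_affine[OF der per T n2, of 0] True by simp
    finally show ?thesis by simp
  qed
  then show ?thesis
    using integral_fund_par[OF _ det, of "\<lambda>p. \<phi> (fst p)"] w
    by (simp add: continuous_on_compose2[OF cont] continuous_on_fst)
qed

section \<open>The Jacobi amplitude\<close>

text \<open>Near \<open>x\<close> the signed integral differs by a constant from an ordinary one
  whose lower end \<open>c\<close> lies to the left of both \<open>a\<close> and
  \<open>x\<close>.\<close>

lemma sint_has_derivative:
  assumes f: "continuous_on UNIV f"
  shows "(sint f a has_real_derivative f x) (at x)"
proof -
  define c d where "c = min a x - 1" and "d = max a x + 1"
  have int: "f integrable_on {u..v}" for u v
    by (rule integrable_continuous_interval[OF continuous_on_subset[OF f]]) simp
  have "((\<lambda>y. integral {c..y} f) has_real_derivative f x) (at x within {c..d})"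
    by (rule integral_has_real_derivative[OF continuous_on_subset[OF f]]) (auto simp: c_def d_def)
  then have "((\<lambda>y. integral {c..y} f) has_real_derivative f x) (at x)"
    by (subst (asm) at_within_interior) (auto simp: c_def d_def)
  then have "((\<lambda>y. integral {c..y} f - integral {c..a} f) has_real_derivative f x) (at x)"
    by (auto intro!: derivative_eq_intros)
  moreover have "eventually (\<lambda>y. integral {c..y} f - integral {c..a} f = sint f a y) (nhds x)"
  proof (rule eventually_nhds_in_open[THEN eventually_mono])
    show "open {c<..}" "x \<in> {c<..}" by (auto simp: c_def)
    fix y assume "y \<in> {c<..}"
    then have y: "c \<le> y" by simp
    have a: "c \<le> a" by (simp add: c_def)
    show "integral {c..y} f - integral {c..a} f = sint f a y"
      using Henstock_Kurzweil_Integration.integral_combine[OF a, of y, OF _ int]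
        Henstock_Kurzweil_Integration.integral_combine[OF y, of a, OF _ int]
      by (auto simp: sint_def)
  qed
  ultimately show ?thesis
    by (subst (asm) DERIV_cong_ev[OF refl _ refl]) auto
qed

text \<open>The Jacobi function dn, taken as a function of the amplitude instead of the
  argument.\<close>

definition dn0 :: "real \<Rightarrow> real \<Rightarrow> real" where
  "dn0 k \<theta> = sqrt (1 - k\<^sup>2 * (sin \<theta>)\<^sup>2)"

locale elliptic_modulus =
  fixes k :: real
  assumes k0: "0 \<le> k" and k1: "k < 1"
begin

lemma dn0_sq_pos: "0 < 1 - k\<^sup>2 * (sin \<theta>)\<^sup>2"
proof -
  have "k\<^sup>2 < 1" using k0 k1 by (simp add: power_less_one_iff)
  moreover have "k\<^sup>2 * (sin \<theta>)\<^sup>2 \<le> k\<^sup>2"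
    by (rule mult_left_le) (auto simp: abs_square_le_1)
  ultimately show ?thesis by linarith
qed

lemma dn0_pos: "0 < dn0 k \<theta>"
  using dn0_sq_pos by (simp add: dn0_def)

lemma dn0_le_1: "dn0 k \<theta> \<le> 1"
  by (simp add: dn0_def)

lemma dn0_sq: "(dn0 k \<theta>)\<^sup>2 = 1 - k\<^sup>2 * (sin \<theta>)\<^sup>2"
  using dn0_sq_pos[of \<theta>] by (simp add: dn0_def)

lemma dn0_continuous: "continuous_on UNIV (dn0 k)"
  unfolding dn0_def by (intro continuous_intros)

lemma ellF_has_derivative: "(ellF k has_real_derivative 1 / dn0 k \<theta>) (at \<theta>)"
proof -
  have "continuous_on UNIV (\<lambda>\<phi>. 1 / sqrt (1 - k\<^sup>2 * (sin \<phi>)\<^sup>2))"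
    using dn0_pos unfolding dn0_def by (intro continuous_intros) (auto simp: less_le)
  then have "(sint (\<lambda>\<phi>. 1 / sqrt (1 - k\<^sup>2 * (sin \<phi>)\<^sup>2)) 0 has_real_derivative
      1 / sqrt (1 - k\<^sup>2 * (sin \<theta>)\<^sup>2)) (at \<theta>)"
    by (rule sint_has_derivative)
  then show ?thesis
    unfolding dn0_def ellF_def[abs_def] .
qed

lemma ellF_0: "ellF k 0 = 0"
  by (simp add: ellF_def sint_def)

text \<open>The integrand \<open>1 / dn0 k z\<close> is at least 1. This single estimate yields
  injectivity, surjectivity and the Lipschitz bound for the inverse, so that \<open>am\<close> is
  well defined and continuous.\<close>

lemma ellF_expanding: assumes "x \<le> y" shows "y - x \<le> ellF k y - ellF k x"
proof -
  have "ellF k x - x \<le> ellF k y - y"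
  proof (rule DERIV_nonneg_imp_nondecreasing[OF assms])
    fix z
    have "((\<lambda>z. ellF k z - z) has_real_derivative (1 / dn0 k z - 1)) (at z)"
      by (auto intro!: derivative_eq_intros ellF_has_derivative)
    moreover have "1 / dn0 k z - 1 \<ge> 0"
      using dn0_pos[of z] dn0_le_1[of z] by simp
    ultimately show "\<exists>y. ((\<lambda>z. ellF k z - z) has_real_derivative y) (at z) \<and> 0 \<le> y"
      by blast
  qed
  then show ?thesis by simp
qed

lemma ellF_inj: "ellF k x = ellF k y \<Longrightarrow> x = y"
  using ellF_expanding[of x y] ellF_expanding[of y x] by linarith

lemma ellF_surj: "\<exists>\<theta>. ellF k \<theta> = u"
proof -
  have "\<exists>\<theta>. - \<bar>u\<bar> \<le> \<theta> \<and> \<theta> \<le> \<bar>u\<bar> \<and> ellF k \<theta> = u"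
  proof (rule IVT)
    show "ellF k (- \<bar>u\<bar>) \<le> u" "u \<le> ellF k \<bar>u\<bar>"
      using ellF_expanding[of "- \<bar>u\<bar>" 0] ellF_expanding[of 0 "\<bar>u\<bar>"] ellF_0 by linarith+
  qed (use ellF_has_derivative in \<open>auto intro: DERIV_isCont\<close>)
  then show ?thesis by blast
qed

lemma ellF_am: "ellF k (am u k) = u"
proof -
  obtain \<theta> where "ellF k \<theta> = u" using ellF_surj by blast
  then show ?thesis unfolding am_def by (rule theI) (use ellF_inj \<open>ellF k \<theta> = u\<close> in blast)
qed

lemma am_ellF: "am (ellF k \<theta>) k = \<theta>"
  by (rule ellF_inj) (rule ellF_am)

lemma am_lipschitz: "\<bar>am u k - am v k\<bar> \<le> \<bar>u - v\<bar>"
  using ellF_expanding[of "am u k" "am v k"] ellF_expanding[of "am v k" "am u k"]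
  by (simp add: ellF_am) linarith

lemma am_isCont: "isCont (\<lambda>u. am u k) u"
  unfolding continuous_at_eps_delta dist_real_def
  using am_lipschitz order.strict_trans1 by blast

lemma am_has_derivative: "((\<lambda>u. am u k) has_real_derivative dn0 k (am u k)) (at u)"
proof -
  have "((\<lambda>u. am u k) has_real_derivative inverse (1 / dn0 k (am u k))) (at u)"
    by (rule DERIV_inverse_function[where f="ellF k" and a="u - 1" and b="u + 1"])
      (use dn0_pos[of "am u k"] in \<open>auto simp: ellF_am am_isCont intro: ellF_has_derivative\<close>)
  then show ?thesis by simp
qed

text \<open>Invariance of \<open>sin^2\<close> under translation by \<open>pi\<close> makes the
  increment constant; its invariance under reflection in \<open>pi / 2\<close> evaluates that
  constant.\<close>

lemma ellF_add_pi: "ellF k (\<theta> + pi) = ellF k \<theta> + 2 * ellF k (pi / 2)"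
proof -
  have "((\<lambda>\<theta>. ellF k (\<theta> + pi) - ellF k \<theta>) has_real_derivative 0) (at x)" for x
  proof -
    have "((\<lambda>\<theta>. ellF k (\<theta> + pi) - ellF k \<theta>) has_real_derivative
        1 / dn0 k (x + pi) * 1 - 1 / dn0 k x) (at x)"
      by (intro derivative_intros DERIV_chain2[OF ellF_has_derivative] ellF_has_derivative)
        (auto intro!: derivative_eq_intros)
    then show ?thesis by (simp add: dn0_def)
  qed
  then have 1: "ellF k (\<theta> + pi) - ellF k \<theta> = ellF k (0 + pi) - ellF k 0"
    by (rule DERIV_isconst_all[rule_format])
  have "((\<lambda>\<theta>. ellF k (pi - \<theta>) + ellF k \<theta>) has_real_derivative 0) (at x)" for x
  proof -
    have "((\<lambda>\<theta>. ellF k (pi - \<theta>) + ellF k \<theta>) has_real_derivative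
        1 / dn0 k (pi - x) * (- 1) + 1 / dn0 k x) (at x)"
      by (intro derivative_intros DERIV_chain2[OF ellF_has_derivative] ellF_has_derivative)
        (auto intro!: derivative_eq_intros)
    then show ?thesis by (simp add: dn0_def)
  qed
  then have "ellF k (pi - pi / 2) + ellF k (pi / 2) = ellF k (pi - 0) + ellF k 0"
    by (rule DERIV_isconst_all[rule_format])
  with 1 show ?thesis by (simp add: ellF_0)
qed

lemma am_add_period: "am (u + 2 * ellF k (pi / 2)) k = am u k + pi"
  by (rule ellF_inj) (simp add: ellF_am ellF_add_pi)

lemma am_0: "am 0 k = 0"
  by (rule ellF_inj) (simp add: ellF_am ellF_0)

lemma ellF_int_pi: "ellF k (of_int n * pi) = of_int n * (2 * ellF k (pi / 2))"
  using quasiperiodic_multiple[of "ellF k" pi "2 * ellF k (pi / 2)" 0 n] ellF_add_pi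
  by (simp add: ellF_0)

end

section \<open>Energy density of an orthogonal horizontal lift\<close>

definition hdot :: "complex^3 \<Rightarrow> complex^3 \<Rightarrow> complex" where
  "hdot u v = (\<Sum>i\<in>UNIV. u$i * cnj (v$i))"

definition outer :: "complex^3 \<Rightarrow> complex^3 \<Rightarrow> complex^3^3" where
  "outer u v = (\<chi> i j. u$i * cnj (v$j))"

lemma hdot_add_left: "hdot (u + v) w = hdot u w + hdot v w"
  and hdot_diff_left: "hdot (u - v) w = hdot u w - hdot v w"
  and hdot_smult_left: "hdot (c *s u) w = c * hdot u w"
  and hdot_smult_right: "hdot u (c *s w) = cnj c * hdot u w"
  and hdot_scaleR_left: "hdot (r *\<^sub>R u) w = of_real r * hdot u w"
  and hdot_scaleR_right: "hdot u (r *\<^sub>R w) = of_real r * hdot u w"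
  by (simp_all add: hdot_def sum.distrib sum_subtractf sum_distrib_left algebra_simps
      scaleR_conv_of_real[where 'a=complex])

lemma cnj_hdot: "cnj (hdot u v) = hdot v u"
  by (simp add: hdot_def mult.commute)

lemma Re_hdot: "Re (hdot u v) = inner u v"
  by (simp add: hdot_def inner_vec_def inner_complex_def)

lemma hdot_self: "hdot u u = of_real ((norm u)\<^sup>2)"
proof (rule complex_eqI)
  show "Re (hdot u u) = Re (of_real ((norm u)\<^sup>2))"
    by (simp add: Re_hdot power2_norm_eq_inner)
  show "Im (hdot u u) = Im (of_real ((norm u)\<^sup>2))"
    by (simp add: hdot_def)
qed

lemma bounded_bilinear_outer: "bounded_bilinear outer"
proof
  have "norm (outer u v) \<le> norm u * norm v * 9" for u v
  proof -
    have "norm (outer u v) \<le> (\<Sum>i\<in>UNIV. norm (outer u v $ i))"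
      unfolding norm_vec_def[of "outer u v"] by (rule L2_set_le_sum) simp
    also have "\<dots> \<le> (\<Sum>i\<in>UNIV. \<Sum>j\<in>UNIV. norm (outer u v $ i $ j))"
      by (intro sum_mono) (subst norm_vec_def, rule L2_set_le_sum, simp)
    also have "\<dots> \<le> (\<Sum>i\<in>(UNIV::3 set). \<Sum>j\<in>(UNIV::3 set). norm u * norm v)"
      by (intro sum_mono) (simp add: outer_def norm_mult mult_mono Finite_Cartesian_Product.norm_nth_le)
    also have "\<dots> = norm u * norm v * 9" by simp
    finally show ?thesis .
  qed
  then show "\<exists>K. \<forall>u v. norm (outer u v) \<le> norm u * norm v * K" by blast
qed (simp_all add: outer_def vec_eq_iff algebra_simps scaleR_conv_of_real[where 'a=complex])

interpretation outer: bounded_bilinear outer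
  by (rule bounded_bilinear_outer)

lemma inner_outer: "inner (outer a b) (outer c d) = Re (hdot a c * cnj (hdot b d))"
proof -
  have "inner (outer a b) (outer c d) = (\<Sum>i\<in>UNIV. \<Sum>j\<in>UNIV. Re ((a$i * cnj (c$i)) * (cnj (b$j) * d$j)))"
    by (simp add: inner_vec_def outer_def inner_complex_def) (simp add: algebra_simps)
  also have "\<dots> = Re (hdot a c * cnj (hdot b d))"
    unfolding hdot_def by (simp only: sum_product Re_sum cnj_sum complex_cnj_mult complex_cnj_cnj)
  finally show ?thesis .
qed

lemma outer_mult_outer: "outer a b ** outer c d = outer (hdot c b *s a) d"
  by (simp add: outer_def matrix_matrix_mult_def vec_eq_iff hdot_def sum_distrib_right sum_distrib_left mult_ac)

lemma matrix_mult_linear: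
  fixes A B C :: "complex^3^3"
  shows "(A + B) ** C = A ** C + B ** C" "A ** (B - C) = A ** B - A ** C" "(A - B) ** C = A ** C - B ** C"
    "(r *\<^sub>R A) ** B = r *\<^sub>R (A ** B)" "A ** (r *\<^sub>R B) = r *\<^sub>R (A ** B)"
  by (simp_all add: vec_eq_iff matrix_matrix_mult_def scaleR_sum_right sum.distrib sum_subtractf algebra_simps)

lemma tproj_add: "tproj P (A + B) = tproj P A + tproj P B"
  by (simp add: tproj_def matrix_add_ldistrib matrix_mult_linear)

lemma tproj_scaleR: "tproj P (r *\<^sub>R A) = r *\<^sub>R tproj P A"
  by (simp add: tproj_def matrix_mult_linear scaleR_add_right scaleR_diff_right)

lemma tproj_expand: "tproj P A = P ** A + A ** P - 2 *\<^sub>R (P ** A ** P)"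
  by (simp add: tproj_def matrix_mult_linear scaleR_2 matrix_mul_assoc)

lemma tproj_outer_orthogonal:
  assumes "hdot x z = 0"
  shows "tproj (outer z z) (outer x x) = 0"
proof -
  have "hdot z x = 0" using assms cnj_hdot[of x z] by simp
  with assms show ?thesis
    by (simp add: tproj_expand outer_mult_outer outer.zero_left)
qed

lemma tproj_outer_left:
  assumes "hdot z z = 1"
  shows "tproj (outer z z) (outer v z) = outer (v - hdot v z *s z) z"
  using assms by (simp add: tproj_expand outer_mult_outer outer.diff_left scaleR_2)

lemma tproj_outer_right:
  assumes "hdot z z = 1"
  shows "tproj (outer z z) (outer z v) = outer z (v - hdot v z *s z)"
proof -
  have "outer (hdot z v *s z) z = outer z (hdot v z *s z)"
    by (simp add: outer_def vec_eq_iff cnj_hdot)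
  then show ?thesis
    using assms by (simp add: tproj_expand outer_mult_outer outer.diff_right scaleR_2)
qed

definition horiz :: "complex^3 \<Rightarrow> complex^3 \<Rightarrow> complex^3" where
  "horiz z v = v - hdot v z *s z"

text \<open>This is the shape of the Laplacian of a projector field with horizontal derivatives
  \<open>x\<close>, \<open>y\<close>. The rank-one squares of horizontal vectors have no tangential
  part, the cross terms keep only the horizontal part of \<open>v\<close>, and the factor
  \<open>1 / sqrt 2\<close> makes the passage from horizontal vectors to tangent matrices
  isometric.\<close>

lemma norm_tproj_sym:
  assumes z: "hdot z z = 1" and x: "hdot x z = 0" and y: "hdot y z = 0"
  shows "(norm (tproj (outer z z) ((1 / sqrt 2) *\<^sub>R (outer v z + outer z v + r *\<^sub>R outer x x + s *\<^sub>R outer y y))))\<^sup>2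
    = (norm (horiz z v))\<^sup>2"
proof -
  let ?h = "horiz z v"
  have hz: "hdot ?h z = 0" using z by (simp add: horiz_def hdot_diff_left hdot_smult_left)
  then have zh: "hdot z ?h = 0" using cnj_hdot[of ?h z] by simp
  have "tproj (outer z z) ((1 / sqrt 2) *\<^sub>R (outer v z + outer z v + r *\<^sub>R outer x x + s *\<^sub>R outer y y))
     = (1 / sqrt 2) *\<^sub>R (outer ?h z + outer z ?h)"
    using z x y by (simp add: tproj_scaleR tproj_add tproj_outer_left tproj_outer_right
        tproj_outer_orthogonal horiz_def)
  then show ?thesis
    unfolding power2_norm_eq_inner
    by (simp add: inner_add_left inner_add_right inner_outer hz zh z Re_hdot)
qed

lemma emb_unit:
  assumes "hdot z z = 1"
  shows "emb z = (1 / sqrt 2) *\<^sub>R outer z z" and "proj z = outer z z"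
  using assms by (simp_all add: emb_def proj_def outer_def hdot_self vec_eq_iff)

text \<open>With orthogonal coordinate fields and a metric depending on \<open>x\<close> alone, the
  divergence form of the Laplacian involves only the derivative \<open>Z\<close> of the weighted
  field and \<open>\<Psi>yy\<close>. The norm of the mean curvature vector is then computed in C^3,
  as that of a horizontal part.\<close>

lemma energy_dens_orthogonal_lift:
  fixes \<Psi> \<Psi>x \<Psi>y \<Psi>yy Z :: "real \<times> real \<Rightarrow> complex^3" and E G :: "real \<Rightarrow> real"
  assumes dx: "\<And>x y. ((\<lambda>t. \<Psi> (t, y)) has_vector_derivative \<Psi>x (x, y)) (at x)"
    and dy: "\<And>x y. ((\<lambda>t. \<Psi> (x, t)) has_vector_derivative \<Psi>y (x, y)) (at y)"
    and dyy: "\<And>x y. ((\<lambda>t. \<Psi>y (x, t)) has_vector_derivative \<Psi>yy (x, y)) (at y)"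
    and dxx: "\<And>x y. ((\<lambda>t. sqrt (G t / E t) *\<^sub>R \<Psi>x (t, y)) has_vector_derivative Z (x, y)) (at x)"
    and unit: "\<And>p. hdot (\<Psi> p) (\<Psi> p) = 1"
    and hx: "\<And>p. hdot (\<Psi>x p) (\<Psi> p) = 0" and hy: "\<And>p. hdot (\<Psi>y p) (\<Psi> p) = 0"
    and mE: "\<And>p. hdot (\<Psi>x p) (\<Psi>x p) = of_real (E (fst p))"
    and mF: "\<And>p. hdot (\<Psi>x p) (\<Psi>y p) = 0"
    and mG: "\<And>p. hdot (\<Psi>y p) (\<Psi>y p) = of_real (G (fst p))"
    and E: "\<And>x. E x > 0" and G: "\<And>x. G x > 0"
  shows "energy_dens \<Psi> p = sqrt (E (fst p) * G (fst p)) * (1 + (1/8) * (norm (horiz (\<Psi> p)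
     ((1 / sqrt (E (fst p) * G (fst p))) *\<^sub>R (Z p + sqrt (E (fst p) / G (fst p)) *\<^sub>R \<Psi>yy p))))\<^sup>2)"
proof -
  have hx': "hdot (\<Psi> p) (\<Psi>x p) = 0" and hy': "hdot (\<Psi> p) (\<Psi>y p) = 0" for p
    using hx[of p] hy[of p] cnj_hdot[of "\<Psi>x p" "\<Psi> p"] cnj_hdot[of "\<Psi>y p" "\<Psi> p"] by simp_all
  have comp: "emb \<circ> \<Psi> = (\<lambda>p. (1 / sqrt 2) *\<^sub>R outer (\<Psi> p) (\<Psi> p))"
    using emb_unit[OF unit] by auto
  have px: "px (emb \<circ> \<Psi>) p = (1 / sqrt 2) *\<^sub>R (outer (\<Psi> p) (\<Psi>x p) + outer (\<Psi>x p) (\<Psi> p))" for p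
    unfolding px_def comp
    by (rule vector_derivative_at)
      (use dx[of "snd p" "fst p"] in \<open>auto intro!: derivative_eq_intros outer.has_vector_derivative\<close>)
  have py: "py (emb \<circ> \<Psi>) p = (1 / sqrt 2) *\<^sub>R (outer (\<Psi> p) (\<Psi>y p) + outer (\<Psi>y p) (\<Psi> p))" for p
    unfolding py_def comp
    by (rule vector_derivative_at)
      (use dy[of "fst p" "snd p"] in \<open>auto intro!: derivative_eq_intros outer.has_vector_derivative\<close>)
  have gE: "gE \<Psi> p = E (fst p)" for p
    unfolding gE_def px by (simp add: inner_add_left inner_add_right inner_outer unit hx hx' mE)
  have gG: "gG \<Psi> p = G (fst p)" for p
    unfolding gG_def py by (simp add: inner_add_left inner_add_right inner_outer unit hy hy' mG)
  have gF: "gF \<Psi> p = 0" for p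
    unfolding gF_def px py
    by (simp add: inner_add_left inner_add_right inner_outer unit hx hx' hy hy' mF)
  have gdet: "gdet \<Psi> p = E (fst p) * G (fst p)" for p
    by (simp add: gdet_def gE gF gG)
  have area: "area_dens \<Psi> p = sqrt (E (fst p) * G (fst p))" for p
    by (simp add: area_dens_def gdet)
  have coef: "area_dens \<Psi> q / gdet \<Psi> q * G (fst q) = sqrt (G (fst q) / E (fst q))"
    "area_dens \<Psi> q / gdet \<Psi> q * E (fst q) = sqrt (E (fst q) / G (fst q))" for q
    using E[of "fst q"] G[of "fst q"] unfolding area gdet
    by (simp_all add: real_sqrt_mult real_sqrt_divide field_simps)
  let ?r = "\<lambda>q. sqrt (G (fst q) / E (fst q))" and ?s = "\<lambda>q. sqrt (E (fst q) / G (fst q))"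
  have "px (\<lambda>q. (area_dens \<Psi> q / gdet \<Psi> q) *\<^sub>R
              (gG \<Psi> q *\<^sub>R px (emb \<circ> \<Psi>) q - gF \<Psi> q *\<^sub>R py (emb \<circ> \<Psi>) q)) p
    = px (\<lambda>q. (1 / sqrt 2) *\<^sub>R (outer (\<Psi> q) (?r q *\<^sub>R \<Psi>x q) + outer (?r q *\<^sub>R \<Psi>x q) (\<Psi> q))) p"
    by (rule arg_cong[where f="\<lambda>f. px f p"], rule ext)
      (simp add: gF gG px coef outer.scaleR_left outer.scaleR_right scaleR_add_right mult.commute flip: coef)
  also have "\<dots> = (1 / sqrt 2) *\<^sub>R (outer (\<Psi> p) (Z p) + outer (\<Psi>x p) (?r p *\<^sub>R \<Psi>x p)
      + (outer (?r p *\<^sub>R \<Psi>x p) (\<Psi>x p) + outer (Z p) (\<Psi> p)))"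
    unfolding px_def
    by (rule vector_derivative_at)
      (use outer.has_vector_derivative[OF dx[of "snd p" "fst p"] dxx[of "snd p" "fst p"]]
        outer.has_vector_derivative[OF dxx[of "snd p" "fst p"] dx[of "snd p" "fst p"]] in \<open>auto intro!: derivative_eq_intros\<close>)
  finally have X: "px (\<lambda>q. (area_dens \<Psi> q / gdet \<Psi> q) *\<^sub>R
              (gG \<Psi> q *\<^sub>R px (emb \<circ> \<Psi>) q - gF \<Psi> q *\<^sub>R py (emb \<circ> \<Psi>) q)) p
    = (1 / sqrt 2) *\<^sub>R (outer (Z p) (\<Psi> p) + outer (\<Psi> p) (Z p) + (2 * ?r p) *\<^sub>R outer (\<Psi>x p) (\<Psi>x p))"
    by (simp add: outer.scaleR_left outer.scaleR_right algebra_simps flip: scaleR_2)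
  have "py (\<lambda>q. (area_dens \<Psi> q / gdet \<Psi> q) *\<^sub>R
              (gE \<Psi> q *\<^sub>R py (emb \<circ> \<Psi>) q - gF \<Psi> q *\<^sub>R px (emb \<circ> \<Psi>) q)) p
    = py (\<lambda>q. (?s q / sqrt 2) *\<^sub>R (outer (\<Psi> q) (\<Psi>y q) + outer (\<Psi>y q) (\<Psi> q))) p"
    by (rule arg_cong[where f="\<lambda>f. py f p"], rule ext)
      (simp add: gF gE py scaleR_add_right mult.commute flip: coef)
  also have "\<dots> = (?s p / sqrt 2) *\<^sub>R (outer (\<Psi> p) (\<Psi>yy p) + outer (\<Psi>y p) (\<Psi>y p)
      + (outer (\<Psi>y p) (\<Psi>y p) + outer (\<Psi>yy p) (\<Psi> p)))"
    unfolding py_def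
    by (rule vector_derivative_at)
      (use dy[of "fst p" "snd p"] dyy[of "fst p" "snd p"] in
        \<open>auto intro!: derivative_eq_intros outer.has_vector_derivative\<close>)
  also have "\<dots> = (1 / sqrt 2) *\<^sub>R (outer (?s p *\<^sub>R \<Psi>yy p) (\<Psi> p) + outer (\<Psi> p) (?s p *\<^sub>R \<Psi>yy p)
        + (2 * ?s p) *\<^sub>R outer (\<Psi>y p) (\<Psi>y p))"
    by (simp add: vec_eq_iff outer_def scaleR_conv_of_real[where 'a=complex] algebra_simps)
  finally have Y: "py (\<lambda>q. (area_dens \<Psi> q / gdet \<Psi> q) *\<^sub>R
              (gE \<Psi> q *\<^sub>R py (emb \<circ> \<Psi>) q - gF \<Psi> q *\<^sub>R px (emb \<circ> \<Psi>) q)) p = \<dots>" .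
  \<comment> \<open>\<open>V\<close> collects the terms that contain \<open>\<Psi> p\<close> itself;
    what remains are the squares removed by the tangential projection.\<close>
  define c where "c = 1 / sqrt (E (fst p) * G (fst p))"
  define V where "V = c *\<^sub>R (Z p + ?s p *\<^sub>R \<Psi>yy p)"
  have "lapl \<Psi> p = (1 / sqrt 2) *\<^sub>R (outer V (\<Psi> p) + outer (\<Psi> p) V
      + (c * (2 * ?r p)) *\<^sub>R outer (\<Psi>x p) (\<Psi>x p) + (c * (2 * ?s p)) *\<^sub>R outer (\<Psi>y p) (\<Psi>y p))"
    unfolding lapl_def X Y unfolding area V_def c_def[symmetric]
    by (simp add: outer.scaleR_left outer.scaleR_right outer.add_left outer.add_right algebra_simps)
  then have "(norm (mcurv \<Psi> p))\<^sup>2 = (norm (horiz (\<Psi> p) V))\<^sup>2"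
    unfolding mcurv_def emb_unit(2)[OF unit] by (simp only: norm_tproj_sym[OF unit hx hy])
  then show ?thesis
    by (simp add: energy_dens_def area V_def c_def algebra_simps)
qed

text \<open>Expansion of the squared distance from \<open>v\<close> to its projection onto the span
  of \<open>e1\<close>, \<open>e2\<close>. For the normal frame it bounds the mean curvature from
  below by two components.\<close>

lemma bessel_two:
  fixes v e1 e2 :: "'a::real_inner"
  assumes "inner e1 e2 = 0" "e1 \<noteq> 0" "e2 \<noteq> 0"
  shows "(inner v e1)\<^sup>2 / (norm e1)\<^sup>2 + (inner v e2)\<^sup>2 / (norm e2)\<^sup>2 \<le> (norm v)\<^sup>2"
proof -
  define s t where "s = inner v e1 / (norm e1)\<^sup>2" and "t = inner v e2 / (norm e2)\<^sup>2"
  have "0 \<le> (norm (v - s *\<^sub>R e1 - t *\<^sub>R e2))\<^sup>2" by simp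
  also have "\<dots> = (norm v)\<^sup>2 - 2 * s * inner v e1 - 2 * t * inner v e2
      + s * s * (norm e1)\<^sup>2 + t * t * (norm e2)\<^sup>2"
    using assms(1) unfolding power2_norm_eq_inner
    by (simp add: inner_diff_left inner_diff_right inner_commute algebra_simps)
  also have "\<dots> = (norm v)\<^sup>2 - ((inner v e1)\<^sup>2 / (norm e1)\<^sup>2 + (inner v e2)\<^sup>2 / (norm e2)\<^sup>2)"
    using assms(2,3) by (simp add: s_def t_def field_simps power2_eq_square)
  finally show ?thesis by simp
qed

text \<open>The vectors \<open>\<i> x\<close> and \<open>\<i> y\<close> are the rotations by the complex structure of a tangent frame:
  for a Lagrangian surface they span the normal plane.\<close>

lemma norm_horiz_ge:
  assumes "hdot z z = 1" and x: "hdot x z = 0" and y: "hdot y z = 0" and xy: "hdot x y = 0"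
    and E: "hdot x x = of_real E" "E > 0" and G: "hdot y y = of_real G" "G > 0"
  shows "(Im (hdot v x))\<^sup>2 / E + (Im (hdot v y))\<^sup>2 / G \<le> (norm (horiz z v))\<^sup>2"
proof -
  have zx: "hdot z x = 0" "hdot z y = 0"
    using x y cnj_hdot[of x z] cnj_hdot[of y z] by simp_all
  have nrm: "(norm (\<i> *s x))\<^sup>2 = E" "(norm (\<i> *s y))\<^sup>2 = G"
    using E(1) G(1) unfolding power2_norm_eq_inner
    by (simp_all add: hdot_smult_left hdot_smult_right flip: Re_hdot)
  have inn: "inner (horiz z v) (\<i> *s x) = Im (hdot v x)" "inner (horiz z v) (\<i> *s y) = Im (hdot v y)"
    "inner (\<i> *s x) (\<i> *s y) = 0"
    using zx xy by (simp_all add: horiz_def hdot_diff_left hdot_smult_left hdot_smult_right flip: Re_hdot)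
  have "\<i> *s x \<noteq> 0" "\<i> *s y \<noteq> 0" using nrm E(2) G(2) by fastforce+
  from bessel_two[OF inn(3) this, of "horiz z v"] show ?thesis
    by (simp only: inn nrm)
qed

section \<open>The Clifford torus\<close>

lemma vec3_nth [simp]: "vec3 a b c $ 1 = a" "vec3 a b c $ 2 = b" "vec3 a b c $ 3 = c"
  by (simp_all add: vec3_def)

lemma vec3_algebra:
  "vec3 a b c + vec3 a' b' c' = vec3 (a + a') (b + b') (c + c')"
  "r *\<^sub>R vec3 a b c = vec3 (r *\<^sub>R a) (r *\<^sub>R b) (r *\<^sub>R c)"
  "z *s vec3 a b c = vec3 (z * a) (z * b) (z * c)"
  by (simp_all add: vec_eq_iff forall_3)

lemma hdot_vec3: "hdot (vec3 a b c) (vec3 a' b' c') = a * cnj a' + b * cnj b' + c * cnj c'"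
  by (simp add: hdot_def sum_3)

lemma bounded_linear_vec3:
  "bounded_linear (\<lambda>z. vec3 z 0 0)" "bounded_linear (\<lambda>z. vec3 0 z 0)" "bounded_linear (\<lambda>z. vec3 0 0 z)"
  by (auto intro!: linearI simp: vec3_algebra simp flip: linear_conv_bounded_linear)

lemma vec3_sum: "vec3 a b c = vec3 a 0 0 + vec3 0 b 0 + vec3 0 0 c"
  by (simp add: vec3_algebra)

lemma has_vector_derivative_vec3:
  assumes "(f has_vector_derivative f') F" "(g has_vector_derivative g') F" "(h has_vector_derivative h') F"
  shows "((\<lambda>t. vec3 (f t) (g t) (h t)) has_vector_derivative vec3 f' g' h') F"
  unfolding vec3_sum[of "f t" "g t" "h t" for t] vec3_sum[of f' g' h']
  by (intro has_vector_derivative_add bounded_linear.has_vector_derivative[OF bounded_linear_vec3(1)]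
      bounded_linear.has_vector_derivative[OF bounded_linear_vec3(2)]
      bounded_linear.has_vector_derivative[OF bounded_linear_vec3(3)] assms)

lemma continuous_on_vec3:
  assumes "continuous_on S f" "continuous_on S g" "continuous_on S h"
  shows "continuous_on S (\<lambda>t. vec3 (f t) (g t) (h t))"
  unfolding vec3_sum[of "f t" "g t" "h t" for t]
  by (intro continuous_on_add bounded_linear.continuous_on[OF bounded_linear_vec3(1)]
      bounded_linear.continuous_on[OF bounded_linear_vec3(2)]
      bounded_linear.continuous_on[OF bounded_linear_vec3(3)] assms)

lemma has_vector_derivative_cis:
  assumes "(f has_real_derivative f') (at x)"
  shows "((\<lambda>t. cis (f t)) has_vector_derivative \<i> * of_real f' * cis (f x)) (at x)"
  unfolding has_vector_derivative_complex_iff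
  using assms by (auto intro!: derivative_eq_intros)

section \<open>Period lattices and the Clifford energy\<close>

lemma cis_eq_1_imp: "cis t = 1 \<Longrightarrow> \<exists>n::int. t = 2 * pi * of_int n"
  by (metis cos_one_2pi_int cis.sel(1) mult.commute mult.left_commute one_complex.sel(1))

lemma lattice_basis_det: "lattice_basis L w1 w2 \<Longrightarrow> fst w1 * snd w2 - snd w1 * fst w2 \<noteq> 0"
  unfolding lattice_basis_def by (rule conjunct1)

text \<open>Each determinant is an integer multiple of the other, so the factor is a unit. The area
  of a fundamental domain may thus be computed from any basis.\<close>

lemma lattice_det_unique:
  assumes "lattice_basis L w1 w2" "lattice_basis L u1 u2"
  shows "\<bar>fst w1 * snd w2 - snd w1 * fst w2\<bar> = \<bar>fst u1 * snd u2 - snd u1 * fst u2\<bar>"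
proof -
  have mult: "\<exists>k::int. fst w1 * snd w2 - snd w1 * fst w2 = of_int k * (fst u1 * snd u2 - snd u1 * fst u2)"
    if w: "lattice_basis L w1 w2" and u: "lattice_basis L u1 u2" for w1 w2 u1 u2
  proof -
    have "w1 = of_int 1 *\<^sub>R w1 + of_int 0 *\<^sub>R w2" "w2 = of_int 0 *\<^sub>R w1 + of_int 1 *\<^sub>R w2"
      by simp_all
    then have "w1 \<in> L" "w2 \<in> L" using w unfolding lattice_basis_def by blast+
    then obtain a b c d :: int where "w1 = of_int a *\<^sub>R u1 + of_int b *\<^sub>R u2"
      "w2 = of_int c *\<^sub>R u1 + of_int d *\<^sub>R u2"
      using u unfolding lattice_basis_def by blast
    then have "fst w1 * snd w2 - snd w1 * fst w2 = of_int (a * d - b * c) * (fst u1 * snd u2 - snd u1 * fst u2)"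
      by (simp add: algebra_simps)
    then show ?thesis by blast
  qed
  obtain k l :: int where k: "fst w1 * snd w2 - snd w1 * fst w2 = of_int k * (fst u1 * snd u2 - snd u1 * fst u2)"
    and l: "fst u1 * snd u2 - snd u1 * fst u2 = of_int l * (fst w1 * snd w2 - snd w1 * fst w2)"
    using mult[OF assms] mult[OF assms(2,1)] by blast
  have "of_int (k * l) * (fst w1 * snd w2 - snd w1 * fst w2) = fst w1 * snd w2 - snd w1 * fst w2"
    using k l by (metis mult.assoc of_int_mult)
  then have "of_int (k * l) = (1::real)"
    using lattice_basis_det[OF assms(1)] by simp
  then have "k * l = 1" by linarith
  then have "\<bar>k\<bar> = 1" using zmult_eq_1_iff[of k l] by auto
  then show ?thesis unfolding k by (simp add: abs_mult flip: of_int_abs)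
qed

lemma proj_smult:
  assumes "cmod u = 1"
  shows "proj (u *s z) = proj z"
proof -
  have u: "cnj u * u = 1" using complex_norm_square[of u] assms by (simp add: mult.commute)
  have "hdot (u *s z) (u *s z) = hdot z z"
    by (simp only: hdot_smult_left hdot_smult_right mult.assoc[symmetric] u mult_1_left)
  then have "norm (u *s z) ^ 2 = norm z ^ 2"
    unfolding hdot_self by (simp only: of_real_eq_iff)
  moreover have "u * a * cnj (u * b) = a * cnj b" for a b
  proof -
    have "u * a * cnj (u * b) = (cnj u * u) * (a * cnj b)" by simp
    then show ?thesis unfolding u by simp
  qed
  ultimately show ?thesis
    by (simp add: proj_def vec_eq_iff)
qed

definition cl_phase :: "real \<Rightarrow> real \<Rightarrow> real \<times> real \<Rightarrow> complex" where
  "cl_phase l m p = of_real (1 / sqrt 3) * cis (l * fst p + m * snd p)"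

lemma cl_phase_deriv:
  "((\<lambda>t. cl_phase l m (t, y)) has_vector_derivative \<i> * of_real l * cl_phase l m (x, y)) (at x)"
  "((\<lambda>t. cl_phase l m (x, t)) has_vector_derivative \<i> * of_real m * cl_phase l m (x, y)) (at y)"
proof -
  have "((\<lambda>t. cis (l * t + m * y)) has_vector_derivative \<i> * of_real l * cis (l * x + m * y)) (at x)"
    "((\<lambda>t. cis (l * x + m * t)) has_vector_derivative \<i> * of_real m * cis (l * x + m * y)) (at y)"
    by (rule has_vector_derivative_cis, auto intro!: derivative_eq_intros)+
  from this[THEN has_vector_derivative_mult_right, of "of_real (1 / sqrt 3)"]
  show "((\<lambda>t. cl_phase l m (t, y)) has_vector_derivative \<i> * of_real l * cl_phase l m (x, y)) (at x)"
    "((\<lambda>t. cl_phase l m (x, t)) has_vector_derivative \<i> * of_real m * cl_phase l m (x, y)) (at y)"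
    by (simp_all add: cl_phase_def mult_ac)
qed

lemma cl_phase_mult_cnj: "cl_phase l m p * cnj (cl_phase l m p) = of_real (1 / 3)"
  by (subst complex_norm_square[symmetric]) (simp add: cl_phase_def norm_mult norm_divide power_divide)

lemma cl_phase_add: "cl_phase l m (p + w) = cis (l * fst w + m * snd w) * cl_phase l m p"
  by (simp add: cl_phase_def cis_mult algebra_simps)

lemma clifford_lift_eq:
  "clifford_lift p = vec3 (cl_phase (2 * pi) 0 p) (cl_phase (- pi) (sqrt 3 * pi) p) (cl_phase (- pi) (- sqrt 3 * pi) p)"
proof -
  have "2 * pi * (- x / 2 + sqrt 3 * y / 2) = - pi * x + sqrt 3 * pi * y"
    "2 * pi * (- x / 2 - sqrt 3 * y / 2) = - pi * x + - sqrt 3 * pi * y" for x y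
    by (simp_all add: algebra_simps)
  then show ?thesis
    by (simp add: clifford_lift_def cl_phase_def Let_def vec3_algebra scaleR_conv_of_real[where 'a=complex])
qed

text \<open>The three frequency vectors have the same length \<open>2 * pi\<close>, so the lift is
  an eigenfunction of the flat Laplacian with eigenvalue \<open>-4 * pi^2\<close>. Its Laplacian has
  no horizontal part, the torus is minimal, and only the area density remains.\<close>

lemma clifford_energy_dens: "energy_dens clifford_lift p = 2 * pi\<^sup>2"
proof -
  let ?f = "cl_phase (2 * pi) 0" and ?g = "cl_phase (- pi) (sqrt 3 * pi)"
    and ?h = "cl_phase (- pi) (- sqrt 3 * pi)"
  let ?x = "\<lambda>p. vec3 (\<i> * of_real (2 * pi) * ?f p) (\<i> * of_real (- pi) * ?g p) (\<i> * of_real (- pi) * ?h p)"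
  let ?y = "\<lambda>p. vec3 (\<i> * of_real 0 * ?f p) (\<i> * of_real (sqrt 3 * pi) * ?g p) (\<i> * of_real (- sqrt 3 * pi) * ?h p)"
  let ?xx = "\<lambda>p. vec3 (\<i> * of_real (2 * pi) * (\<i> * of_real (2 * pi) * ?f p))
      (\<i> * of_real (- pi) * (\<i> * of_real (- pi) * ?g p)) (\<i> * of_real (- pi) * (\<i> * of_real (- pi) * ?h p))"
  let ?yy = "\<lambda>p. vec3 (\<i> * of_real 0 * (\<i> * of_real 0 * ?f p)) (\<i> * of_real (sqrt 3 * pi) * (\<i> * of_real (sqrt 3 * pi) * ?g p))
     (\<i> * of_real (- sqrt 3 * pi) * (\<i> * of_real (- sqrt 3 * pi) * ?h p))"
  have norms: "a * cl_phase l m p * cnj (b * cl_phase l m p) = a * cnj b / 3"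
    "a * cl_phase l m p * cnj (cl_phase l m p) = a / 3" for a b l m p
  proof -
    have "a * cl_phase l m p * cnj (b * cl_phase l m p) = a * cnj b * (cl_phase l m p * cnj (cl_phase l m p))"
      "a * cl_phase l m p * cnj (cl_phase l m p) = a * (cl_phase l m p * cnj (cl_phase l m p))" by simp_all
    then show "a * cl_phase l m p * cnj (b * cl_phase l m p) = a * cnj b / 3"
      "a * cl_phase l m p * cnj (cl_phase l m p) = a / 3"
      unfolding cl_phase_mult_cnj by simp_all
  qed
  have "energy_dens clifford_lift p = sqrt (2 * pi\<^sup>2 * (2 * pi\<^sup>2)) * (1 + (1/8) * (norm (horiz (clifford_lift p)
     ((1 / sqrt (2 * pi\<^sup>2 * (2 * pi\<^sup>2))) *\<^sub>R (?xx p + sqrt (2 * pi\<^sup>2 / (2 * pi\<^sup>2)) *\<^sub>R ?yy p))))\<^sup>2)"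
  proof (rule energy_dens_orthogonal_lift[where \<Psi>x="?x" and \<Psi>y="?y" and E="\<lambda>_. 2 * pi\<^sup>2" and G="\<lambda>_. 2 * pi\<^sup>2"])
    show "((\<lambda>t. clifford_lift (t, y)) has_vector_derivative ?x (x, y)) (at x)"
      "((\<lambda>t. clifford_lift (x, t)) has_vector_derivative ?y (x, y)) (at y)"
      "((\<lambda>t. ?y (x, t)) has_vector_derivative ?yy (x, y)) (at y)"
      for x y
      unfolding clifford_lift_eq
      by (intro has_vector_derivative_vec3 cl_phase_deriv has_vector_derivative_mult_right)+
    have "((\<lambda>t. ?x (t, y)) has_vector_derivative ?xx (x, y)) (at x)" for x y
      by (intro has_vector_derivative_vec3 cl_phase_deriv has_vector_derivative_mult_right)
    then show "((\<lambda>t. sqrt (2 * pi\<^sup>2 / (2 * pi\<^sup>2)) *\<^sub>R ?x (t, y)) has_vector_derivative ?xx (x, y)) (at x)" for x y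
      by simp
    show "hdot (clifford_lift q) (clifford_lift q) = 1" for q
      unfolding clifford_lift_eq hdot_vec3 cl_phase_mult_cnj by simp
    show "hdot (?x q) (clifford_lift q) = 0" "hdot (?y q) (clifford_lift q) = 0" for q
      unfolding clifford_lift_eq hdot_vec3 norms by (simp_all add: algebra_simps)
    show "hdot (?x q) (?x q) = of_real (2 * pi\<^sup>2)" "hdot (?x q) (?y q) = 0"
      "hdot (?y q) (?y q) = of_real (2 * pi\<^sup>2)" for q
      unfolding hdot_vec3 norms by (simp_all add: complex_eq_iff power2_eq_square)
  qed simp_all
  moreover have "?xx p + sqrt (2 * pi\<^sup>2 / (2 * pi\<^sup>2)) *\<^sub>R ?yy p = of_real (- 4 * pi\<^sup>2) *s clifford_lift p"
  proof -
    have "\<i> * of_real a * (\<i> * of_real a * z) = of_real (- (a\<^sup>2)) * z" for a z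
      using i_squared by (simp add: power2_eq_square algebra_simps)
    moreover have "sqrt (2 * pi\<^sup>2 / (2 * pi\<^sup>2)) = 1" by simp
    ultimately show ?thesis
      unfolding clifford_lift_eq vec3_algebra
      by (simp only: scaleR_one distrib_right[symmetric] of_real_add[symmetric]) (simp add: power_mult_distrib)
  qed
  moreover have "horiz (clifford_lift p) (c *\<^sub>R (of_real d *s clifford_lift p)) = 0" for c d
  proof -
    have "hdot (clifford_lift p) (clifford_lift p) = 1"
      unfolding clifford_lift_eq hdot_vec3 cl_phase_mult_cnj by simp
    then show ?thesis
      by (simp add: horiz_def hdot_scaleR_left hdot_smult_left)
        (simp add: vec_eq_iff scaleR_conv_of_real[where 'a=complex])
  qed
  moreover have "sqrt (2 * pi\<^sup>2 * (2 * pi\<^sup>2)) = 2 * pi\<^sup>2"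
    by (rule real_sqrt_unique) (simp_all add: power2_eq_square)
  ultimately show ?thesis
    by (simp only: norm_zero) simp
qed

text \<open>A translation is a period exactly when it changes all three phases by the same amount
  modulo \<open>2 * pi\<close>. The two independent phase differences give integers
  \<open>m\<close>, \<open>n\<close>, the coordinates in this basis. Its determinant
  \<open>2 / (3 * sqrt 3)\<close> times the density \<open>2 * pi^2\<close> is the Clifford
  energy.\<close>

lemma clifford_period_lattice:
  "lattice_basis (period_lattice clifford_lift) (2/3, 0) (1/3, 1 / sqrt 3)"
proof -
  have "w \<in> period_lattice clifford_lift \<longleftrightarrow>
     (\<exists>m n::int. w = of_int m *\<^sub>R (2/3, 0) + of_int n *\<^sub>R (1/3, 1 / sqrt 3))" (is "_ \<longleftrightarrow> ?R") for w
  proof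
    let ?f = "2 * pi * fst w" and ?g = "- pi * fst w + sqrt 3 * pi * snd w"
      and ?h = "- pi * fst w + - sqrt 3 * pi * snd w"
    assume w: "w \<in> period_lattice clifford_lift"
    have unit: "hdot (clifford_lift q) (clifford_lift q) = 1" for q
      unfolding clifford_lift_eq hdot_vec3 cl_phase_mult_cnj by simp
    have "outer (clifford_lift (0 + w)) (clifford_lift (0 + w)) = outer (clifford_lift 0) (clifford_lift 0)"
      using w unfolding period_lattice_def by (simp only: mem_Collect_eq emb_unit(2)[OF unit])
    then have e: "clifford_lift (0 + w) $ i * cnj (clifford_lift (0 + w) $ j)
        = clifford_lift 0 $ i * cnj (clifford_lift 0 $ j)" for i j
      by (simp add: outer_def vec_eq_iff)
    have "cis (?f - ?g) = 1" "cis (?g - ?h) = 1"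
      using e[of 1 2] e[of 2 3] unfolding clifford_lift_eq
      by (simp_all add: cl_phase_def cis_cnj cis_mult power_divide)
    then obtain m n :: int where m: "?f - ?g = 2 * pi * of_int m" and n: "?g - ?h = 2 * pi * of_int n"
      by (meson cis_eq_1_imp)
    have "pi * (3 * fst w - sqrt 3 * snd w) = pi * (2 * of_int m)" "pi * (sqrt 3 * snd w) = pi * of_int n"
      using m n by (simp_all add: algebra_simps)
    then have "3 * fst w - sqrt 3 * snd w = 2 * of_int m" "sqrt 3 * snd w = of_int n"
      by simp_all
    then have "w = of_int m *\<^sub>R (2/3, 0) + of_int n *\<^sub>R (1/3, 1 / sqrt 3)"
      by (intro prod_eqI) (simp_all add: field_simps)
    then show ?R by blast
  next
    assume ?R
    then obtain m n :: int where w: "w = of_int m *\<^sub>R (2/3, 0) + of_int n *\<^sub>R (1/3, 1 / sqrt 3)" by blast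
    let ?u = "cis (2 * pi * fst w)"
    have c: "cis (- pi * fst w + sqrt 3 * pi * snd w) = ?u * cis (2 * pi * of_int (- m))"
       "cis (- pi * fst w + - sqrt 3 * pi * snd w) = ?u * cis (2 * pi * of_int (- m - n))"
      unfolding cis_mult
    proof -
      have "3 * fst w = 2 * of_int m + of_int n" and s: "sqrt 3 * snd w = of_int n"
        unfolding w by simp_all
      then have f: "fst w = (2 * of_int m + of_int n) / 3" by simp
      have "- pi * fst w + sqrt 3 * pi * snd w = - pi * fst w + pi * (sqrt 3 * snd w)"
        "- pi * fst w + - sqrt 3 * pi * snd w = - pi * fst w - pi * (sqrt 3 * snd w)"
        by simp_all
      then show "cis (- pi * fst w + sqrt 3 * pi * snd w) = cis (2 * pi * fst w + 2 * pi * of_int (- m))"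
        "cis (- pi * fst w + - sqrt 3 * pi * snd w) = cis (2 * pi * fst w + 2 * pi * of_int (- m - n))"
        unfolding s f by (simp_all add: field_simps)
    qed
    have "clifford_lift (p + w) = ?u *s clifford_lift p" for p
      unfolding clifford_lift_eq vec3_algebra cl_phase_add c
      by (simp only: cis_multiple_2pi Ints_of_int) simp
    then show "w \<in> period_lattice clifford_lift"
      by (simp add: period_lattice_def proj_smult)
  qed
  then have L: "period_lattice clifford_lift
      = {of_int m *\<^sub>R (2/3, 0) + of_int n *\<^sub>R (1/3, 1 / sqrt 3) | m n. True}"
    by (simp only: set_eq_iff mem_Collect_eq simp_thms)
  have "fst (2/3, 0) * snd (1/3, 1 / sqrt 3) - snd (2/3, 0) * fst (1/3, 1 / sqrt 3) \<noteq> (0::real)"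
    by simp
  with L show ?thesis
    unfolding lattice_basis_def by (rule conjI[rotated])
qed

lemma clifford_energy:
  assumes "lattice_basis (period_lattice clifford_lift) w1 w2"
  shows "energy clifford_lift w1 w2 = 4 * pi\<^sup>2 / (3 * sqrt 3)"
proof -
  have "energy clifford_lift w1 w2 = \<bar>fst w1 * snd w2 - snd w1 * fst w2\<bar> * (2 * pi\<^sup>2)"
    unfolding energy_def clifford_energy_dens
    by (rule integral_fund_par_const) (rule lattice_basis_det[OF assms])
  also have "\<bar>fst w1 * snd w2 - snd w1 * fst w2\<bar> = 2 / (3 * sqrt 3)"
    using lattice_det_unique[OF assms clifford_period_lattice] by simp
  finally show ?thesis by simp
qed

section \<open>Inequalities for the integer parameters\<close>

text \<open>The negative parameter is \<open>-s\<close>. With \<open>d = p - s\<close> the left side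
  is \<open>4 * s^2 + 4 * (s - q) * d\<close>, and replacing \<open>a1\<close>, \<open>a2\<close> by
  their common lower bound \<open>q * s\<close> gives \<open>Y\<close>. If \<open>d >= 0\<close>,
  the term \<open>4 * s * d\<close> is paid for by \<open>q * s * (q + d)^2\<close>, because
  \<open>4 * d <= (1 + d)^2\<close>; otherwise \<open>q <= s\<close> and the mixed term is not
  positive.\<close>

lemma symmetric_bound_pos:
  fixes p q s a1 a2 :: real
  assumes "q \<ge> 1" "s \<ge> 1" "p > q" "q * s < a2" "a2 < a1"
  shows "4 * (p * s + q * s - p * q) \<le> (a1 + a2 + (p + q - s)\<^sup>2 / 4)\<^sup>2"
proof -
  define d Y where "d = p - s" and "Y = 2 * (q * s) + (q + d)\<^sup>2 / 4"
  have p: "p = s + d" by (simp add: d_def)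
  have s2: "s\<^sup>2 \<le> (q * s)\<^sup>2" using assms by (simp add: power_mono)
  have qs: "0 < q * s" using assms by simp
  have "Y\<^sup>2 = 4 * (q * s)\<^sup>2 + q * s * (q + d)\<^sup>2 + ((q + d)\<^sup>2 / 4)\<^sup>2"
    by (simp add: Y_def power2_eq_square algebra_simps)
  then have Y2: "4 * (q * s)\<^sup>2 + q * s * (q + d)\<^sup>2 \<le> Y\<^sup>2" by simp
  have "4 * (p * s + q * s - p * q) \<le> 4 * (q * s)\<^sup>2 + q * s * (q + d)\<^sup>2"
  proof (cases "d \<ge> 0")
    case True
    have "(1 + d)\<^sup>2 \<le> (q + d)\<^sup>2" using True assms by (intro power_mono) auto
    moreover have "4 * d \<le> (1 + d)\<^sup>2"
      using zero_le_power2[of "1 - d"] by (simp add: power2_eq_square algebra_simps)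
    ultimately have "4 * d \<le> (q + d)\<^sup>2" by simp
    then have "s * (4 * d) \<le> s * (q + d)\<^sup>2" using assms by (intro mult_left_mono) auto
    also have "\<dots> \<le> q * (s * (q + d)\<^sup>2)" using assms mult_right_mono[of 1 q "s * (q + d)\<^sup>2"] by simp
    finally have "4 * s * d \<le> q * s * (q + d)\<^sup>2" by (simp add: mult_ac)
    moreover have "0 \<le> q * d" using True assms by simp
    ultimately show ?thesis using s2 by (simp add: p power2_eq_square algebra_simps)
  next
    case False
    have "q \<le> s" using False assms by (simp add: d_def)
    then have "(s - q) * d \<le> 0" using False by (intro mult_nonneg_nonpos) auto
    moreover have "0 \<le> q * s * (q + d)\<^sup>2" using qs by simp
    ultimately show ?thesis using s2 by (simp add: p power2_eq_square algebra_simps)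
  qed
  also have "\<dots> \<le> Y\<^sup>2" by (rule Y2)
  also have "\<dots> \<le> (a1 + a2 + (p + q - s)\<^sup>2 / 4)\<^sup>2"
  proof (rule power_mono)
    show "Y \<le> a1 + a2 + (p + q - s)\<^sup>2 / 4" using assms by (simp add: Y_def p algebra_simps)
    show "0 \<le> Y" using qs by (simp add: Y_def)
  qed
  finally show ?thesis .
qed

text \<open>The signs force \<open>p > 0 > r\<close>; by integrality one of \<open>- q * r\<close>,
  \<open>- p * q\<close> is at least 1, and it lies below \<open>a2\<close>. The second bound
  combines \<open>(p + r - q)^2 >= 0\<close> with \<open>a1 < - p * r\<close>. In the third,
  negative \<open>q\<close> reduces to positive \<open>q\<close> by the symmetry sending
  \<open>(p, q, r)\<close> to \<open>(-r, -q, -p)\<close>.\<close>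

lemma symmetric_bounds_sorted:
  fixes p q r :: int and a1 a2 :: real
  assumes pqr: "p > q" "q > r" "q \<noteq> 0" and a: "0 < a2" "a2 < a1"
    and s: "a2 + q * r > 0" "a1 + p * r < 0" "a2 + p * q > 0"
  shows "a2 > 1" "a1 + Mc p q r \<le> (Mb p q r)\<^sup>2 / 4"
    "- 4 * Mc p q r \<le> (a1 + a2 + (Mb p q r)\<^sup>2 / 4)\<^sup>2"
proof -
  have "real_of_int p * real_of_int r < 0" using s(2) a by simp
  then have "p > 0" "r < 0" using pqr by (auto simp: mult_less_0_iff)
  then have pr: "p \<ge> 1" "r \<le> -1" by auto
  have "q \<ge> 1 \<or> q \<le> -1" using pqr by linarith
  then show "a2 > 1"
  proof
    assume "q \<ge> 1"
    then have "1 * 1 \<le> q * (- r)" using pr by (intro mult_mono) auto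
    then have "q * r \<le> -1" by simp
    then have "real_of_int (q * r) \<le> real_of_int (-1)" by (simp only: of_int_le_iff)
    then show ?thesis using s(1) by linarith
  next
    assume "q \<le> -1"
    then have "1 * 1 \<le> p * (- q)" using pr by (intro mult_mono) auto
    then have "p * q \<le> -1" by simp
    then have "real_of_int (p * q) \<le> real_of_int (-1)" by (simp only: of_int_le_iff)
    then show ?thesis using s(3) by linarith
  qed
  have "0 \<le> (real_of_int p + r - q)\<^sup>2 / 4" by simp
  also have "\<dots> = (Mb p q r)\<^sup>2 / 4 - Mc p q r + real_of_int p * r"
    by (simp add: Mb_def Mc_def power2_eq_square field_simps)
  finally show "a1 + Mc p q r \<le> (Mb p q r)\<^sup>2 / 4" using s(2) by simp
  from \<open>q \<ge> 1 \<or> q \<le> -1\<close> show "- 4 * Mc p q r \<le> (a1 + a2 + (Mb p q r)\<^sup>2 / 4)\<^sup>2"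
  proof
    assume "q \<ge> 1"
    then have "4 * (of_int p * of_int (- r) + of_int q * of_int (- r) - of_int p * of_int q)
       \<le> (a1 + a2 + (of_int p + of_int q - of_int (- r))\<^sup>2 / 4)\<^sup>2"
      using pqr pr s a by (intro symmetric_bound_pos) auto
    moreover have "(of_int p + of_int q - of_int (- r))\<^sup>2 = (Mb p q r)\<^sup>2"
      by (simp add: Mb_def power2_eq_square algebra_simps)
    moreover have "4 * (of_int p * of_int (- r) + of_int q * of_int (- r) - of_int p * of_int q) = - 4 * Mc p q r"
      by (simp add: Mc_def algebra_simps)
    ultimately show ?thesis by (simp only:)
  next
    assume "q \<le> -1"
    then have "4 * (of_int (- r) * of_int p + of_int (- q) * of_int p - of_int (- r) * of_int (- q))
       \<le> (a1 + a2 + (of_int (- r) + of_int (- q) - of_int p)\<^sup>2 / 4)\<^sup>2"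
      using pqr pr s a by (intro symmetric_bound_pos) (auto simp: mult.commute)
    moreover have "(of_int (- r) + of_int (- q) - of_int p)\<^sup>2 = (Mb p q r)\<^sup>2"
      by (simp add: Mb_def power2_eq_square algebra_simps)
    moreover have "4 * (of_int (- r) * of_int p + of_int (- q) * of_int p - of_int (- r) * of_int (- q)) = - 4 * Mc p q r"
      by (simp add: Mc_def algebra_simps)
    ultimately show ?thesis by (simp only:)
  qed
qed

text \<open>Testing the negative factor at the upper end \<open>a1\<close> and the positive ones at
  the lower end \<open>a2\<close> fixes the three signs on the whole range of
  \<open>h\<close>.\<close>

definition one_neg :: "real \<Rightarrow> real \<Rightarrow> real \<Rightarrow> real \<Rightarrow> real \<Rightarrow> bool" where
  "one_neg a1 a2 g1 g2 g3 \<longleftrightarrow> a1 + g1 < 0 \<and> a2 + g2 > 0 \<and> a2 + g3 > 0"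

text \<open>The quotients are the squared moduli of the coordinates at the extreme values of
  \<open>h\<close>. For each order of the \<alpha>'s their positivity fixes the signs of the
  numerators, and the bounds are symmetric, so all six orders reduce to the sorted one.\<close>

lemma symmetric_bounds:
  fixes \<alpha>1 \<alpha>2 \<alpha>3 :: int and a1 a2 :: real
  assumes dist: "\<alpha>1 \<noteq> \<alpha>2" "\<alpha>1 \<noteq> \<alpha>3" "\<alpha>2 \<noteq> \<alpha>3" and nz: "\<alpha>1 \<noteq> 0" "\<alpha>2 \<noteq> 0" "\<alpha>3 \<noteq> 0"
    and a: "0 < a2" "a2 < a1"
    and pos: "\<And>t::real. t \<in> {a1, a2} \<Longrightarrow> (t + \<alpha>2 * \<alpha>3) / ((\<alpha>1 - \<alpha>2) * (\<alpha>1 - \<alpha>3)) > 0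
      \<and> (t + \<alpha>3 * \<alpha>1) / ((\<alpha>2 - \<alpha>3) * (\<alpha>2 - \<alpha>1)) > 0 \<and> (t + \<alpha>1 * \<alpha>2) / ((\<alpha>3 - \<alpha>1) * (\<alpha>3 - \<alpha>2)) > 0"
  shows "a2 > 1" "a1 + Mc \<alpha>1 \<alpha>2 \<alpha>3 \<le> (Mb \<alpha>1 \<alpha>2 \<alpha>3)\<^sup>2 / 4"
    "- 4 * Mc \<alpha>1 \<alpha>2 \<alpha>3 \<le> (a1 + a2 + (Mb \<alpha>1 \<alpha>2 \<alpha>3)\<^sup>2 / 4)\<^sup>2"
    "one_neg a1 a2 (\<alpha>2 * \<alpha>3) (\<alpha>3 * \<alpha>1) (\<alpha>1 * \<alpha>2) \<or> one_neg a1 a2 (\<alpha>3 * \<alpha>1) (\<alpha>1 * \<alpha>2) (\<alpha>2 * \<alpha>3)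
      \<or> one_neg a1 a2 (\<alpha>1 * \<alpha>2) (\<alpha>2 * \<alpha>3) (\<alpha>3 * \<alpha>1)"
proof -
  note p1 = pos[of a1] and p2 = pos[of a2]
  consider "\<alpha>1 > \<alpha>2 \<and> \<alpha>2 > \<alpha>3" | "\<alpha>1 > \<alpha>3 \<and> \<alpha>3 > \<alpha>2" | "\<alpha>2 > \<alpha>1 \<and> \<alpha>1 > \<alpha>3" |
     "\<alpha>2 > \<alpha>3 \<and> \<alpha>3 > \<alpha>1" | "\<alpha>3 > \<alpha>1 \<and> \<alpha>1 > \<alpha>2" | "\<alpha>3 > \<alpha>2 \<and> \<alpha>2 > \<alpha>1"
    using dist by linarith
  then have "a2 > 1 \<and> a1 + Mc \<alpha>1 \<alpha>2 \<alpha>3 \<le> (Mb \<alpha>1 \<alpha>2 \<alpha>3)\<^sup>2 / 4 \<and>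
    - 4 * Mc \<alpha>1 \<alpha>2 \<alpha>3 \<le> (a1 + a2 + (Mb \<alpha>1 \<alpha>2 \<alpha>3)\<^sup>2 / 4)\<^sup>2 \<and>
    (one_neg a1 a2 (\<alpha>2 * \<alpha>3) (\<alpha>3 * \<alpha>1) (\<alpha>1 * \<alpha>2) \<or> one_neg a1 a2 (\<alpha>3 * \<alpha>1) (\<alpha>1 * \<alpha>2) (\<alpha>2 * \<alpha>3)
      \<or> one_neg a1 a2 (\<alpha>1 * \<alpha>2) (\<alpha>2 * \<alpha>3) (\<alpha>3 * \<alpha>1))"
  proof cases
    case 1
    have s: "a2 + \<alpha>2 * \<alpha>3 > 0" "a1 + \<alpha>1 * \<alpha>3 < 0" "a2 + \<alpha>1 * \<alpha>2 > 0"
      using p1 p2 1 by (auto simp: zero_less_divide_iff zero_less_mult_iff mult_less_0_iff mult.commute)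
    show ?thesis using symmetric_bounds_sorted[of \<alpha>2 \<alpha>1 \<alpha>3 a2 a1] s 1 a nz
      by (simp add: one_neg_def mult.commute)
  next
    case 2
    have s: "a2 + \<alpha>3 * \<alpha>2 > 0" "a1 + \<alpha>1 * \<alpha>2 < 0" "a2 + \<alpha>1 * \<alpha>3 > 0"
      using p1 p2 2 by (auto simp: zero_less_divide_iff zero_less_mult_iff mult_less_0_iff mult.commute)
    have "Mb \<alpha>1 \<alpha>3 \<alpha>2 = Mb \<alpha>1 \<alpha>2 \<alpha>3" "Mc \<alpha>1 \<alpha>3 \<alpha>2 = Mc \<alpha>1 \<alpha>2 \<alpha>3"
      by (simp_all add: Mb_def Mc_def)
    then show ?thesis using symmetric_bounds_sorted[of \<alpha>3 \<alpha>1 \<alpha>2 a2 a1] s 2 a nz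
      by (simp add: one_neg_def mult.commute)
  next
    case 3
    have s: "a2 + \<alpha>1 * \<alpha>3 > 0" "a1 + \<alpha>2 * \<alpha>3 < 0" "a2 + \<alpha>2 * \<alpha>1 > 0"
      using p1 p2 3 by (auto simp: zero_less_divide_iff zero_less_mult_iff mult_less_0_iff mult.commute)
    have "Mb \<alpha>2 \<alpha>1 \<alpha>3 = Mb \<alpha>1 \<alpha>2 \<alpha>3" "Mc \<alpha>2 \<alpha>1 \<alpha>3 = Mc \<alpha>1 \<alpha>2 \<alpha>3"
      by (simp_all add: Mb_def Mc_def)
    then show ?thesis using symmetric_bounds_sorted[of \<alpha>1 \<alpha>2 \<alpha>3 a2 a1] s 3 a nz
      by (simp add: one_neg_def mult.commute)
  next
    case 4
    have s: "a2 + \<alpha>3 * \<alpha>1 > 0" "a1 + \<alpha>2 * \<alpha>1 < 0" "a2 + \<alpha>2 * \<alpha>3 > 0"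
      using p1 p2 4 by (auto simp: zero_less_divide_iff zero_less_mult_iff mult_less_0_iff mult.commute)
    have "Mb \<alpha>2 \<alpha>3 \<alpha>1 = Mb \<alpha>1 \<alpha>2 \<alpha>3" "Mc \<alpha>2 \<alpha>3 \<alpha>1 = Mc \<alpha>1 \<alpha>2 \<alpha>3"
      by (simp_all add: Mb_def Mc_def)
    then show ?thesis using symmetric_bounds_sorted[of \<alpha>3 \<alpha>2 \<alpha>1 a2 a1] s 4 a nz
      by (simp add: one_neg_def mult.commute)
  next
    case 5
    have s: "a2 + \<alpha>1 * \<alpha>2 > 0" "a1 + \<alpha>3 * \<alpha>2 < 0" "a2 + \<alpha>3 * \<alpha>1 > 0"
      using p1 p2 5 by (auto simp: zero_less_divide_iff zero_less_mult_iff mult_less_0_iff mult.commute)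
    have "Mb \<alpha>3 \<alpha>1 \<alpha>2 = Mb \<alpha>1 \<alpha>2 \<alpha>3" "Mc \<alpha>3 \<alpha>1 \<alpha>2 = Mc \<alpha>1 \<alpha>2 \<alpha>3"
      by (simp_all add: Mb_def Mc_def)
    then show ?thesis using symmetric_bounds_sorted[of \<alpha>1 \<alpha>3 \<alpha>2 a2 a1] s 5 a nz
      by (simp add: one_neg_def mult.commute)
  next
    case 6
    have s: "a2 + \<alpha>2 * \<alpha>1 > 0" "a1 + \<alpha>3 * \<alpha>1 < 0" "a2 + \<alpha>3 * \<alpha>2 > 0"
      using p1 p2 6 by (auto simp: zero_less_divide_iff zero_less_mult_iff mult_less_0_iff mult.commute)
    have "Mb \<alpha>3 \<alpha>2 \<alpha>1 = Mb \<alpha>1 \<alpha>2 \<alpha>3" "Mc \<alpha>3 \<alpha>2 \<alpha>1 = Mc \<alpha>1 \<alpha>2 \<alpha>3"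
      by (simp_all add: Mb_def Mc_def)
    then show ?thesis using symmetric_bounds_sorted[of \<alpha>2 \<alpha>3 \<alpha>1 a2 a1] s 6 a nz
      by (simp add: one_neg_def mult.commute)
  qed
  then show "a2 > 1" "a1 + Mc \<alpha>1 \<alpha>2 \<alpha>3 \<le> (Mb \<alpha>1 \<alpha>2 \<alpha>3)\<^sup>2 / 4"
    "- 4 * Mc \<alpha>1 \<alpha>2 \<alpha>3 \<le> (a1 + a2 + (Mb \<alpha>1 \<alpha>2 \<alpha>3)\<^sup>2 / 4)\<^sup>2"
    "one_neg a1 a2 (\<alpha>2 * \<alpha>3) (\<alpha>3 * \<alpha>1) (\<alpha>1 * \<alpha>2) \<or> one_neg a1 a2 (\<alpha>3 * \<alpha>1) (\<alpha>1 * \<alpha>2) (\<alpha>2 * \<alpha>3)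
      \<or> one_neg a1 a2 (\<alpha>1 * \<alpha>2) (\<alpha>2 * \<alpha>3) (\<alpha>3 * \<alpha>1)"
    by blast+
qed

text \<open>Here \<open>u = a\<^sub>1 - t\<close> and \<open>v = t - a\<^sub>2\<close>; the sum of the reciprocals is the logarithmic derivative of
  the cubic, and the last term is the derivative of \<open>\<delta> u\<^sup>2 v\<close>.\<close>

lemma log_derivative_bound:
  fixes u v d1 d2 d3 \<delta> :: real
  assumes uv: "u \<ge> 0" "v \<ge> 0" and d: "0 \<le> \<delta>" "\<delta> \<le> 1"
    and d1: "d1 \<le> - u" "d1 < 0" and d2: "v \<le> d2" "0 < d2" and d3: "v \<le> d3" "0 < d3"
  shows "\<bar>\<delta> * u\<^sup>2 * v * (1 / d1 + 1 / d2 + 1 / d3) - \<delta> * (u\<^sup>2 - 2 * u * v)\<bar> \<le> u * (2 * v + u)"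
proof -
  \<comment> \<open>Each zero of the cubic is at distance at least \<open>u\<close> or
    \<open>v\<close> from \<open>t\<close>, so every pole is balanced by one factor of
    \<open>u^2 * v\<close> and the quotients lie in \<open>[0, 1]\<close>.\<close>
  define x y z where "x = u / - d1" and "y = v / d2" and "z = v / d3"
  have x: "0 \<le> x" "x \<le> 1" and y: "0 \<le> y" "y \<le> 1" and z: "0 \<le> z" "z \<le> 1"
    using assms by (auto simp: x_def y_def z_def field_simps divide_le_0_iff)
  have e: "\<delta> * u\<^sup>2 * v * (1 / d1 + 1 / d2 + 1 / d3) - \<delta> * (u\<^sup>2 - 2 * u * v)
     = \<delta> * (u * v * (2 - x) + u\<^sup>2 * (y + z - 1))"
  proof -
    have r: "u * (1 / d1) = - x" "v * (1 / d2) = y" "v * (1 / d3) = z"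
      by (simp_all add: x_def y_def z_def)
    have "u\<^sup>2 * v * (1 / d1 + 1 / d2 + 1 / d3)
       = u * v * (u * (1 / d1)) + u\<^sup>2 * (v * (1 / d2)) + u\<^sup>2 * (v * (1 / d3))"
      by (simp add: power2_eq_square algebra_simps)
    then have "u\<^sup>2 * v * (1 / d1 + 1 / d2 + 1 / d3) = - (u * v * x) + u\<^sup>2 * y + u\<^sup>2 * z"
      unfolding r by simp
    then show ?thesis
      by (simp add: mult.assoc[of \<delta>] right_diff_distrib[symmetric]) (simp add: power2_eq_square algebra_simps)
  qed
  have "u * v * (2 - x) \<le> u * v * 2" "u * v * (2 - x) \<ge> 0"
    using uv x by (intro mult_left_mono mult_nonneg_nonneg; simp)+
  moreover have "u\<^sup>2 * (y + z - 1) \<le> u\<^sup>2 * 1" "u\<^sup>2 * (y + z - 1) \<ge> u\<^sup>2 * (-1)"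
    using y z by (intro mult_left_mono; simp)+
  ultimately have "\<bar>u * v * (2 - x) + u\<^sup>2 * (y + z - 1)\<bar> \<le> u * (2 * v + u)"
    using mult_nonneg_nonneg[OF uv] by (simp add: abs_le_iff power2_eq_square algebra_simps)
  then have "\<bar>\<delta>\<bar> * \<bar>u * v * (2 - x) + u\<^sup>2 * (y + z - 1)\<bar> \<le> 1 * (u * (2 * v + u))"
    using d by (intro mult_mono) auto
  then show ?thesis unfolding e by (simp add: abs_mult)
qed

section \<open>The profile function\<close>

lemma vandermonde_sum:
  fixes A B C f1 f2 f3 :: real
  assumes "A \<noteq> B" "A \<noteq> C" "B \<noteq> C"
  shows "f1 / ((A-B)*(A-C)) + f2 / ((B-C)*(B-A)) + f3 / ((C-A)*(C-B))
    = - ((B-C)*f1 + (C-A)*f2 + (A-B)*f3) / ((A-B)*(B-C)*(C-A))"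
proof -
  have nz: "(A-B)*(A-C) \<noteq> 0" "(B-C)*(B-A) \<noteq> 0" "(C-A)*(C-B) \<noteq> 0" "(A-B)*(B-C)*(C-A) \<noteq> 0"
    using assms by simp_all
  have "f1 / ((A-B)*(A-C)) = - ((B-C)*f1) / ((A-B)*(B-C)*(C-A))"
    "f2 / ((B-C)*(B-A)) = - ((C-A)*f2) / ((A-B)*(B-C)*(C-A))"
    "f3 / ((C-A)*(C-B)) = - ((A-B)*f3) / ((A-B)*(B-C)*(C-A))"
    by (subst frac_eq_eq[OF nz(1,4)], algebra)
      (subst frac_eq_eq[OF nz(2,4)], algebra, subst frac_eq_eq[OF nz(3,4)], algebra)
  then show ?thesis by (simp add: add_divide_distrib diff_divide_distrib)
qed

text \<open>Sums of the type of second divided differences. Geometrically, (4) is the unit norm of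
  the lift, (1) and (5) the horizontality of the two coordinate fields, (2) their orthogonality and
  (6) the squared length \<open>h\<close> of the second field; (3) and (7) enter the mean
  curvature.\<close>

lemma partial_fractions_alpha:
  fixes A B C :: real
  assumes d: "A \<noteq> B" "A \<noteq> C" "B \<noteq> C"
  shows "1 / ((A-B)*(A-C)) + 1 / ((B-C)*(B-A)) + 1 / ((C-A)*(C-B)) = 0"
    "A / ((A-B)*(A-C)) + B / ((B-C)*(B-A)) + C / ((C-A)*(C-B)) = 0"
    "A\<^sup>2 / ((A-B)*(A-C)) + B\<^sup>2 / ((B-C)*(B-A)) + C\<^sup>2 / ((C-A)*(C-B)) = 1"
    "(t + B*C) / ((A-B)*(A-C)) + (t + C*A) / ((B-C)*(B-A)) + (t + A*B) / ((C-A)*(C-B)) = 1"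
    "A * ((t + B*C) / ((A-B)*(A-C))) + B * ((t + C*A) / ((B-C)*(B-A))) + C * ((t + A*B) / ((C-A)*(C-B))) = 0"
    "A\<^sup>2 * ((t + B*C) / ((A-B)*(A-C))) + B\<^sup>2 * ((t + C*A) / ((B-C)*(B-A))) + C\<^sup>2 * ((t + A*B) / ((C-A)*(C-B))) = t"
    "A^3 * ((t + B*C) / ((A-B)*(A-C))) + B^3 * ((t + C*A) / ((B-C)*(B-A))) + C^3 * ((t + A*B) / ((C-A)*(C-B)))
      = (A + B + C) * t + A * B * C"
proof -
  have V: "(A-B)*(B-C)*(C-A) \<noteq> 0" using d by simp
  have eqI: "- N / ((A-B)*(B-C)*(C-A)) = v" if "N = - v * ((A-B)*(B-C)*(C-A))" for N v
    unfolding that using V by simp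
  show "1 / ((A-B)*(A-C)) + 1 / ((B-C)*(B-A)) + 1 / ((C-A)*(C-B)) = 0"
    "A / ((A-B)*(A-C)) + B / ((B-C)*(B-A)) + C / ((C-A)*(C-B)) = 0"
    "A\<^sup>2 / ((A-B)*(A-C)) + B\<^sup>2 / ((B-C)*(B-A)) + C\<^sup>2 / ((C-A)*(C-B)) = 1"
    "(t + B*C) / ((A-B)*(A-C)) + (t + C*A) / ((B-C)*(B-A)) + (t + A*B) / ((C-A)*(C-B)) = 1"
    "A * ((t + B*C) / ((A-B)*(A-C))) + B * ((t + C*A) / ((B-C)*(B-A))) + C * ((t + A*B) / ((C-A)*(C-B))) = 0"
    "A\<^sup>2 * ((t + B*C) / ((A-B)*(A-C))) + B\<^sup>2 * ((t + C*A) / ((B-C)*(B-A))) + C\<^sup>2 * ((t + A*B) / ((C-A)*(C-B))) = t"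
    "A^3 * ((t + B*C) / ((A-B)*(A-C))) + B^3 * ((t + C*A) / ((B-C)*(B-A))) + C^3 * ((t + A*B) / ((C-A)*(C-B)))
      = (A + B + C) * t + A * B * C"
    unfolding times_divide_eq_right vandermonde_sum[OF d] by (rule eqI, algebra)+
qed

text \<open>The differentiated coordinates carry the denominators \<open>t + B*C\<close>,
  \<open>t + C*A\<close>, \<open>t + A*B\<close>. The first sum gives the squared length of the
  first coordinate field, the others appear in the normal components of the Laplacian.\<close>

lemma partial_fractions_radicand:
  fixes A B C t :: real
  assumes d: "A \<noteq> B" "A \<noteq> C" "B \<noteq> C"
    and nz: "t + B*C \<noteq> 0" "t + C*A \<noteq> 0" "t + A*B \<noteq> 0"
  defines "R \<equiv> - ((t + B*C) * (t + C*A) * (t + A*B))"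
  shows "1 / (t + B*C) / ((A-B)*(A-C)) + 1 / (t + C*A) / ((B-C)*(B-A)) + 1 / (t + A*B) / ((C-A)*(C-B)) = t / R"
    "A / (t + B*C) / ((A-B)*(A-C)) + B / (t + C*A) / ((B-C)*(B-A)) + C / (t + A*B) / ((C-A)*(C-B)) = - (A*B*C) / R"
    "1 / (t + B*C)\<^sup>2 / ((A-B)*(A-C)) + 1 / (t + C*A)\<^sup>2 / ((B-C)*(B-A)) + 1 / (t + A*B)\<^sup>2 / ((C-A)*(C-B))
      = - 1 / R + t * (1 / (t + B*C) + 1 / (t + C*A) + 1 / (t + A*B)) / R"
proof -
  define p q r V where "p = t + B*C" and "q = t + C*A" and "r = t + A*B" and "V = (A-B)*(B-C)*(C-A)"
  have V: "V \<noteq> 0" using d by (simp add: V_def)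
  have pqr: "p \<noteq> 0" "q \<noteq> 0" "r \<noteq> 0" using nz by (simp_all add: p_def q_def r_def)
  have R: "R = - (p * q * r)" by (simp add: R_def p_def q_def r_def)
  have 1: "(B-C)*(1/p) + (C-A)*(1/q) + (A-B)*(1/r) = ((B-C)*(q*r) + (C-A)*(p*r) + (A-B)*(p*q)) / (p*q*r)"
    using pqr by (simp add: field_simps)
  have 11: "(B-C)*(q*r) + (C-A)*(p*r) + (A-B)*(p*q) = V * t"
    by (simp add: p_def q_def r_def V_def algebra_simps)
  have 2: "(B-C)*(A/p) + (C-A)*(B/q) + (A-B)*(C/r) = ((B-C)*A*(q*r) + (C-A)*B*(p*r) + (A-B)*C*(p*q)) / (p*q*r)"
    using pqr by (simp add: field_simps)
  have 22: "(B-C)*A*(q*r) + (C-A)*B*(p*r) + (A-B)*C*(p*q) = - V * (A*B*C)"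
    by (simp add: p_def q_def r_def V_def algebra_simps)
  have 3: "(B-C)*(1/p\<^sup>2) + (C-A)*(1/q\<^sup>2) + (A-B)*(1/r\<^sup>2)
      = ((B-C)*(q*r)\<^sup>2 + (C-A)*(p*r)\<^sup>2 + (A-B)*(p*q)\<^sup>2) / (p*q*r)\<^sup>2"
  proof -
    have "(B-C)*(1/p\<^sup>2) = (B-C)*(q*r)\<^sup>2 / (p*q*r)\<^sup>2" "(C-A)*(1/q\<^sup>2) = (C-A)*(p*r)\<^sup>2 / (p*q*r)\<^sup>2"
      "(A-B)*(1/r\<^sup>2) = (A-B)*(p*q)\<^sup>2 / (p*q*r)\<^sup>2"
      using pqr by (simp_all add: power_mult_distrib)
    then show ?thesis by (simp only: add_divide_distrib)
  qed
  have 4: "1/p + 1/q + 1/r = (q*r + p*r + p*q) / (p*q*r)"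
    using pqr by (simp add: field_simps)
  have 5: "- (V * (t * \<sigma> - P) / P\<^sup>2) / V = - 1 / - P + t * (\<sigma> / P) / - P" if "P \<noteq> 0" for P \<sigma>
    using V that by (simp add: field_simps power2_eq_square)
  have 33: "(B-C)*(q*r)\<^sup>2 + (C-A)*(p*r)\<^sup>2 + (A-B)*(p*q)\<^sup>2 = V * (t * (q*r + p*r + p*q) - p*q*r)"
    unfolding p_def q_def r_def V_def by algebra
  show "1 / (t + B*C) / ((A-B)*(A-C)) + 1 / (t + C*A) / ((B-C)*(B-A)) + 1 / (t + A*B) / ((C-A)*(C-B)) = t / R"
    unfolding vandermonde_sum[OF d] V_def[symmetric] R
    unfolding p_def[symmetric] q_def[symmetric] r_def[symmetric] 1 11
    using V pqr by (simp add: field_simps)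
  show "A / (t + B*C) / ((A-B)*(A-C)) + B / (t + C*A) / ((B-C)*(B-A)) + C / (t + A*B) / ((C-A)*(C-B)) = - (A*B*C) / R"
    unfolding vandermonde_sum[OF d] V_def[symmetric] R
    unfolding p_def[symmetric] q_def[symmetric] r_def[symmetric] 2 22
    using V pqr by (simp add: field_simps)
  show "1 / (t + B*C)\<^sup>2 / ((A-B)*(A-C)) + 1 / (t + C*A)\<^sup>2 / ((B-C)*(B-A)) + 1 / (t + A*B)\<^sup>2 / ((C-A)*(C-B))
      = - 1 / R + t * (1 / (t + B*C) + 1 / (t + C*A) + 1 / (t + A*B)) / R"
    unfolding vandermonde_sum[OF d] V_def[symmetric] R
    unfolding p_def[symmetric] q_def[symmetric] r_def[symmetric] 3 33 4
    by (rule 5) (use pqr in simp)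
qed

text \<open>The coordinates of the lift are defined with cyclically permuted arguments; this makes
  them share one profile \<open>h\<close> and one constant \<open>a\<close>.\<close>

lemma cyclic_invariance:
  "Mb y z x = Mb x y z" "Mc1 y z x = Mc1 x y z" "Ma3 y z x a1 a2 c2 = Ma3 x y z a1 a2 c2"
  "Ma y z x a1 a2 c2 = Ma x y z a1 a2 c2" "Mk y z x a1 a2 c2 = Mk x y z a1 a2 c2"
  "Mev y z x a1 a2 c2 = Mev x y z a1 a2 c2"
proof -
  show b: "Mb y z x = Mb x y z" and c: "Mc1 y z x = Mc1 x y z" by (simp_all add: Mb_def Mc1_def)
  show a3: "Ma3 y z x a1 a2 c2 = Ma3 x y z a1 a2 c2" by (simp add: Ma3_def c)
  show "Ma y z x a1 a2 c2 = Ma x y z a1 a2 c2" by (simp add: Ma_def Let_def a3 b c)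
  show k: "Mk y z x a1 a2 c2 = Mk x y z a1 a2 c2" by (simp add: Mk_def a3)
  show "Mev y z x a1 a2 c2 = Mev x y z a1 a2 c2" by (simp add: Mev_def a3 k fun_eq_iff)
qed

locale hm_surface =
  fixes al1 al2 al3 a1 a2 c2 :: real
  assumes dist: "al1 \<noteq> al2" "al1 \<noteq> al3" "al2 \<noteq> al3"
    and a12: "a2 < a1" "0 < a2"
    and root: "(a1 - a2)\<^sup>2 * c2^4 + 2 * MP al1 al2 al3 a1 a2 * c2\<^sup>2 + (MQ al1 al2 al3 a1 a2)\<^sup>2 = 0"
    and c2nz: "c2 \<noteq> 0"
    and rad: "\<And>x. Mrad al1 al2 al3 a1 a2 c2 x \<ge> 0" "\<And>x. Mrad al2 al3 al1 a1 a2 c2 x \<ge> 0"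
      "\<And>x. Mrad al3 al1 al2 a1 a2 c2 x \<ge> 0"
    and den: "\<And>x. 2 * al1 * Mev al1 al2 al3 a1 a2 c2 x \<noteq> Mc1 al1 al2 al3"
      "\<And>x. 2 * al2 * Mev al1 al2 al3 a1 a2 c2 x \<noteq> Mc1 al1 al2 al3"
      "\<And>x. 2 * al3 * Mev al1 al2 al3 a1 a2 c2 x \<noteq> Mc1 al1 al2 al3"
begin

definition "b = Mb al1 al2 al3"
definition "c = Mc al1 al2 al3"
definition "c1 = Mc1 al1 al2 al3"
definition "a3 = Ma3 al1 al2 al3 a1 a2 c2"
definition "a = Ma al1 al2 al3 a1 a2 c2"
definition "k = Mk al1 al2 al3 a1 a2 c2"
definition "LL = sqrt (a1 + a3)"
definition "dd = a1 - a2"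

lemma dd_pos: "dd > 0" and a1_pos: "a1 > 0" using a12 by (simp_all add: dd_def)

lemma a3_pos: "a3 > 0"
  using a12 c2nz by (simp add: a3_def Ma3_def add_nonneg_pos)

lemma LL_pos: "LL > 0" and LL_sq: "LL\<^sup>2 = a1 + a3"
  using a1_pos a3_pos by (simp_all add: LL_def)

lemma k_eq: "k = dd / (a1 + a3)"
  by (simp add: k_def Mk_def a3_def dd_def)

lemma k_LL: "k * LL\<^sup>2 = dd"
  using a1_pos a3_pos by (simp add: k_eq LL_sq)

lemma k_pos: "0 < k" and k_less_1: "k < 1"
  using a1_pos a3_pos dd_pos a12 by (simp_all add: k_eq dd_def)

lemma a1a2a3: "a1 * a2 * a3 = c1\<^sup>2 + c2\<^sup>2"
  using a12 by (simp add: a3_def Ma3_def c1_def)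

lemma a_c2: "a * c2 = b * c1 + a1 * a3 + a2 * a3 - a1 * a2"
  using c2nz by (simp add: a_def Ma_def Let_def a3_def b_def c1_def)

text \<open>After clearing denominators this is exactly the quartic equation for \<open>c2\<close>.
  It is the comparison of quadratic coefficients in \<open>Rf_eq\<close>, as \<open>a1a2a3\<close>
  and \<open>a_c2\<close> are those of the constant and linear ones.\<close>

lemma a_sq: "a3 - a1 - a2 = c + a\<^sup>2 / 4"
proof -
  define N where "N = (a1 + a2) * c1\<^sup>2 - a1\<^sup>2 * a2\<^sup>2 + a1 * a2 * b * c1"
  have 1: "a1 * a2 * (a * c2) = N + (a1 + a2) * c2\<^sup>2"
  proof -
    have "a1 * a2 * (a * c2) = a1 * a2 * (b * c1) + (a1 + a2) * (a1 * a2 * a3) - a1 * a2 * (a1 * a2)"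
      unfolding a_c2 by (simp add: algebra_simps)
    then show ?thesis unfolding a1a2a3 N_def by (simp add: algebra_simps power2_eq_square)
  qed
  have rt: "(a1 - a2)\<^sup>2 * c2^4 + 2 * (a1^3*a2^2 + a1^2*a2^3 + (a1^2*a2 + a1*a2^2)*b*c1 + (a1^2 + a2^2)*c1^2 + 2*a1^2*a2^2*c) * c2\<^sup>2
      + N\<^sup>2 = 0"
    using root by (simp add: MP_def MQ_def Let_def N_def b_def c_def c1_def)
  have "(a1 * a2 * (a * c2))\<^sup>2 - 4 * c2\<^sup>2 * (a1 * a2) * (a1 * a2 * a3) + 4 * c2\<^sup>2 * (a1 * a2)\<^sup>2 * (a1 + a2 + c) = 0"
    unfolding 1 a1a2a3 rt[symmetric] N_def by algebra
  then have "(c2\<^sup>2 * (a1 * a2)\<^sup>2) * (a\<^sup>2 - 4 * (a3 - a1 - a2 - c)) = 0"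
    by (simp add: power2_eq_square algebra_simps)
  then have "a\<^sup>2 - 4 * (a3 - a1 - a2 - c) = 0"
    using c2nz a12 by simp
  then show ?thesis by (simp add: field_simps)
qed

sublocale ell: elliptic_modulus k
  by unfold_locales (use k_pos k_less_1 in auto)

section \<open>The profile and its differential equation\<close>

definition "th x = am (x * LL) k"
definition "hh x = a1 - dd * (sin (th x))\<^sup>2"
definition "ss x = - dd * sin (th x) * cos (th x) * LL * dn0 k (th x)"
text \<open>For the modulus that makes the metric conformal, the square root of \<open>k\<close>,
  the last factor would be \<open>t + a3\<close>.\<close>

definition "eta t = (a1 - t) * (t - a2) * (a1 + a3 - k * (a1 - t))"
definition "etap t = (a1 - t - (t - a2)) * (a1 + a3 - k * (a1 - t)) + k * (a1 - t) * (t - a2)"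
definition "mm t = c2 - a * t / 2"
definition "Rf t = - ((t + al2*al3) * (t + al3*al1) * (t + al1*al2))"
definition "Rp t = - ((t + al3*al1) * (t + al1*al2) + (t + al2*al3) * (t + al1*al2) + (t + al2*al3) * (t + al3*al1))"
definition "gf t = eta t + (mm t)\<^sup>2"
definition "gp t = etap t - a * mm t"

lemma Mev_eq: "Mev al1 al2 al3 a1 a2 c2 x = hh x / 2"
  using a1_pos by (simp add: Mev_def hh_def sn_def th_def LL_def a3_def k_def dd_def field_simps)

lemma Mev_cyc:
  "Mev al2 al3 al1 a1 a2 c2 = Mev al1 al2 al3 a1 a2 c2" "Mev al3 al1 al2 a1 a2 c2 = Mev al1 al2 al3 a1 a2 c2"
  by (rule cyclic_invariance) (rule cyclic_invariance(6)[symmetric])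

lemma Ma_cyc: "Ma al2 al3 al1 a1 a2 c2 = a" "Ma al3 al1 al2 a1 a2 c2 = a"
  unfolding a_def by (rule cyclic_invariance) (rule cyclic_invariance(4)[symmetric])

lemma th_deriv: "(th has_real_derivative LL * dn0 k (th x)) (at x)"
proof -
  have "((\<lambda>x. am (x * LL) k) has_real_derivative dn0 k (am (x * LL) k) * LL) (at x)"
    by (rule DERIV_chain2[OF ell.am_has_derivative]) (auto intro!: derivative_eq_intros)
  then show ?thesis unfolding th_def[abs_def] by (simp add: mult.commute)
qed

lemma hh_deriv: "(hh has_real_derivative 2 * ss x) (at x)"
  unfolding hh_def[abs_def] ss_def
  by (auto intro!: derivative_eq_intros th_deriv)

lemma dn0_deriv: "(dn0 k has_real_derivative - k\<^sup>2 * sin t * cos t / dn0 k t) (at t)"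
  unfolding dn0_def[abs_def] using ell.dn0_sq_pos[of t]
  by (auto intro!: derivative_eq_intros simp: field_simps)

lemma hh_u: "a1 - hh x = dd * (sin (th x))\<^sup>2" and hh_v: "hh x - a2 = dd * (cos (th x))\<^sup>2"
  by (simp_all add: hh_def dd_def cos_squared_eq algebra_simps)

lemma hh_bounds: "a2 \<le> hh x" "hh x \<le> a1" "0 < hh x"
proof -
  have "0 \<le> dd * (sin (th x))\<^sup>2" "0 \<le> dd * (cos (th x))\<^sup>2" using dd_pos by simp_all
  then show "a2 \<le> hh x" "hh x \<le> a1" unfolding hh_u[symmetric] hh_v[symmetric] by simp_all
  then show "0 < hh x" using a12 by simp
qed

lemma LD: "a1 + a3 - k * (a1 - hh x) = LL\<^sup>2 * (dn0 k (th x))\<^sup>2"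
  unfolding ell.dn0_sq hh_u k_LL[symmetric] LL_sq[symmetric]
  by (simp add: power2_eq_square algebra_simps)

lemma ss_sq: "(ss x)\<^sup>2 = eta (hh x)"
  unfolding eta_def LD unfolding hh_u hh_v ss_def
  by (simp add: power2_eq_square algebra_simps)

text \<open>Formally \<open>ss^2 = eta h\<close> is differentiated and divided by
  \<open>2 * ss\<close>. Since \<open>ss\<close> vanishes at the extrema of \<open>h\<close>, the
  computation goes through the amplitude instead.\<close>

lemma ss_deriv: "(ss has_real_derivative etap (hh x)) (at x)"
proof -
  let ?S = "sin (th x)" and ?C = "cos (th x)" and ?D = "dn0 k (th x)"
  have D: "?D \<noteq> 0" using ell.dn0_pos[of "th x"] by simp
  have "(ss has_real_derivative
     - dd * LL * ((?C * (LL * ?D) * ?C + ?S * (- ?S * (LL * ?D))) * ?D + ?S * ?C * (- k\<^sup>2 * ?S * ?C / ?D * (LL * ?D)))) (at x)"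
    unfolding ss_def[abs_def]
    by (auto intro!: derivative_eq_intros th_deriv DERIV_chain2[OF dn0_deriv th_deriv] simp: algebra_simps)
  also have "- dd * LL * ((?C * (LL * ?D) * ?C + ?S * (- ?S * (LL * ?D))) * ?D + ?S * ?C * (- k\<^sup>2 * ?S * ?C / ?D * (LL * ?D)))
    = (dd * ?S\<^sup>2 - dd * ?C\<^sup>2) * (LL\<^sup>2 * ?D\<^sup>2) + dd * (k * LL\<^sup>2) * k * ?S\<^sup>2 * ?C\<^sup>2"
    using D by (simp add: power2_eq_square algebra_simps)
  also have "\<dots> = etap (hh x)"
    unfolding etap_def LD unfolding hh_u hh_v k_LL by (simp add: algebra_simps)
  finally show ?thesis .
qed

text \<open>The definitions of \<open>a3\<close> and \<open>a\<close> and the equation for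
  \<open>c2\<close> say precisely that \<open>Rf - mm^2\<close> is the cubic with leading
  coefficient -1 and roots \<open>a1\<close>, \<open>a2\<close>, \<open>-a3\<close>.\<close>

lemma Rf_eq: "Rf t = (a1 - t) * (t - a2) * (t + a3) + (mm t)\<^sup>2"
proof -
  have "Rf t = - (t^3 + c * t\<^sup>2 + b * c1 * t + c1\<^sup>2)"
    unfolding Rf_def c_def b_def c1_def Mc_def Mb_def Mc1_def by algebra
  also have "\<dots> = - (t^3) - (a3 - a1 - a2) * t\<^sup>2 + a\<^sup>2 / 4 * t\<^sup>2 - (a * c2 - a1 * a3 - a2 * a3 + a1 * a2) * t - (a1 * a2 * a3 - c2\<^sup>2)"
    unfolding a_sq a_c2 a1a2a3 by (simp add: algebra_simps)
  also have "\<dots> = (a1 - t) * (t - a2) * (t + a3) + (mm t)\<^sup>2"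
    unfolding mm_def by (simp add: power2_eq_square power3_eq_cube field_simps)
  finally show ?thesis .
qed

lemma gf_Rf: "gf t = Rf t + (1 - k) * (a1 - t)\<^sup>2 * (t - a2)"
  unfolding gf_def eta_def Rf_eq by (simp add: power2_eq_square algebra_simps)

lemma al_nz: "al1 \<noteq> 0" "al2 \<noteq> 0" "al3 \<noteq> 0"
  using den[of 0] by (auto simp: Mc1_def)

text \<open>The phase denominators are \<open>al1 * (h + al2 * al3)\<close> and its cyclic
  analogues, so their nonvanishing turns the nonnegative radicands into positive ones.\<close>

lemma q_pos:
  "(hh x + al2 * al3) / ((al1 - al2) * (al1 - al3)) > 0"
  "(hh x + al3 * al1) / ((al2 - al3) * (al2 - al1)) > 0"
  "(hh x + al1 * al2) / ((al3 - al1) * (al3 - al2)) > 0"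
proof -
  have "hh x + al2 * al3 \<noteq> 0" "hh x + al3 * al1 \<noteq> 0" "hh x + al1 * al2 \<noteq> 0"
  proof -
    have "al1 * (hh x + al2 * al3) \<noteq> 0" "al2 * (hh x + al3 * al1) \<noteq> 0" "al3 * (hh x + al1 * al2) \<noteq> 0"
      using den[of x] by (auto simp: Mev_eq Mc1_def algebra_simps)
    then show "hh x + al2 * al3 \<noteq> 0" "hh x + al3 * al1 \<noteq> 0" "hh x + al1 * al2 \<noteq> 0" by auto
  qed
  moreover have "(hh x + al2 * al3) / ((al1 - al2) * (al1 - al3)) \<ge> 0"
    "(hh x + al3 * al1) / ((al2 - al3) * (al2 - al1)) \<ge> 0"
    "(hh x + al1 * al2) / ((al3 - al1) * (al3 - al2)) \<ge> 0"
    using rad[of x] by (simp_all add: Mrad_def Mev_cyc Mev_eq)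
  ultimately show "(hh x + al2 * al3) / ((al1 - al2) * (al1 - al3)) > 0"
    "(hh x + al3 * al1) / ((al2 - al3) * (al2 - al1)) > 0"
    "(hh x + al1 * al2) / ((al3 - al1) * (al3 - al2)) > 0"
    using dist by (simp_all add: less_le)
qed

lemma d_nz: "hh x + al2 * al3 \<noteq> 0" "hh x + al3 * al1 \<noteq> 0" "hh x + al1 * al2 \<noteq> 0"
  using q_pos[of x] by auto

text \<open>The product of the three squared moduli is \<open>Rf\<close> divided by the squared
  Vandermonde determinant.\<close>

lemma Rf_pos: "Rf (hh x) > 0"
proof -
  let ?V = "(al1 - al2) * (al2 - al3) * (al3 - al1)"
  have "0 < (hh x + al2 * al3) / ((al1 - al2) * (al1 - al3)) * ((hh x + al3 * al1) / ((al2 - al3) * (al2 - al1)))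
     * ((hh x + al1 * al2) / ((al3 - al1) * (al3 - al2)))"
    by (intro mult_pos_pos q_pos)
  also have "\<dots> = ((hh x + al2 * al3) * (hh x + al3 * al1) * (hh x + al1 * al2)) /
     ((al1 - al2) * (al1 - al3) * ((al2 - al3) * (al2 - al1)) * ((al3 - al1) * (al3 - al2)))"
    by simp
  also have "(al1 - al2) * (al1 - al3) * ((al2 - al3) * (al2 - al1)) * ((al3 - al1) * (al3 - al2)) = - (?V\<^sup>2)"
    by algebra
  finally have "0 < Rf (hh x) / ?V\<^sup>2" by (simp add: Rf_def)
  then show ?thesis by (simp add: zero_less_divide_iff)
qed

lemma gf_ge_Rf: "Rf (hh x) \<le> gf (hh x)"
  unfolding gf_Rf using k_less_1 hh_bounds[of x] by simp

lemma gf_pos: "gf (hh x) > 0"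
  using gf_ge_Rf[of x] Rf_pos[of x] by linarith

lemma gf_ss: "gf (hh x) = (ss x)\<^sup>2 + (mm (hh x))\<^sup>2"
  by (simp add: gf_def ss_sq)

end

section \<open>The energy density of the lift\<close>

lemma inv_sqrt:
  assumes "0 < (y::real)"
  shows "inverse (sqrt y) = sqrt y / y"
proof -
  have "sqrt y / y = sqrt y / (sqrt y * sqrt y)" using assms by simp
  also have "\<dots> = inverse (sqrt y)" using assms by (simp only: divide_inverse inverse_mult_distrib) simp
  finally show ?thesis ..
qed

text \<open>The contribution of one coordinate, of squared modulus \<open>d / D\<close>, to the
  normal component along the first field. The terms with \<open>p\<close> drop out because they
  multiply the real number \<open>mu * cnj mu\<close>.\<close>

lemma Im_second_derivative_tangent:
  fixes s m e a d D p r :: real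
  assumes "d \<noteq> 0" "D \<noteq> 0"
  shows "Im ((of_real p * Complex (s / d) (m / d) + of_real r * (Complex (e / d - 2 * s\<^sup>2 / d\<^sup>2) (- a * s / d - 2 * s * m / d\<^sup>2)
      + Complex (s / d) (m / d) * Complex (s / d) (m / d))) * cnj (Complex (s / d) (m / d)) * of_real (d / D))
    = r * ((- a * s\<^sup>2 - e * m) * (1 / d / D) + (s\<^sup>2 + m\<^sup>2) * m * (1 / d\<^sup>2 / D))"
proof -
  define x where "x = 1 / d"
  have x: "y / d = y * x" "y / d\<^sup>2 = y * x\<^sup>2" for y by (simp_all add: x_def power2_eq_square)
  have "(p * (s * x) + r * (e * x - 2 * s\<^sup>2 * x\<^sup>2 + (s * x * (s * x) - m * x * (m * x)))) * - (m * x)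
      + (p * (m * x) + r * (- a * s * x - 2 * s * m * x\<^sup>2 + (s * x * (m * x) + m * x * (s * x)))) * (s * x)
    = x * x * (r * ((- a * s\<^sup>2 - e * m) + (s\<^sup>2 + m\<^sup>2) * m * x))"
    by algebra
  then show ?thesis
    unfolding x by simp (simp add: x_def power2_eq_square assms divide_simps)
qed

lemma Im_second_derivative_vertical:
  fixes s m e a d D p r \<alpha> :: real
  assumes "d \<noteq> 0" "D \<noteq> 0"
  shows "Im ((of_real p * Complex (s / d) (m / d) + of_real r * (Complex (e / d - 2 * s\<^sup>2 / d\<^sup>2) (- a * s / d - 2 * s * m / d\<^sup>2)
      + Complex (s / d) (m / d) * Complex (s / d) (m / d))) * cnj (\<i> * of_real \<alpha>) * of_real (d / D))
    = - (p * s + r * e) * (\<alpha> / D) + r * (s\<^sup>2 + m\<^sup>2) * (\<alpha> / d / D)"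
  using assms by (simp add: divide_simps power2_eq_square) (simp add: algebra_simps)

lemma Im_vertical_tangent:
  fixes s m d D \<alpha> :: real
  assumes "d \<noteq> 0" "D \<noteq> 0"
  shows "Im (\<i> * of_real \<alpha> * (\<i> * of_real \<alpha>) * cnj (Complex (s / d) (m / d)) * of_real (d / D)) = m * (\<alpha>\<^sup>2 / D)"
  using assms by (simp add: power2_eq_square)

lemma Im_vertical_vertical:
  fixes q \<alpha> :: real
  shows "Im (\<i> * of_real \<alpha> * (\<i> * of_real \<alpha>) * cnj (\<i> * of_real \<alpha>) * of_real q) = \<alpha>^3 * q"
  by (simp add: power3_eq_cube)

section \<open>Derivatives of the lift as diagonal multiples of the lift\<close>

context hm_surface
begin

text \<open>The logarithmic \<open>x\<close>-derivative of a coordinate: the real part comes from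
  its radius, the imaginary part from its phase.\<close>

definition "mu g x = Complex (ss x / (hh x + g)) (mm (hh x) / (hh x + g))"
definition "mup g x = Complex (etap (hh x) / (hh x + g) - 2 * (ss x)\<^sup>2 / (hh x + g)\<^sup>2)
  (- a * ss x / (hh x + g) - 2 * ss x * mm (hh x) / (hh x + g)\<^sup>2)"
text \<open>The reciprocal of the weight \<open>w\<close>, which is also the coefficient
  \<open>sqrt (G / E)\<close> in the Laplacian.\<close>

definition "rr x = sqrt (Rf (hh x) / gf (hh x))"
definition "rp x = (Rp (hh x) * gf (hh x) - Rf (hh x) * gp (hh x)) / (gf (hh x))\<^sup>2 * ss x / rr x"

lemma rr_pos: "rr x > 0"
  using Rf_pos gf_pos by (simp add: rr_def)

lemma mm_deriv: "((\<lambda>x. mm (hh x)) has_real_derivative - a * ss x) (at x)"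
  unfolding mm_def by (auto intro!: derivative_eq_intros hh_deriv)

lemma mu_deriv:
  assumes "hh x + g \<noteq> 0"
  shows "(mu g has_vector_derivative mup g x) (at x)"
proof -
  have d: "((\<lambda>x. hh x + g) has_real_derivative 2 * ss x) (at x)"
    by (auto intro!: derivative_eq_intros hh_deriv)
  have q: "(e * d - s * (2 * v)) / (d * d) = e / d - 2 * v * s / d\<^sup>2" if "d \<noteq> 0" for e d s v :: real
    using that by (simp add: diff_divide_distrib power2_eq_square)
  have "((\<lambda>x. ss x / (hh x + g)) has_real_derivative etap (hh x) / (hh x + g) - 2 * (ss x)\<^sup>2 / (hh x + g)\<^sup>2) (at x)"
    using DERIV_divide[OF ss_deriv d assms] unfolding q[OF assms] by (simp add: power2_eq_square mult.assoc)
  moreover have "((\<lambda>x. mm (hh x) / (hh x + g)) has_real_derivative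
      - a * ss x / (hh x + g) - 2 * ss x * mm (hh x) / (hh x + g)\<^sup>2) (at x)"
    using DERIV_divide[OF mm_deriv d assms] unfolding q[OF assms] .
  ultimately show ?thesis
    unfolding has_vector_derivative_complex_iff mu_def mup_def by simp
qed

lemma rr_deriv: "(rr has_real_derivative rp x) (at x)"
proof -
  have R: "((\<lambda>x. Rf (hh x)) has_real_derivative Rp (hh x) * (2 * ss x)) (at x)"
    unfolding Rf_def Rp_def by (auto intro!: derivative_eq_intros hh_deriv simp: algebra_simps)
  have g: "((\<lambda>x. gf (hh x)) has_real_derivative gp (hh x) * (2 * ss x)) (at x)"
    unfolding gf_def gp_def eta_def etap_def mm_def
    by (auto intro!: derivative_eq_intros hh_deriv simp: field_simps)
  have "((\<lambda>x. Rf (hh x) / gf (hh x)) has_real_derivative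
     (Rp (hh x) * (2 * ss x) * gf (hh x) - Rf (hh x) * (gp (hh x) * (2 * ss x))) / (gf (hh x) * gf (hh x))) (at x)"
    by (rule DERIV_divide[OF R g]) (use gf_pos[of x] in simp)
  from DERIV_chain2[OF DERIV_real_sqrt this] show ?thesis
    using Rf_pos[of x] gf_pos[of x] unfolding rr_def[abs_def] rp_def
    by (auto simp: power2_eq_square field_simps elim!: DERIV_cong)
qed

text \<open>Stated for one cyclic triple, so that all three coordinates are instances. In the phase
  the factor \<open>ai\<close> cancels against the denominator
  \<open>ai * (hh z + g)\<close>.\<close>

lemma comp_facts:
  fixes ai aj ak :: real
  defines "g \<equiv> aj * ak" and "D \<equiv> (ai - aj) * (ai - ak)"
  assumes ev: "Mev ai aj ak a1 a2 c2 = Mev al1 al2 al3 a1 a2 c2" and aa: "Ma ai aj ak a1 a2 c2 = a"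
    and nz: "ai \<noteq> 0" and pos: "\<And>x. (hh x + g) / D > 0"
  shows comp_dx: "((\<lambda>t. Mcomp ai aj ak a1 a2 c2 (t, y)) has_vector_derivative mu g x * Mcomp ai aj ak a1 a2 c2 (x, y)) (at x)"
    and comp_dy: "((\<lambda>t. Mcomp ai aj ak a1 a2 c2 (x, t)) has_vector_derivative \<i> * of_real ai * Mcomp ai aj ak a1 a2 c2 (x, y)) (at y)"
    and comp_norm: "Mcomp ai aj ak a1 a2 c2 p * cnj (Mcomp ai aj ak a1 a2 c2 p) = of_real ((hh (fst p) + g) / D)"
    and comp_cont: "continuous_on UNIV (Mcomp ai aj ak a1 a2 c2)"
proof -
  have dnz: "hh x + g \<noteq> 0" for x using pos[of x] by auto
  have MF: "MF ai aj ak a1 a2 c2 x = sqrt ((hh x + g) / D)" for x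
    by (simp add: MF_def Mrad_def ev Mev_eq g_def D_def)
  have MFd: "(MF ai aj ak a1 a2 c2 has_real_derivative MF ai aj ak a1 a2 c2 x * (ss x / (hh x + g))) (at x)" for x
  proof -
    have D: "D \<noteq> 0" by (metis div_by_0 less_irrefl pos)
    have "((\<lambda>x. (hh x + g) / D) has_real_derivative 2 * ss x / D) (at x)"
      using D by (auto intro!: derivative_eq_intros hh_deriv)
    from DERIV_chain2[OF DERIV_real_sqrt this] pos[of x]
    have "((\<lambda>x. sqrt ((hh x + g) / D)) has_real_derivative
       inverse (sqrt ((hh x + g) / D)) / 2 * (2 * ss x / D)) (at x)" by simp
    moreover have "inverse (sqrt ((hh x + g) / D)) / 2 * (2 * ss x / D) = sqrt ((hh x + g) / D) * (ss x / (hh x + g))"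
    proof -
      have "inverse (sqrt ((hh x + g) / D)) = sqrt ((hh x + g) / D) / ((hh x + g) / D)"
        by (rule inv_sqrt[OF pos])
      moreover have "S / (d / D) / 2 * (2 * s / D) = S * (s / d)" if "d \<noteq> 0" for S d s
        using that D by (simp add: divide_simps)
      ultimately show ?thesis using dnz[of x] by (simp only:)
    qed
    ultimately show ?thesis unfolding MF[abs_def] by simp
  qed
  have hc: "continuous_on UNIV hh"
    by (rule DERIV_continuous_on[where D="\<lambda>x. 2 * ss x"]) (simp add: hh_deriv)
  have MGd: "(MG ai aj ak a1 a2 c2 has_real_derivative mm (hh x) / (hh x + g)) (at x)" for x
  proof -
    have f: "ai * ((c2 - a * (hh z / 2)) / (2 * ai * (hh z / 2) - Mc1 ai aj ak)) = mm (hh z) / (hh z + g)" for z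
    proof -
      have "2 * ai * (hh z / 2) - Mc1 ai aj ak = ai * (hh z + g)"
        by (simp add: Mc1_def g_def algebra_simps)
      then show ?thesis using nz dnz[of z] by (simp add: mm_def)
    qed
    let ?f = "\<lambda>z. (c2 - a * (hh z / 2)) / (2 * ai * (hh z / 2) - Mc1 ai aj ak)"
    have fe: "?f = (\<lambda>z. mm (hh z) / (hh z + g) / ai)"
      unfolding f[symmetric] using nz by simp
    have "continuous_on UNIV ?f"
      unfolding fe using dnz nz by (auto simp: mm_def intro!: continuous_intros hc)
    then have "(sint ?f 0 has_real_derivative ?f x) (at x)"
      by (rule sint_has_derivative)
    then have "((\<lambda>x. ai * sint ?f 0 x) has_real_derivative ai * ?f x) (at x)"
      by (rule DERIV_cmult)
    then show ?thesis unfolding f MG_def[abs_def] aa ev Mev_eq .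
  qed
  show "((\<lambda>t. Mcomp ai aj ak a1 a2 c2 (t, y)) has_vector_derivative mu g x * Mcomp ai aj ak a1 a2 c2 (x, y)) (at x)"
  proof -
    have "((\<lambda>t. MG ai aj ak a1 a2 c2 t + ai * y) has_real_derivative mm (hh x) / (hh x + g)) (at x)"
      by (auto intro!: derivative_eq_intros MGd)
    note has_vector_derivative_mult[OF has_vector_derivative_of_real[OF MFd] has_vector_derivative_cis[OF this]]
    then show ?thesis
      unfolding Mcomp_def fst_conv snd_conv by (rule has_vector_derivative_eq_rhs) (simp add: mu_def Complex_eq algebra_simps)
  qed
  show "((\<lambda>t. Mcomp ai aj ak a1 a2 c2 (x, t)) has_vector_derivative \<i> * of_real ai * Mcomp ai aj ak a1 a2 c2 (x, y)) (at y)"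
  proof -
    have "((\<lambda>t. MG ai aj ak a1 a2 c2 x + ai * t) has_real_derivative ai) (at y)"
      by (auto intro!: derivative_eq_intros)
    note has_vector_derivative_mult_right[OF has_vector_derivative_cis[OF this], of "of_real (MF ai aj ak a1 a2 c2 x)"]
    then show ?thesis
      unfolding Mcomp_def fst_conv snd_conv by (rule has_vector_derivative_eq_rhs) (simp add: algebra_simps)
  qed
  show "Mcomp ai aj ak a1 a2 c2 p * cnj (Mcomp ai aj ak a1 a2 c2 p) = of_real ((hh (fst p) + g) / D)"
    using pos[of "fst p"] by (subst complex_norm_square[symmetric]) (simp add: Mcomp_def norm_mult MF del: of_real_divide)
  have "continuous_on UNIV (MF ai aj ak a1 a2 c2)" "continuous_on UNIV (MG ai aj ak a1 a2 c2)"
    using MFd MGd by (auto intro!: DERIV_continuous_on)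
  then show "continuous_on UNIV (Mcomp ai aj ak a1 a2 c2)"
    unfolding Mcomp_def[abs_def]
    by (auto simp: cis_conv_exp intro!: continuous_intros elim!: continuous_on_compose2)
qed

definition "z1 = Mcomp al1 al2 al3 a1 a2 c2"
definition "z2 = Mcomp al2 al3 al1 a1 a2 c2"
definition "z3 = Mcomp al3 al1 al2 a1 a2 c2"

lemmas z1_facts = comp_facts[OF refl a_def[symmetric] al_nz(1) q_pos(1), folded z1_def]
lemmas z2_facts = comp_facts[OF Mev_cyc(1) Ma_cyc(1) al_nz(2) q_pos(2), folded z2_def]
lemmas z3_facts = comp_facts[OF Mev_cyc(2) Ma_cyc(2) al_nz(3) q_pos(3), folded z3_def]

definition "q1 x = (hh x + al2 * al3) / ((al1 - al2) * (al1 - al3))"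
definition "q2 x = (hh x + al3 * al1) / ((al2 - al3) * (al2 - al1))"
definition "q3 x = (hh x + al1 * al2) / ((al3 - al1) * (al3 - al2))"

text \<open>Differentiation acts on the lift by diagonal matrices. In this notation every Hermitian
  product becomes a sum weighted by \<open>q1\<close>, \<open>q2\<close>, \<open>q3\<close>, in
  which the phases have disappeared.\<close>

definition "dvec l1 l2 l3 p = vec3 (l1 * z1 p) (l2 * z2 p) (l3 * z3 p)"

lemma hdot_dvec: "hdot (dvec l1 l2 l3 p) (dvec k1 k2 k3 p)
   = l1 * cnj k1 * of_real (q1 (fst p)) + l2 * cnj k2 * of_real (q2 (fst p)) + l3 * cnj k3 * of_real (q3 (fst p))"
proof -
  have "l * z * cnj (k * z) = l * cnj k * (z * cnj z)" for l k z :: complex by simp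
  then show ?thesis
    unfolding dvec_def hdot_vec3 q1_def q2_def q3_def
    by (simp only: z1_facts(3) z2_facts(3) z3_facts(3))
qed

lemma M_lift_dvec: "M_lift al1 al2 al3 a1 a2 c2 p = dvec 1 1 1 p"
  by (simp add: M_lift_def dvec_def z1_def z2_def z3_def)

definition "metE x = gf (hh x) * hh x / Rf (hh x)"
definition "\<Psi>x p = dvec (mu (al2 * al3) (fst p)) (mu (al3 * al1) (fst p)) (mu (al1 * al2) (fst p)) p"
definition "\<Psi>y p = dvec (\<i> * of_real al1) (\<i> * of_real al2) (\<i> * of_real al3) p"
definition "\<Psi>yy p = dvec (\<i> * of_real al1 * (\<i> * of_real al1)) (\<i> * of_real al2 * (\<i> * of_real al2))
  (\<i> * of_real al3 * (\<i> * of_real al3)) p"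
definition "zc g x = of_real (rp x) * mu g x + of_real (rr x) * (mup g x + mu g x * mu g x)"
definition "Zx p = dvec (zc (al2 * al3) (fst p)) (zc (al3 * al1) (fst p)) (zc (al1 * al2) (fst p)) p"

lemma metE_pos: "metE x > 0"
  using gf_pos[of x] Rf_pos[of x] hh_bounds(3)[of x] by (simp add: metE_def)

lemma sqrt_ratio: "sqrt (hh x / metE x) = rr x" "sqrt (metE x / hh x) = 1 / rr x" "sqrt (metE x * hh x) = hh x / rr x"
proof -
  have h: "hh x \<noteq> 0" using hh_bounds(3)[of x] by simp
  show "sqrt (hh x / metE x) = rr x" using h by (simp add: metE_def rr_def)
  show "sqrt (metE x / hh x) = 1 / rr x" using h by (simp add: metE_def rr_def real_sqrt_divide)
  have "metE x * hh x = (hh x)\<^sup>2 * (gf (hh x) / Rf (hh x))" by (simp add: metE_def power2_eq_square)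
  then show "sqrt (metE x * hh x) = hh x / rr x"
    using hh_bounds(3)[of x] by (simp add: rr_def real_sqrt_mult real_sqrt_divide)
qed

lemma zc_deriv:
  assumes g: "hh x + g \<noteq> 0" and z: "((\<lambda>t. z (t, y)) has_vector_derivative mu g x * z (x, y)) (at x)"
  shows "((\<lambda>t. of_real (rr t) * (mu g t * z (t, y))) has_vector_derivative zc g x * z (x, y)) (at x)"
  by (rule has_vector_derivative_eq_rhs[OF has_vector_derivative_mult[OF has_vector_derivative_of_real[OF rr_deriv]
        has_vector_derivative_mult[OF mu_deriv[OF g] z]]])
    (simp add: zc_def algebra_simps)

lemma D_nz: "(al1 - al2) * (al1 - al3) \<noteq> 0" "(al2 - al3) * (al2 - al1) \<noteq> 0" "(al3 - al1) * (al3 - al2) \<noteq> 0"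
  using dist by simp_all

lemma mu_q: "mu (al2 * al3) x * of_real (q1 x) = Complex (ss x) (mm (hh x)) * of_real (1 / ((al1 - al2) * (al1 - al3)))"
  "mu (al3 * al1) x * of_real (q2 x) = Complex (ss x) (mm (hh x)) * of_real (1 / ((al2 - al3) * (al2 - al1)))"
  "mu (al1 * al2) x * of_real (q3 x) = Complex (ss x) (mm (hh x)) * of_real (1 / ((al3 - al1) * (al3 - al2)))"
  using d_nz[of x] by (simp_all add: mu_def q1_def q2_def q3_def complex_eq_iff)

lemma mu_mu_q:
  "mu (al2 * al3) x * cnj (mu (al2 * al3) x) * of_real (q1 x) = of_real (gf (hh x) * (1 / (hh x + al2 * al3) / ((al1 - al2) * (al1 - al3))))"
  "mu (al3 * al1) x * cnj (mu (al3 * al1) x) * of_real (q2 x) = of_real (gf (hh x) * (1 / (hh x + al3 * al1) / ((al2 - al3) * (al2 - al1))))"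
  "mu (al1 * al2) x * cnj (mu (al1 * al2) x) * of_real (q3 x) = of_real (gf (hh x) * (1 / (hh x + al1 * al2) / ((al3 - al1) * (al3 - al2))))"
proof -
  have aux: "Complex (s / d) (m / d) * cnj (Complex (s / d) (m / d)) * of_real (d / D) = of_real ((s\<^sup>2 + m\<^sup>2) * (1 / d / D))"
    if "d \<noteq> 0" for s m d D
  proof -
    have "Complex (s / d) (m / d) * cnj (Complex (s / d) (m / d)) = of_real ((s / d)\<^sup>2 + (m / d)\<^sup>2)"
      by (simp add: complex_eq_iff power2_eq_square)
    moreover have "((s / d)\<^sup>2 + (m / d)\<^sup>2) * (d / D) = (s\<^sup>2 + m\<^sup>2) * (1 / d / D)"
      using that by (simp add: power2_eq_square add_divide_distrib distrib_right)
    ultimately show ?thesis by (simp only: of_real_mult[symmetric])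
  qed
  show "mu (al2 * al3) x * cnj (mu (al2 * al3) x) * of_real (q1 x) = of_real (gf (hh x) * (1 / (hh x + al2 * al3) / ((al1 - al2) * (al1 - al3))))"
    "mu (al3 * al1) x * cnj (mu (al3 * al1) x) * of_real (q2 x) = of_real (gf (hh x) * (1 / (hh x + al3 * al1) / ((al2 - al3) * (al2 - al1))))"
    "mu (al1 * al2) x * cnj (mu (al1 * al2) x) * of_real (q3 x) = of_real (gf (hh x) * (1 / (hh x + al1 * al2) / ((al3 - al1) * (al3 - al2))))"
    unfolding mu_def q1_def q2_def q3_def gf_ss by (rule aux, rule d_nz)+
qed

lemma lift_unit: "hdot (dvec 1 1 1 p) (dvec 1 1 1 p) = 1"
proof -
  have "q1 (fst p) + q2 (fst p) + q3 (fst p) = 1"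
    unfolding q1_def q2_def q3_def by (rule partial_fractions_alpha(4)[OF dist])
  then show ?thesis unfolding hdot_dvec by (simp flip: of_real_add)
qed

lemma lift_horiz_x: "hdot (\<Psi>x p) (dvec 1 1 1 p) = 0"
  unfolding hdot_dvec \<Psi>x_def complex_cnj_one mult_1_right mu_q distrib_left[symmetric] of_real_add[symmetric]
    partial_fractions_alpha(1)[OF dist] by simp

lemma lift_horiz_y: "hdot (\<Psi>y p) (dvec 1 1 1 p) = 0"
proof -
  have "hdot (\<Psi>y p) (dvec 1 1 1 p) = \<i> * of_real (al1 * q1 (fst p) + al2 * q2 (fst p) + al3 * q3 (fst p))"
    unfolding hdot_dvec \<Psi>y_def by (simp add: algebra_simps)
  also have "al1 * q1 (fst p) + al2 * q2 (fst p) + al3 * q3 (fst p) = 0"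
    unfolding q1_def q2_def q3_def by (rule partial_fractions_alpha(5)[OF dist])
  finally show ?thesis by simp
qed

lemma lift_E: "hdot (\<Psi>x p) (\<Psi>x p) = of_real (metE (fst p))"
  unfolding hdot_dvec \<Psi>x_def mu_mu_q of_real_add[symmetric] distrib_left[symmetric]
    partial_fractions_radicand(1)[OF dist d_nz] by (simp add: metE_def Rf_def)

lemma lift_F: "hdot (\<Psi>x p) (\<Psi>y p) = 0"
proof -
  let ?x = "fst p"
  have "hdot (\<Psi>x p) (\<Psi>y p) = - \<i> * (of_real al1 * (mu (al2 * al3) ?x * of_real (q1 ?x)) +
      of_real al2 * (mu (al3 * al1) ?x * of_real (q2 ?x)) + of_real al3 * (mu (al1 * al2) ?x * of_real (q3 ?x)))"
    unfolding hdot_dvec \<Psi>x_def \<Psi>y_def by (simp add: algebra_simps)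
  also have "\<dots> = - \<i> * (Complex (ss ?x) (mm (hh ?x)) * of_real (al1 / ((al1 - al2) * (al1 - al3))
      + al2 / ((al2 - al3) * (al2 - al1)) + al3 / ((al3 - al1) * (al3 - al2))))"
    unfolding mu_q by (simp add: algebra_simps)
  finally show ?thesis unfolding partial_fractions_alpha(2)[OF dist] by simp
qed

lemma lift_G: "hdot (\<Psi>y p) (\<Psi>y p) = of_real (hh (fst p))"
proof -
  have "hdot (\<Psi>y p) (\<Psi>y p) = of_real (al1\<^sup>2 * q1 (fst p) + al2\<^sup>2 * q2 (fst p) + al3\<^sup>2 * q3 (fst p))"
  proof -
    have "\<i> * of_real \<alpha> * cnj (\<i> * of_real \<alpha>) = of_real (\<alpha>\<^sup>2)" for \<alpha>
      by (simp add: complex_eq_iff power2_eq_square)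
    then show ?thesis unfolding hdot_dvec \<Psi>y_def by (simp only: of_real_add of_real_mult)
  qed
  also have "al1\<^sup>2 * q1 (fst p) + al2\<^sup>2 * q2 (fst p) + al3\<^sup>2 * q3 (fst p) = hh (fst p)"
    unfolding q1_def q2_def q3_def by (rule partial_fractions_alpha(6)[OF dist])
  finally show ?thesis .
qed

definition "Vn p = (rr (fst p) / hh (fst p)) *\<^sub>R (Zx p + (1 / rr (fst p)) *\<^sub>R \<Psi>yy p)"

lemma energy_dens_lift:
  "energy_dens (M_lift al1 al2 al3 a1 a2 c2) p
    = hh (fst p) / rr (fst p) * (1 + (1/8) * (norm (horiz (dvec 1 1 1 p) (Vn p)))\<^sup>2)"
proof -
  have "energy_dens (M_lift al1 al2 al3 a1 a2 c2) p
    = sqrt (metE (fst p) * hh (fst p)) * (1 + (1/8) * (norm (horiz (M_lift al1 al2 al3 a1 a2 c2 p)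
     ((1 / sqrt (metE (fst p) * hh (fst p))) *\<^sub>R (Zx p + sqrt (metE (fst p) / hh (fst p)) *\<^sub>R \<Psi>yy p))))\<^sup>2)"
  proof (rule energy_dens_orthogonal_lift[where \<Psi>x=\<Psi>x and \<Psi>y=\<Psi>y])
    show "((\<lambda>t. M_lift al1 al2 al3 a1 a2 c2 (t, y)) has_vector_derivative \<Psi>x (x, y)) (at x)" for x y
      unfolding M_lift_dvec \<Psi>x_def dvec_def mult_1_left fst_conv
      by (intro has_vector_derivative_vec3 z1_facts z2_facts z3_facts)
    show "((\<lambda>t. M_lift al1 al2 al3 a1 a2 c2 (x, t)) has_vector_derivative \<Psi>y (x, y)) (at y)" for x y
      unfolding M_lift_dvec \<Psi>y_def dvec_def mult_1_left
      by (intro has_vector_derivative_vec3 z1_facts z2_facts z3_facts)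
    show "((\<lambda>t. \<Psi>y (x, t)) has_vector_derivative \<Psi>yy (x, y)) (at y)" for x y
      unfolding \<Psi>y_def \<Psi>yy_def dvec_def mult.assoc[of "\<i> * of_real al1" "\<i> * of_real al1"]
        mult.assoc[of "\<i> * of_real al2" "\<i> * of_real al2"] mult.assoc[of "\<i> * of_real al3" "\<i> * of_real al3"]
      by (intro has_vector_derivative_vec3 has_vector_derivative_mult_right z1_facts z2_facts z3_facts)
    have "((\<lambda>t. vec3 (of_real (rr t) * (mu (al2 * al3) t * z1 (t, y))) (of_real (rr t) * (mu (al3 * al1) t * z2 (t, y)))
       (of_real (rr t) * (mu (al1 * al2) t * z3 (t, y)))) has_vector_derivative Zx (x, y)) (at x)" for x y
      unfolding Zx_def dvec_def fst_conv
      by (intro has_vector_derivative_vec3 zc_deriv d_nz z1_facts z2_facts z3_facts)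
    then show "((\<lambda>t. sqrt (hh t / metE t) *\<^sub>R \<Psi>x (t, y)) has_vector_derivative Zx (x, y)) (at x)" for x y
      by (simp add: sqrt_ratio \<Psi>x_def dvec_def vec3_algebra scaleR_conv_of_real[where 'a=complex])
  qed (simp_all only: M_lift_dvec lift_unit lift_horiz_x lift_horiz_y lift_E lift_F lift_G metE_pos hh_bounds)
  then show ?thesis
    by (simp add: sqrt_ratio M_lift_dvec Vn_def)
qed

lemma energy_dens_continuous: "continuous_on UNIV (energy_dens (M_lift al1 al2 al3 a1 a2 c2))"
proof -
  have hc: "continuous_on UNIV hh" and sc: "continuous_on UNIV ss" and rc: "continuous_on UNIV rr"
    using hh_deriv ss_deriv rr_deriv by (auto intro!: DERIV_continuous_on)
  have muc: "continuous_on UNIV (mu g)" and mupc: "continuous_on UNIV (mup g)" if "\<And>x. hh x + g \<noteq> 0" for g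
  proof -
    have "complex_of_real (hh x) + complex_of_real g \<noteq> 0" for x
      using that[of x] by (metis of_real_add of_real_eq_0_iff)
    then show "continuous_on UNIV (mu g)" "continuous_on UNIV (mup g)"
      unfolding mu_def[abs_def] mup_def[abs_def] Complex_eq mm_def etap_def
      by (auto intro!: continuous_intros hc sc)
  qed
  have rpc: "continuous_on UNIV rp"
  proof -
    have "gf (hh x) \<noteq> 0" "rr x \<noteq> 0" for x using gf_pos[of x] rr_pos[of x] by auto
    then show ?thesis
      unfolding rp_def[abs_def] Rp_def Rf_def gp_def etap_def mm_def gf_def eta_def
      by (auto intro!: continuous_intros hc sc rc)
  qed
  have zcc: "continuous_on UNIV (zc g)" if "\<And>x. hh x + g \<noteq> 0" for g
    unfolding zc_def[abs_def] by (intro continuous_intros muc mupc rpc rc that)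
  have f: "continuous_on UNIV (\<lambda>p::real \<times> real. f (fst p))" if "continuous_on UNIV f" for f :: "real \<Rightarrow> 'c::topological_space"
    by (rule continuous_on_compose2[OF that]) (auto intro!: continuous_intros)
  have dv: "continuous_on UNIV (\<lambda>p. dvec (l1 p) (l2 p) (l3 p) p)"
    if "continuous_on UNIV l1" "continuous_on UNIV l2" "continuous_on UNIV l3" for l1 l2 l3
    unfolding dvec_def using that
    by (intro continuous_on_vec3 continuous_intros z1_facts(4) z2_facts(4) z3_facts(4))
  have Vc: "continuous_on UNIV Vn"
    unfolding Vn_def[abs_def] Zx_def \<Psi>yy_def
    using rr_pos hh_bounds(3) by (intro continuous_intros dv f zcc d_nz rc hc) (auto simp: less_imp_neq[symmetric])
  have hdc: "continuous_on UNIV (\<lambda>p. hdot (u p) (v p))" if "continuous_on UNIV u" "continuous_on UNIV v" for u v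
    unfolding hdot_def using that by (intro continuous_intros)
  have sm: "continuous_on UNIV (\<lambda>p. u p *s v p)" if "continuous_on UNIV u" "continuous_on UNIV v"
    for u :: "real \<times> real \<Rightarrow> complex" and v :: "real \<times> real \<Rightarrow> complex^3"
    unfolding vector_scalar_mult_def using that by (intro continuous_on_vec_lambda continuous_intros)
  show ?thesis
    unfolding energy_dens_lift[abs_def] horiz_def
    using rr_pos by (intro continuous_intros f hc rc Vc sm hdc dv) (auto simp: less_imp_neq[symmetric])
qed

section \<open>The gradient of the Lagrangian angle\<close>

definition "beta x = (- a * eta (hh x) - etap (hh x) * mm (hh x)) / gf (hh x) + mm (hh x) * Rp (hh x) / Rf (hh x)"

lemma rr_sq: "(rr x)\<^sup>2 = Rf (hh x) / gf (hh x)"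
  using Rf_pos[of x] gf_pos[of x] by (simp add: rr_def)

lemma Rp_Rf: "1 / (hh x + al2 * al3) + 1 / (hh x + al3 * al1) + 1 / (hh x + al1 * al2) = Rp (hh x) / Rf (hh x)"
proof -
  have "1 / p + 1 / q + 1 / r = - (q * r + p * r + p * q) / - (p * q * r)"
    if "p \<noteq> 0" "q \<noteq> 0" "r \<noteq> 0" for p q r :: real
    using that by (simp add: field_simps)
  from this[OF d_nz] show ?thesis unfolding Rp_def Rf_def .
qed

text \<open>Partial fractions turn the sum over coordinates into a rational expression in
  \<open>h\<close>, \<open>mm\<close> and \<open>eta\<close>. If \<open>gf\<close> and
  \<open>Rf\<close> agreed, \<open>beta\<close> would reduce to \<open>-a\<close>.\<close>

lemma Im_V_x: "Im (hdot (Vn p) (\<Psi>x p)) = beta (fst p)"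
proof -
  let ?x = "fst p"
  let ?h = "hh ?x" and ?m = "mm (hh ?x)" and ?r = "rr ?x" and ?R = "Rf (hh ?x)" and ?g = "gf (hh ?x)"
  let ?K = "- a * eta ?h - etap ?h * ?m"
  have nz: "?h \<noteq> 0" "?r \<noteq> 0" "?R \<noteq> 0" "?g \<noteq> 0"
    using hh_bounds(3)[of ?x] rr_pos[of ?x] Rf_pos[of ?x] gf_pos[of ?x] by auto
  have Z: "Im (hdot (Zx p) (\<Psi>x p)) = ?r * (?K * (?h / ?R) + ?g * ?m * (- 1 / ?R + ?h * (Rp ?h / ?R) / ?R))"
  proof -
    have "Im (hdot (Zx p) (\<Psi>x p)) = ?r * (?K * (1 / (?h + al2 * al3) / ((al1 - al2) * (al1 - al3))) + ?g * ?m * (1 / (?h + al2 * al3)\<^sup>2 / ((al1 - al2) * (al1 - al3))))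
      + ?r * (?K * (1 / (?h + al3 * al1) / ((al2 - al3) * (al2 - al1))) + ?g * ?m * (1 / (?h + al3 * al1)\<^sup>2 / ((al2 - al3) * (al2 - al1))))
      + ?r * (?K * (1 / (?h + al1 * al2) / ((al3 - al1) * (al3 - al2))) + ?g * ?m * (1 / (?h + al1 * al2)\<^sup>2 / ((al3 - al1) * (al3 - al2))))"
      unfolding Zx_def \<Psi>x_def hdot_dvec zc_def mu_def mup_def q1_def q2_def q3_def plus_complex.sel
        Im_second_derivative_tangent[OF d_nz(1) D_nz(1)] Im_second_derivative_tangent[OF d_nz(2) D_nz(2)]
        Im_second_derivative_tangent[OF d_nz(3) D_nz(3)]
      by (simp only: gf_ss ss_sq)
    also have "\<dots> = ?r * (?K * (1 / (?h + al2 * al3) / ((al1 - al2) * (al1 - al3)) + 1 / (?h + al3 * al1) / ((al2 - al3) * (al2 - al1))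
         + 1 / (?h + al1 * al2) / ((al3 - al1) * (al3 - al2)))
      + ?g * ?m * (1 / (?h + al2 * al3)\<^sup>2 / ((al1 - al2) * (al1 - al3)) + 1 / (?h + al3 * al1)\<^sup>2 / ((al2 - al3) * (al2 - al1))
         + 1 / (?h + al1 * al2)\<^sup>2 / ((al3 - al1) * (al3 - al2))))"
      by (simp only: distrib_left add_ac)
    also have "\<dots> = ?r * (?K * (?h / ?R) + ?g * ?m * (- 1 / ?R + ?h * (Rp ?h / ?R) / ?R))"
      unfolding partial_fractions_radicand(1,3)[OF dist d_nz] Rp_Rf Rf_def[symmetric] ..
    finally show ?thesis .
  qed
  have Y: "Im (hdot (\<Psi>yy p) (\<Psi>x p)) = ?m"
  proof -
    have "Im (hdot (\<Psi>yy p) (\<Psi>x p)) = ?m * (al1\<^sup>2 / ((al1 - al2) * (al1 - al3))) + ?m * (al2\<^sup>2 / ((al2 - al3) * (al2 - al1)))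
       + ?m * (al3\<^sup>2 / ((al3 - al1) * (al3 - al2)))"
      unfolding \<Psi>yy_def \<Psi>x_def hdot_dvec mu_def q1_def q2_def q3_def plus_complex.sel
        Im_vertical_tangent[OF d_nz(1) D_nz(1)] Im_vertical_tangent[OF d_nz(2) D_nz(2)]
        Im_vertical_tangent[OF d_nz(3) D_nz(3)] ..
    then show ?thesis
      unfolding distrib_left[symmetric] partial_fractions_alpha(3)[OF dist] by simp
  qed
  have "Im (hdot (Vn p) (\<Psi>x p)) = ?r / ?h * (Im (hdot (Zx p) (\<Psi>x p)) + 1 / ?r * Im (hdot (\<Psi>yy p) (\<Psi>x p)))"
    unfolding Vn_def hdot_scaleR_left hdot_add_left
    by (simp del: of_real_divide)
  also have "\<dots> = ?r\<^sup>2 * ?K / ?R + (?r\<^sup>2 * ?g / ?R) * (- ?m / ?h + ?m * Rp ?h / ?R) + ?m / ?h"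
    unfolding Z Y using nz by (simp add: field_simps power2_eq_square)
  also have "\<dots> = beta ?x"
    unfolding rr_sq beta_def using nz by simp
  finally show ?thesis .
qed

text \<open>The terms with \<open>rp\<close> and \<open>etap\<close> multiply a vanishing partial
  fraction sum, and the two terms \<open>c1 / h\<close> cancel because
  \<open>rr^2 * gf = Rf\<close>. This component is therefore constant even though the metric is not
  conformal.\<close>

lemma Im_V_y: "Im (hdot (Vn p) (\<Psi>y p)) = - b"
proof -
  let ?x = "fst p"
  let ?h = "hh ?x" and ?m = "mm (hh ?x)" and ?r = "rr ?x" and ?R = "Rf (hh ?x)" and ?g = "gf (hh ?x)"
  have nz: "?h \<noteq> 0" "?r \<noteq> 0" "?R \<noteq> 0" "?g \<noteq> 0"
    using hh_bounds(3)[of ?x] rr_pos[of ?x] Rf_pos[of ?x] gf_pos[of ?x] by auto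
  let ?P = "- (rp ?x * ss ?x + ?r * etap ?h)"
  have Z: "Im (hdot (Zx p) (\<Psi>y p)) = ?r * ?g * (c1 / ?R)"
  proof -
    have "Im (hdot (Zx p) (\<Psi>y p)) = (?P * (al1 / ((al1 - al2) * (al1 - al3))) + ?r * ?g * (al1 / (?h + al2 * al3) / ((al1 - al2) * (al1 - al3))))
      + (?P * (al2 / ((al2 - al3) * (al2 - al1))) + ?r * ?g * (al2 / (?h + al3 * al1) / ((al2 - al3) * (al2 - al1))))
      + (?P * (al3 / ((al3 - al1) * (al3 - al2))) + ?r * ?g * (al3 / (?h + al1 * al2) / ((al3 - al1) * (al3 - al2))))"
      unfolding Zx_def \<Psi>y_def hdot_dvec zc_def mu_def mup_def q1_def q2_def q3_def plus_complex.sel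
        Im_second_derivative_vertical[OF d_nz(1) D_nz(1)] Im_second_derivative_vertical[OF d_nz(2) D_nz(2)]
        Im_second_derivative_vertical[OF d_nz(3) D_nz(3)]
      by (simp only: gf_ss)
    also have "\<dots> = ?P * (al1 / ((al1 - al2) * (al1 - al3)) + al2 / ((al2 - al3) * (al2 - al1)) + al3 / ((al3 - al1) * (al3 - al2)))
      + ?r * ?g * (al1 / (?h + al2 * al3) / ((al1 - al2) * (al1 - al3)) + al2 / (?h + al3 * al1) / ((al2 - al3) * (al2 - al1))
        + al3 / (?h + al1 * al2) / ((al3 - al1) * (al3 - al2)))"
      by (simp only: distrib_left add_ac)
    also have "\<dots> = ?r * ?g * (c1 / ?R)"
      unfolding partial_fractions_radicand(2)[OF dist d_nz] partial_fractions_alpha(2)[OF dist] Rf_def[symmetric]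
      by (simp add: c1_def Mc1_def)
    finally show ?thesis .
  qed
  have Y: "Im (hdot (\<Psi>yy p) (\<Psi>y p)) = - b * ?h - c1"
  proof -
    have "Im (hdot (\<Psi>yy p) (\<Psi>y p)) = al1^3 * q1 ?x + al2^3 * q2 ?x + al3^3 * q3 ?x"
      unfolding \<Psi>yy_def \<Psi>y_def hdot_dvec plus_complex.sel Im_vertical_vertical ..
    then show ?thesis
      unfolding q1_def q2_def q3_def partial_fractions_alpha(7)[OF dist]
      by (simp add: b_def Mb_def c1_def Mc1_def algebra_simps)
  qed
  have "Im (hdot (Vn p) (\<Psi>y p)) = ?r / ?h * (Im (hdot (Zx p) (\<Psi>y p)) + 1 / ?r * Im (hdot (\<Psi>yy p) (\<Psi>y p)))"
    unfolding Vn_def hdot_scaleR_left hdot_add_left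
    by (simp del: of_real_divide)
  also have "\<dots> = (?r\<^sup>2 * ?g / ?R) * (c1 / ?h) + (- b * ?h - c1) / ?h"
    unfolding Z Y using nz by (simp add: field_simps power2_eq_square)
  also have "\<dots> = - b"
    unfolding rr_sq using nz by (simp add: field_simps)
  finally show ?thesis .
qed

text \<open>The two normal components are divided by the squared lengths \<open>hh * w^2\<close> and
  \<open>hh\<close> of the fields; multiplying by the area density \<open>hh * w\<close> leaves
  opposite powers of \<open>w\<close> in the last two terms.\<close>

lemma energy_dens_ge:
  defines "w \<equiv> \<lambda>x. 1 / rr x"
  shows "energy_dens (M_lift al1 al2 al3 a1 a2 c2) p
    \<ge> hh (fst p) * w (fst p) + b\<^sup>2 * w (fst p) / 8 + (beta (fst p))\<^sup>2 / (8 * w (fst p))"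
proof -
  let ?h = "hh (fst p)" and ?r = "rr (fst p)" and ?R = "Rf (hh (fst p))" and ?g = "gf (hh (fst p))"
  have pos: "?h > 0" "?r > 0" "?R > 0" "?g > 0"
    using hh_bounds(3) rr_pos Rf_pos gf_pos by auto
  have E: "metE (fst p) = ?h / ?r\<^sup>2" unfolding rr_sq metE_def by simp
  have "(beta (fst p))\<^sup>2 / metE (fst p) + (- b)\<^sup>2 / ?h \<le> (norm (horiz (dvec 1 1 1 p) (Vn p)))\<^sup>2"
    using norm_horiz_ge[where v="Vn p", OF lift_unit[of p] lift_horiz_x lift_horiz_y lift_F lift_E metE_pos lift_G hh_bounds(3)]
    unfolding Im_V_x Im_V_y .
  then have "?h / ?r * (1 + (1/8) * ((beta (fst p))\<^sup>2 / metE (fst p) + (- b)\<^sup>2 / ?h))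
      \<le> ?h / ?r * (1 + (1/8) * (norm (horiz (dvec 1 1 1 p) (Vn p)))\<^sup>2)"
    using pos by (intro mult_left_mono add_left_mono) (assumption | simp)+
  also have "?h / ?r * (1 + (1/8) * ((beta (fst p))\<^sup>2 / metE (fst p) + (- b)\<^sup>2 / ?h))
     = ?h * (1 / ?r) + b\<^sup>2 * (1 / ?r) / 8 + (beta (fst p))\<^sup>2 / (8 * (1 / ?r))"
    unfolding E using pos by (simp add: field_simps power2_eq_square)
  finally show ?thesis unfolding energy_dens_lift w_def .
qed

end

section \<open>Periods and the energy bound\<close>

text \<open>The maximum is attained at \<open>x = 1/3\<close>, hence the double factor in the
  difference.\<close>

lemma cubic_weight_bound:
  fixes x :: real
  assumes "0 \<le> x"
  shows "(1 - x) * (1 + x)\<^sup>2 \<le> 32 / 27"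
proof -
  have "0 \<le> (x - 1/3)\<^sup>2 * (x + 5/3)" using assms by simp
  also have "\<dots> = 32 / 27 - (1 - x) * (1 + x)\<^sup>2" by (simp add: power2_eq_square field_simps)
  finally show ?thesis by simp
qed

context hm_surface
begin

section \<open>Periods and the area of a fundamental domain\<close>

definition "T = 2 * ellF k (pi / 2) / LL"

lemma T_pos: "T > 0"
proof -
  have "0 < ellF k (pi / 2)"
    using ell.ellF_expanding[of 0 "pi / 2", OF less_imp_le[OF pi_half_gt_zero]] ell.ellF_0 pi_half_gt_zero
    by linarith
  then show ?thesis using LL_pos by (simp add: T_def)
qed

lemma th_period: "th (x + T) = th x + pi"
  using LL_pos ell.am_add_period[of "x * LL"] by (simp add: th_def T_def distrib_right)

lemma lift_proj_entry:
  assumes "w \<in> period_lattice (M_lift al1 al2 al3 a1 a2 c2)"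
  shows "dvec 1 1 1 (p + w) $ i * cnj (dvec 1 1 1 (p + w) $ j) = dvec 1 1 1 p $ i * cnj (dvec 1 1 1 p $ j)"
proof -
  have "outer (dvec 1 1 1 (p + w)) (dvec 1 1 1 (p + w)) = outer (dvec 1 1 1 p) (dvec 1 1 1 p)"
    using assms unfolding period_lattice_def M_lift_dvec
    by (simp only: mem_Collect_eq emb_unit(2)[OF lift_unit])
  then show ?thesis by (simp add: outer_def vec_eq_iff)
qed

text \<open>The modulus of the first coordinate determines \<open>h\<close>, and \<open>h\<close>
  takes its maximum \<open>a1\<close>, the value at 0, exactly when the amplitude is a multiple of
  \<open>pi\<close>.\<close>

lemma period_fst:
  assumes "w \<in> period_lattice (M_lift al1 al2 al3 a1 a2 c2)"
  shows "\<exists>n::int. fst w = of_int n * T"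
proof -
  have "z1 w * cnj (z1 w) = z1 0 * cnj (z1 0)"
    using lift_proj_entry[OF assms, of 0 1 1] by (simp add: dvec_def)
  then have "(hh (fst w) + al2 * al3) / ((al1 - al2) * (al1 - al3)) = (hh 0 + al2 * al3) / ((al1 - al2) * (al1 - al3))"
    unfolding z1_facts(3) of_real_eq_iff by simp
  then have "hh (fst w) = hh 0" using dist by simp
  moreover have "th 0 = 0" by (simp add: th_def ell.am_0)
  ultimately have "sin (th (fst w)) = 0" using dd_pos by (simp add: hh_def)
  then obtain n :: int where "th (fst w) = of_int n * pi" using sin_zero_iff_int2 by blast
  then have "fst w * LL = of_int n * (2 * ellF k (pi / 2))"
    unfolding th_def using ell.ellF_am[of "fst w * LL"] ell.ellF_int_pi by simp
  then show ?thesis using LL_pos by (auto simp: T_def field_simps)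
qed

lemma period_snd:
  assumes "(0, y) \<in> period_lattice (M_lift al1 al2 al3 a1 a2 c2)"
  shows "cis ((al1 - al3) * y) = 1" "cis ((al2 - al3) * y) = 1"
proof -
  have sh: "z1 (0, y) = cis (al1 * y) * z1 0" "z2 (0, y) = cis (al2 * y) * z2 0" "z3 (0, y) = cis (al3 * y) * z3 0"
    by (simp_all add: z1_def z2_def z3_def Mcomp_def cis_mult[symmetric])
  have nz: "z1 0 \<noteq> 0" "z2 0 \<noteq> 0" "z3 0 \<noteq> 0"
  proof -
    have "z1 0 * cnj (z1 0) \<noteq> 0" "z2 0 * cnj (z2 0) \<noteq> 0" "z3 0 * cnj (z3 0) \<noteq> 0"
      unfolding z1_facts(3) z2_facts(3) z3_facts(3) of_real_eq_0_iff using q_pos[of "fst 0"] by auto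
    then show "z1 0 \<noteq> 0" "z2 0 \<noteq> 0" "z3 0 \<noteq> 0" by auto
  qed
  have "z1 (0, y) * cnj (z3 (0, y)) = z1 0 * cnj (z3 0)" "z2 (0, y) * cnj (z3 (0, y)) = z2 0 * cnj (z3 0)"
    using lift_proj_entry[OF assms, of 0 1 3] lift_proj_entry[OF assms, of 0 2 3] by (simp_all add: dvec_def)
  then have "cis (al1 * y) * cnj (cis (al3 * y)) = 1" "cis (al2 * y) * cnj (cis (al3 * y)) = 1"
    unfolding sh using nz by (simp_all add: mult_ac)
  then show "cis ((al1 - al3) * y) = 1" "cis ((al2 - al3) * y) = 1"
    by (simp_all add: cis_cnj cis_mult left_diff_distrib)
qed

lemma energy_dens_nonneg: "energy_dens (M_lift al1 al2 al3 a1 a2 c2) p \<ge> 0"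
  unfolding energy_dens_lift using rr_pos[of "fst p"] hh_bounds(3)[of "fst p"] by simp

text \<open>Multiplying the lower bound by \<open>dn \<le> 1\<close> turns it into an exact derivative, so that its integral over a
  period is elementary.\<close>

lemma energy_ge:
  assumes L: "lattice_basis (period_lattice (M_lift al1 al2 al3 a1 a2 c2)) w1 w2"
    and y: "\<And>y. (0, y) \<in> period_lattice (M_lift al1 al2 al3 a1 a2 c2) \<Longrightarrow> \<exists>n::int. y = 2 * pi * of_int n"
    and dens: "\<And>p. energy_dens (M_lift al1 al2 al3 a1 a2 c2) p \<ge> P + Q * (cos (th (fst p)))\<^sup>2"
    and PQ: "P + Q / 2 \<ge> 0"
  shows "energy (M_lift al1 al2 al3 a1 a2 c2) w1 w2 \<ge> 2 * pi * ((P + Q / 2) * pi / LL)"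
proof -
  define \<phi> where "\<phi> x = (P + Q * (cos (th x))\<^sup>2) * dn0 k (th x)" for x
  define \<Xi> where "\<Xi> x = 1 / LL * (P * th x + Q / 2 * (th x + sin (th x) * cos (th x)))" for x
  let ?C = "(P + Q / 2) * pi / LL" and ?det = "fst w1 * snd w2 - snd w1 * fst w2"
  have der: "(\<Xi> has_real_derivative \<phi> x) (at x)" for x
  proof -
    let ?D = "LL * dn0 k (th x)" and ?s = "sin (th x)" and ?c = "cos (th x)"
    have "(\<Xi> has_real_derivative 1 / LL * (P * ?D + Q / 2 * (?D + (?c * ?D * ?c + - ?s * ?D * ?s)))) (at x)"
    proof -
      have "((\<lambda>x. r * (P * th x + Q' * (th x + sin (th x) * cos (th x)))) has_real_derivative
         r * (P * ?D + Q' * (?D + (?c * ?D * ?c + - ?s * ?D * ?s)))) (at x)" for r Q'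
        by (auto intro!: derivative_eq_intros th_deriv simp: algebra_simps)
      then show ?thesis unfolding \<Xi>_def[abs_def] .
    qed
    also have "1 / LL * (P * ?D + Q / 2 * (?D + (?c * ?D * ?c + - ?s * ?D * ?s)))
       = (P + Q * ((1 - ?s\<^sup>2 + ?c\<^sup>2) / 2)) * dn0 k (th x)"
      using LL_pos by (simp add: field_simps power2_eq_square)
    also have "1 - ?s\<^sup>2 + ?c\<^sup>2 = 2 * ?c\<^sup>2" by (simp add: cos_squared_eq)
    finally show ?thesis by (simp add: \<phi>_def)
  qed
  have thc: "continuous_on UNIV th"
    using th_deriv by (auto intro!: DERIV_continuous_on)
  have cont: "continuous_on UNIV \<phi>"
    unfolding \<phi>_def[abs_def]
    by (intro continuous_intros thc continuous_on_compose2[OF ell.dn0_continuous thc]) auto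
  have per: "\<Xi> (x + T) = \<Xi> x + ?C" for x
    unfolding \<Xi>_def th_period by (simp add: add_divide_distrib algebra_simps)
  have det: "?det \<noteq> 0" by (rule lattice_basis_det[OF L])
  have inL: "of_int m *\<^sub>R w1 + of_int n *\<^sub>R w2 \<in> period_lattice (M_lift al1 al2 al3 a1 a2 c2)" for m n :: int
    using L unfolding lattice_basis_def by blast
  obtain n1 n2 :: int where n: "fst w1 = of_int n1 * T" "fst w2 = of_int n2 * T"
    using period_fst[OF inL[of 1 0]] period_fst[OF inL[of 0 1]] by auto
  \<comment> \<open>This combination of periods cancels the first coordinates. Being vertical, it is
    a multiple of \<open>2 * pi\<close>, and the determinant is \<open>-T\<close> times its
    height.\<close>
  have "of_int n2 *\<^sub>R w1 + of_int (- n1) *\<^sub>R w2 = (0, of_int n2 * snd w1 - of_int n1 * snd w2)"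
    by (rule prod_eqI) (simp_all add: n)
  with inL[of n2 "- n1"] have "(0, of_int n2 * snd w1 - of_int n1 * snd w2) \<in> period_lattice (M_lift al1 al2 al3 a1 a2 c2)"
    by simp
  then obtain j :: int where j: "of_int n2 * snd w1 - of_int n1 * snd w2 = 2 * pi * of_int j"
    using y by blast
  have "?det = - T * (of_int n2 * snd w1 - of_int n1 * snd w2)"
    by (simp add: n algebra_simps)
  then have dj: "?det = - T * (2 * pi * of_int j)" unfolding j .
  with det have "j \<noteq> 0" by auto
  then have "1 \<le> \<bar>j\<bar>" by simp
  then have "(1::real) \<le> of_int \<bar>j\<bar>" by (simp only: of_int_1_le_iff)
  then have dge: "2 * pi * T \<le> \<bar>?det\<bar>"
    unfolding dj using T_pos by (simp add: abs_mult)
  have "2 * pi * ?C = 2 * pi * T * (?C / T)" using T_pos by simp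
  also have "\<dots> \<le> \<bar>?det\<bar> * (?C / T)"
    using PQ LL_pos T_pos by (intro mult_right_mono dge) simp
  also have "\<dots> = integral (fund_par w1 w2) (\<lambda>p. \<phi> (fst p))"
    by (rule integral_fund_par_periodic[OF der cont per T_pos n det, symmetric])
  also have "\<dots> \<le> energy (M_lift al1 al2 al3 a1 a2 c2) w1 w2"
    unfolding energy_def
  proof (rule integral_le)
    show "(\<lambda>p. \<phi> (fst p)) integrable_on fund_par w1 w2"
      by (intro integrable_on_fund_par continuous_on_compose2[OF cont] continuous_intros) auto
    show "energy_dens (M_lift al1 al2 al3 a1 a2 c2) integrable_on fund_par w1 w2"
      by (rule integrable_on_fund_par[OF energy_dens_continuous])
    show "\<phi> (fst p) \<le> energy_dens (M_lift al1 al2 al3 a1 a2 c2) p" for p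
    proof (cases "P + Q * (cos (th (fst p)))\<^sup>2 \<ge> 0")
      case True
      then have "\<phi> (fst p) \<le> (P + Q * (cos (th (fst p)))\<^sup>2) * 1"
        unfolding \<phi>_def by (intro mult_left_mono ell.dn0_le_1)
      then show ?thesis using dens[of p] by simp
    next
      \<comment> \<open>Where the bound is negative, the weight \<open>dn0\<close> would raise it;
        there the sign of the density is enough.\<close>
      case False
      then have "\<phi> (fst p) \<le> 0"
        unfolding \<phi>_def using ell.dn0_pos[of "th (fst p)"] by (intro mult_nonpos_nonneg) auto
      then show ?thesis using energy_dens_nonneg[of p] by simp
    qed
  qed
  finally show ?thesis .
qed

section \<open>Deviation from the conformal case\<close>

lemma gp_Rp: "gp t = Rp t + (1 - k) * ((a1 - t)\<^sup>2 - 2 * (a1 - t) * (t - a2))"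
proof (rule DERIV_unique)
  show "(gf has_real_derivative gp t) (at t)"
    unfolding gf_def[abs_def] gp_def eta_def etap_def mm_def
    by (auto intro!: derivative_eq_intros simp: field_simps)
  have "((\<lambda>t. Rf t + (1 - k) * (a1 - t)\<^sup>2 * (t - a2)) has_real_derivative
     Rp t + (1 - k) * ((a1 - t)\<^sup>2 - 2 * (a1 - t) * (t - a2))) (at t)"
    unfolding Rf_def[abs_def] Rp_def
    by (auto intro!: derivative_eq_intros simp: algebra_simps power2_eq_square)
  then show "(gf has_real_derivative Rp t + (1 - k) * ((a1 - t)\<^sup>2 - 2 * (a1 - t) * (t - a2))) (at t)"
    unfolding gf_Rf[abs_def] .
qed

text \<open>After splitting off the conformal value \<open>-a\<close>, what is left is linear in the
  defect \<open>\<rho> = gf - Rf\<close> and its derivative, with the logarithmic derivative of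
  \<open>Rf\<close> as a coefficient.\<close>

lemma beta_plus_a:
  "beta x + a = mm (hh x) * ((1 - k) * (a1 - hh x)\<^sup>2 * (hh x - a2) * (Rp (hh x) / Rf (hh x))
     - (1 - k) * ((a1 - hh x)\<^sup>2 - 2 * (a1 - hh x) * (hh x - a2))) / gf (hh x)"
proof -
  have alg: "(- a * e - ep * m) / g + m * R' / R + a = m * (\<rho> * (R' / R) - \<rho>') / g"
    if "g = e + m\<^sup>2" "ep - a * m = R' + \<rho>'" "g = R + \<rho>" "g \<noteq> 0" "R \<noteq> 0" for e ep m g R R' \<rho> \<rho>'
  proof -
    have "(- a * e - ep * m) / g + a = - m * (R' + \<rho>') / g"
    proof -
      have "- a * e - ep * m + a * g = - m * (ep - a * m)"
        unfolding that(1) by (simp add: power2_eq_square algebra_simps)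
      then show ?thesis unfolding that(2) using that(4) by (simp add: field_simps)
    qed
    moreover have "- m * (R' + \<rho>') / g + m * R' / R = m * (\<rho> * (R' / R) - \<rho>') / g"
    proof -
      have \<rho>: "\<rho> = g - R" using that(3) by simp
      show ?thesis unfolding \<rho> using that(4,5) by (simp add: field_simps)
    qed
    ultimately show ?thesis by (simp add: add_ac)
  qed
  show ?thesis
    unfolding beta_def
    by (rule alg[OF gf_def gp_Rp[unfolded gp_def] gf_Rf]) (use gf_pos[of x] Rf_pos[of x] in auto)
qed

text \<open>The numerator of \<open>beta + a\<close> is at most \<open>mm\<close> times
  \<open>u * (2 * v + u)\<close> in absolute value, and \<open>mm\<close> is eliminated by
  \<open>4 * mm^2 * eta <= (eta + mm^2)^2\<close>. As the lower bound \<open>u * v * a3\<close> of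
  \<open>eta\<close> degenerates at \<open>v = 0\<close>, a factor \<open>v = dd * cos^2\<close>
  stays on the left. The constant is a quarter of \<open>32/27\<close>.\<close>

lemma beta_bound:
  assumes on: "one_neg a1 a2 (al2 * al3) (al3 * al1) (al1 * al2) \<or> one_neg a1 a2 (al3 * al1) (al1 * al2) (al2 * al3)
      \<or> one_neg a1 a2 (al1 * al2) (al2 * al3) (al3 * al1)"
  shows "(beta x + a)\<^sup>2 * (cos (th x))\<^sup>2 * a3 \<le> 8 / 27 * dd\<^sup>2"
proof -
  let ?u = "a1 - hh x" and ?v = "hh x - a2" and ?m = "mm (hh x)" and ?g = "gf (hh x)"
  define N where "N = (1 - k) * ?u\<^sup>2 * ?v * (Rp (hh x) / Rf (hh x)) - (1 - k) * (?u\<^sup>2 - 2 * ?u * ?v)"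
  have u: "?u \<ge> 0" and v: "?v \<ge> 0" using hh_bounds[of x] by simp_all
  have k': "0 \<le> 1 - k" "1 - k \<le> 1" using k_pos k_less_1 by simp_all
  have N: "\<bar>N\<bar> \<le> ?u * (2 * ?v + ?u)"
  proof -
    have *: "\<bar>(1 - k) * ?u\<^sup>2 * ?v * (1 / (hh x + g1) + 1 / (hh x + g2) + 1 / (hh x + g3)) - (1 - k) * (?u\<^sup>2 - 2 * ?u * ?v)\<bar>
        \<le> ?u * (2 * ?v + ?u)" if "one_neg a1 a2 g1 g2 g3" for g1 g2 g3
      using that hh_bounds[of x] by (intro log_derivative_bound u v k') (auto simp: one_neg_def)
    note bnd = *[of "al2 * al3" "al3 * al1" "al1 * al2"] *[of "al3 * al1" "al1 * al2" "al2 * al3"]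
      *[of "al1 * al2" "al2 * al3" "al3 * al1"]
    from on show ?thesis
      unfolding N_def Rp_Rf[symmetric]
      using bnd by (elim disjE) (simp_all add: add_ac)
  qed
  have b: "beta x + a = ?m * N / ?g" unfolding N_def by (rule beta_plus_a)
  have eta: "?u * ?v * a3 \<le> eta (hh x)"
  proof -
    have "k * ?u \<le> 1 * ?u" using k_less_1 u by (intro mult_right_mono) auto
    then have "a3 \<le> a1 + a3 - k * ?u" using hh_bounds(3)[of x] by simp
    then show ?thesis unfolding eta_def using u v by (intro mult_left_mono mult_nonneg_nonneg) auto
  qed
  have g: "4 * ?m\<^sup>2 * (?u * ?v * a3) \<le> ?g\<^sup>2"
  proof -
    have "4 * ?m\<^sup>2 * (?u * ?v * a3) \<le> 4 * ?m\<^sup>2 * eta (hh x)" by (intro mult_left_mono eta) simp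
    also have "\<dots> \<le> ?g\<^sup>2"
      using zero_le_power2[of "eta (hh x) - ?m\<^sup>2"] unfolding gf_def by (simp add: power2_eq_square algebra_simps)
    finally show ?thesis .
  qed
  have main: "(beta x + a)\<^sup>2 * (4 * (?u * ?v * a3)) \<le> (?u * (2 * ?v + ?u))\<^sup>2"
  proof -
    have "(beta x + a)\<^sup>2 * (4 * (?u * ?v * a3)) = N\<^sup>2 * (4 * ?m\<^sup>2 * (?u * ?v * a3) / ?g\<^sup>2)"
      unfolding b by (simp add: power_divide power_mult_distrib)
    also have "\<dots> \<le> N\<^sup>2 * 1"
      using g gf_pos[of x] by (intro mult_left_mono) (simp_all add: divide_le_eq)
    also have "\<dots> \<le> (?u * (2 * ?v + ?u))\<^sup>2"
      using power_mono[OF N, of 2] by simp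
    finally show ?thesis .
  qed
  show ?thesis
  proof (cases "?u = 0")
    \<comment> \<open>At the maxima of \<open>h\<close> the common factor \<open>u\<close> cannot be
      cancelled, but there \<open>N\<close> itself vanishes.\<close>
    case True
    then have "N = 0" using N by simp
    then show ?thesis unfolding b by simp
  next
    case False
    let ?c = "(cos (th x))\<^sup>2"
    have uc: "?u = dd * (1 - ?c)" unfolding hh_u by (simp add: sin_squared_eq)
    have c: "0 \<le> ?c" by simp
    have "?u * ((beta x + a)\<^sup>2 * (4 * (?v * a3))) \<le> ?u * (?u * (2 * ?v + ?u)\<^sup>2)"
      using main by (simp add: power2_eq_square mult_ac)
    then have "(beta x + a)\<^sup>2 * (4 * (?v * a3)) \<le> ?u * (2 * ?v + ?u)\<^sup>2"
      using False u by simp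
    also have "\<dots> = dd^3 * ((1 - ?c) * (1 + ?c)\<^sup>2)"
      unfolding uc hh_v by (simp add: power2_eq_square power3_eq_cube algebra_simps)
    also have "\<dots> \<le> dd^3 * (32 / 27)"
      using dd_pos by (intro mult_left_mono cubic_weight_bound c) simp
    finally have "(4 * dd) * ((beta x + a)\<^sup>2 * ?c * a3) \<le> (4 * dd) * (8 / 27 * dd\<^sup>2)"
      unfolding hh_v by (simp add: power2_eq_square power3_eq_cube mult_ac)
    then show ?thesis by (rule mult_left_le_imp_le) (use dd_pos in simp)
  qed
qed

lemma inverse_rr_ge: "1 \<le> 1 / rr x"
proof -
  have "(rr x)\<^sup>2 \<le> 1" unfolding rr_sq using gf_ge_Rf[of x] gf_pos[of x] by simp
  then have "rr x \<le> 1" using power2_le_imp_le[of "rr x" 1] by simp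
  then show ?thesis using rr_pos[of x] by simp
qed

text \<open>The defect is at most \<open>u * (u * v)\<close>, whereas \<open>Rf\<close> is at least
  \<open>u * v * a3\<close>, so \<open>gf\<close> exceeds \<open>Rf\<close> by at most the fraction
  \<open>2/3\<close>. The constant \<open>13/10\<close> is a rational upper bound for the square
  root of \<open>5/3\<close>.\<close>

lemma inverse_rr_le:
  assumes "dd \<le> 2 / 3 * a3"
  shows "1 / rr x \<le> 13 / 10"
proof -
  let ?u = "a1 - hh x" and ?v = "hh x - a2"
  have u: "?u \<ge> 0" "?u \<le> dd" and v: "?v \<ge> 0" using hh_bounds[of x] by (simp_all add: dd_def)
  have R: "?u * ?v * a3 \<le> Rf (hh x)"
  proof -
    have "?u * ?v * a3 \<le> ?u * ?v * (hh x + a3)"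
      using u v hh_bounds(3)[of x] by (intro mult_left_mono) auto
    then show ?thesis unfolding Rf_eq using zero_le_power2[of "mm (hh x)"] by linarith
  qed
  have "(1 - k) * ?u\<^sup>2 * ?v \<le> 1 * ?u\<^sup>2 * ?v"
    using k_pos u v by (intro mult_right_mono) auto
  also have "\<dots> = ?u * (?u * ?v)" by (simp add: power2_eq_square)
  also have "\<dots> \<le> (2 / 3 * a3) * (?u * ?v)"
    using u v assms by (intro mult_right_mono) auto
  also have "\<dots> \<le> 2 / 3 * Rf (hh x)" using R by (simp add: mult_ac)
  finally have g: "gf (hh x) \<le> 5 / 3 * Rf (hh x)" unfolding gf_Rf by simp
  have "(1 / rr x)\<^sup>2 = gf (hh x) / Rf (hh x)"
    unfolding power_divide rr_sq by simp
  also have "\<dots> \<le> 5 / 3" using g Rf_pos[of x] by (simp add: divide_le_eq)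
  also have "\<dots> \<le> (13 / 10)\<^sup>2" by (simp add: power2_eq_square)
  finally show "1 / rr x \<le> 13 / 10" by (rule power2_le_imp_le) simp
qed

lemma energy_dens_lower_bound:
  assumes a2: "a2 > 1" and c_le: "a1 + c \<le> b\<^sup>2 / 4"
    and c_ge: "- 4 * c \<le> (a1 + a2 + b\<^sup>2 / 4)\<^sup>2"
    and on: "one_neg a1 a2 (al2 * al3) (al3 * al1) (al1 * al2) \<or> one_neg a1 a2 (al3 * al1) (al1 * al2) (al2 * al3)
      \<or> one_neg a1 a2 (al1 * al2) (al2 * al3) (al3 * al1)"
  obtains P Q where "\<And>p. energy_dens (M_lift al1 al2 al3 a1 a2 c2) p \<ge> P + Q * (cos (th (fst p)))\<^sup>2"
    and "P + Q / 2 > 2 / (3 * sqrt 3) * LL"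
proof -
  define X A where "X = a1 + a2 + b\<^sup>2 / 4" and "A = a\<^sup>2 / 4"
  have A0: "A \<ge> 0" by (simp add: A_def)
  have a3: "a3 = a1 + a2 + c + A" using a_sq by (simp add: A_def)
  have X2: "X > 2" using a2 a12 zero_le_power2[of b] unfolding X_def by linarith
  have XX: "2 * X < X\<^sup>2" using X2 by (simp add: power2_eq_square)
  have LL_le: "LL\<^sup>2 \<le> X + A" using c_le by (simp add: LL_sq a3 X_def)
  \<comment> \<open>\<open>2 / (3 * sqrt 3)\<close> is the Clifford energy divided by
    \<open>2 * pi^2\<close>; its square is \<open>4/27\<close>.\<close>
  have LL_less: "2 / (3 * sqrt 3) * LL < y" if y: "y > 0" "y\<^sup>2 > 4 / 27 * (X + A)" for y
  proof (rule power2_less_imp_less)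
    have "(2 / (3 * sqrt 3) * LL)\<^sup>2 = 4 / 27 * LL\<^sup>2"
      by (simp add: power_mult_distrib power_divide)
    then show "(2 / (3 * sqrt 3) * LL)\<^sup>2 < y\<^sup>2" using LL_le y(2) by simp
  qed (use y in simp)
  have hc: "hh x = a2 + dd * (cos (th x))\<^sup>2" for x using hh_v[of x] by simp
  have base: "hh (fst p) + b\<^sup>2 / 8 + (beta (fst p))\<^sup>2 / (8 * (1 / rr (fst p)))
      \<le> energy_dens (M_lift al1 al2 al3 a1 a2 c2) p" for p
  proof -
    have "(hh (fst p) + b\<^sup>2 / 8) * 1 \<le> (hh (fst p) + b\<^sup>2 / 8) * (1 / rr (fst p))"
      using hh_bounds(3)[of "fst p"] by (intro mult_left_mono inverse_rr_ge) simp
    also have "\<dots> = hh (fst p) * (1 / rr (fst p)) + b\<^sup>2 * (1 / rr (fst p)) / 8"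
      by (simp add: add_divide_distrib)
    finally show ?thesis using energy_dens_ge[of p] by simp
  qed
  show thesis
  proof (cases "A \<le> X\<^sup>2")
    case True
    show thesis
    \<comment> \<open>The coefficients of \<open>h + b^2 / 8\<close>. Since
      \<open>2 * X < X^2\<close>, here \<open>4/27 * (X + A)\<close> is less than
      \<open>2/9 * X^2\<close>, which is below \<open>X^2 / 4\<close>.\<close>
    proof (rule that[of "a2 + b\<^sup>2 / 8" dd])
      show "a2 + b\<^sup>2 / 8 + dd * (cos (th (fst p)))\<^sup>2 \<le> energy_dens (M_lift al1 al2 al3 a1 a2 c2) p" for p
      proof -
        have "0 \<le> (beta (fst p))\<^sup>2 / (8 * (1 / rr (fst p)))" using rr_pos[of "fst p"] by simp
        then show ?thesis using base[of p] hc[of "fst p"] by linarith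
      qed
      have "a2 + b\<^sup>2 / 8 + dd / 2 = X / 2" by (simp add: X_def dd_def field_simps)
      moreover have "2 / (3 * sqrt 3) * LL < X / 2"
        using X2 XX True by (intro LL_less) (simp_all add: power_divide)
      ultimately show "2 / (3 * sqrt 3) * LL < a2 + b\<^sup>2 / 8 + dd / 2" by simp
    qed
  next
    case False
    \<comment> \<open>A negative \<open>c\<close> costs at most \<open>X^2 / 4\<close>, which is
      less than \<open>A / 4\<close>.\<close>
    have a3_ge: "a3 \<ge> 3 / 4 * A" using False c_ge a12 unfolding a3 X_def[symmetric] by simp
    have dd_X: "dd \<le> X" using a12 by (simp add: dd_def X_def add_increasing2)
    have "dd\<^sup>2 \<le> X\<^sup>2" using dd_X dd_pos by (intro power_mono) auto
    then have dd_A: "dd\<^sup>2 \<le> A" using False by simp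
    have "dd \<le> 2 / 3 * a3" using a3_ge dd_X XX False by simp
    note w = inverse_rr_le[OF this]
    have A4: "A > 4" using False X2 XX by simp
    show thesis
    \<comment> \<open>The extra terms are the lower bound
      \<open>16 * A / 5 * cos^2 - 4 * A / 10\<close> for \<open>beta^2\<close>, divided by
      \<open>52/5\<close>, an upper bound for \<open>8 * w\<close>.\<close>
    proof (rule that[of "a2 + b\<^sup>2 / 8 - (4 * A / 10) / (52 / 5)" "dd + (16 * A / 5) / (52 / 5)"])
      show "a2 + b\<^sup>2 / 8 - (4 * A / 10) / (52 / 5) + (dd + (16 * A / 5) / (52 / 5)) * (cos (th (fst p)))\<^sup>2
         \<le> energy_dens (M_lift al1 al2 al3 a1 a2 c2) p" for p
      proof -
        let ?\<beta> = "beta (fst p)" and ?c = "cos (th (fst p))"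
        have "(?\<beta> + a)\<^sup>2 * ?c\<^sup>2 * a3 \<le> 8 / 27 * A"
          using beta_bound[OF on, of "fst p"] dd_A by simp
        also have "\<dots> \<le> 2 / 5 * a3" using a3_ge A0 by simp
        finally have y: "(?\<beta> + a)\<^sup>2 * ?c\<^sup>2 \<le> 2 / 5" using a3_pos by simp
        \<comment> \<open>The weighted form of
          \<open>beta^2 >= 4/5 * a^2 - 4 * (beta + a)^2\<close>, in which most of \<open>a^2\<close>
          survives.\<close>
        have "0 \<le> (5 * (?\<beta> + a) * ?c - a * ?c)\<^sup>2" by simp
        also have "\<dots> = 5 * (?\<beta>\<^sup>2 * ?c\<^sup>2 - 4 / 5 * a\<^sup>2 * ?c\<^sup>2 + 4 * ((?\<beta> + a)\<^sup>2 * ?c\<^sup>2))"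
          by (simp add: power2_eq_square algebra_simps)
        finally have "4 / 5 * a\<^sup>2 * ?c\<^sup>2 - 8 / 5 \<le> ?\<beta>\<^sup>2 * ?c\<^sup>2" using y by simp
        also have "\<dots> \<le> ?\<beta>\<^sup>2 * 1" by (intro mult_left_mono) (simp_all add: abs_square_le_1)
        finally have "4 / 5 * (4 * A) * ?c\<^sup>2 - 8 / 5 \<le> ?\<beta>\<^sup>2" by (simp add: A_def)
        \<comment> \<open>The constant \<open>8/5\<close> is absorbed into \<open>4 * A / 10\<close>
          because \<open>A > 4\<close>.\<close>
        then have \<beta>: "16 * A / 5 * ?c\<^sup>2 - 4 * A / 10 \<le> ?\<beta>\<^sup>2" using A4 by simp
        have "(16 * A / 5 * ?c\<^sup>2 - 4 * A / 10) / (52 / 5) \<le> ?\<beta>\<^sup>2 / (52 / 5)"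
          using \<beta> by (rule divide_right_mono) simp
        also have "\<dots> \<le> ?\<beta>\<^sup>2 / (8 * (1 / rr (fst p)))"
        proof (rule divide_left_mono)
          show "8 * (1 / rr (fst p)) \<le> 52 / 5" using w[of "fst p"] by linarith
          show "0 < 52 / 5 * (8 * (1 / rr (fst p)))" using rr_pos[of "fst p"] by simp
        qed simp
        finally have "(16 * A / 5 * ?c\<^sup>2 - 4 * A / 10) / (52 / 5) \<le> ?\<beta>\<^sup>2 / (8 * (1 / rr (fst p)))" .
        moreover have "a2 + b\<^sup>2 / 8 - (4 * A / 10) / (52 / 5) + (dd + (16 * A / 5) / (52 / 5)) * ?c\<^sup>2
          = hh (fst p) + b\<^sup>2 / 8 + (16 * A / 5 * ?c\<^sup>2 - 4 * A / 10) / (52 / 5)"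
          unfolding hc by (simp add: field_simps)
        ultimately show ?thesis using base[of p] by linarith
      qed
      have e: "a2 + b\<^sup>2 / 8 - (4 * A / 10) / (52 / 5) + (dd + (16 * A / 5) / (52 / 5)) / 2 = X / 2 + 3 / 26 * A"
        by (simp add: X_def dd_def field_simps)
      \<comment> \<open>With the products named, the comparison is linear: \<open>2 * A <= t\<close>
        and \<open>2 * X < q\<close> suffice.\<close>
      define t q where "t = X * A" and "q = X\<^sup>2"
      have "2 * A \<le> t" unfolding t_def using X2 A0 by (intro mult_right_mono) auto
      moreover have "2 * X < q" unfolding q_def by (rule XX)
      ultimately have "4 / 27 * (X + A) < q / 4 + 3 / 26 * t"
        using X2 A4 by simp
      also have "\<dots> = X\<^sup>2 / 4 + 3 / 26 * (X * A)" by (simp add: t_def q_def)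
      also have "\<dots> \<le> X\<^sup>2 / 4 + 3 / 26 * (X * A) + (3 / 26 * A)\<^sup>2"
        by simp
      also have "\<dots> = (X / 2 + 3 / 26 * A)\<^sup>2"
        by (simp add: power2_eq_square field_simps)
      finally have "4 / 27 * (X + A) < (X / 2 + 3 / 26 * A)\<^sup>2" .
      then have "2 / (3 * sqrt 3) * LL < X / 2 + 3 / 26 * A"
        using X2 A0 by (intro LL_less) simp_all
      then show "2 / (3 * sqrt 3) * LL
          < a2 + b\<^sup>2 / 8 - (4 * A / 10) / (52 / 5) + (dd + (16 * A / 5) / (52 / 5)) / 2"
        unfolding e .
    qed
  qed
qed

end

theorem theorem2:
  fixes \<alpha>1 \<alpha>2 \<alpha>3 :: int and a1 a2 c2 :: real
  assumes cop: "coprime (\<alpha>1 - \<alpha>3) (\<alpha>2 - \<alpha>3)"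
    and dist: "\<alpha>1 \<noteq> \<alpha>2" "\<alpha>1 \<noteq> \<alpha>3" "\<alpha>2 \<noteq> \<alpha>3"
    and a12: "a1 > a2" "a2 > 0"
    and Pneg: "MP \<alpha>1 \<alpha>2 \<alpha>3 a1 a2 \<le> 0"
    and disc: "(MP \<alpha>1 \<alpha>2 \<alpha>3 a1 a2)\<^sup>2 - (a1 - a2)\<^sup>2 * (MQ \<alpha>1 \<alpha>2 \<alpha>3 a1 a2)\<^sup>2 \<ge> 0"
    and root: "(a1 - a2)\<^sup>2 * c2^4 + 2 * MP \<alpha>1 \<alpha>2 \<alpha>3 a1 a2 * c2\<^sup>2 + (MQ \<alpha>1 \<alpha>2 \<alpha>3 a1 a2)\<^sup>2 = 0"
    and c2nz: "c2 \<noteq> 0"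
    and rad: "\<forall>x. Mrad \<alpha>1 \<alpha>2 \<alpha>3 a1 a2 c2 x \<ge> 0 \<and> Mrad \<alpha>2 \<alpha>3 \<alpha>1 a1 a2 c2 x \<ge> 0
                 \<and> Mrad \<alpha>3 \<alpha>1 \<alpha>2 a1 a2 c2 x \<ge> 0"
    and den: "\<forall>x. 2 * \<alpha>1 * Mev \<alpha>1 \<alpha>2 \<alpha>3 a1 a2 c2 x \<noteq> Mc1 \<alpha>1 \<alpha>2 \<alpha>3
                 \<and> 2 * \<alpha>2 * Mev \<alpha>1 \<alpha>2 \<alpha>3 a1 a2 c2 x \<noteq> Mc1 \<alpha>1 \<alpha>2 \<alpha>3
                 \<and> 2 * \<alpha>3 * Mev \<alpha>1 \<alpha>2 \<alpha>3 a1 a2 c2 x \<noteq> Mc1 \<alpha>1 \<alpha>2 \<alpha>3"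
    and rat: "\<exists>\<tau>::real.
      (MG \<alpha>1 \<alpha>2 \<alpha>3 a1 a2 c2 (MT \<alpha>1 \<alpha>2 \<alpha>3 a1 a2 c2) - MG \<alpha>3 \<alpha>1 \<alpha>2 a1 a2 c2 (MT \<alpha>1 \<alpha>2 \<alpha>3 a1 a2 c2)
         + (\<alpha>1 - \<alpha>3) * \<tau>) / (2 * pi) \<in> \<rat> \<and>
      (MG \<alpha>2 \<alpha>3 \<alpha>1 a1 a2 c2 (MT \<alpha>1 \<alpha>2 \<alpha>3 a1 a2 c2) - MG \<alpha>3 \<alpha>1 \<alpha>2 a1 a2 c2 (MT \<alpha>1 \<alpha>2 \<alpha>3 a1 a2 c2)
         + (\<alpha>2 - \<alpha>3) * \<tau>) / (2 * pi) \<in> \<rat>"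
  shows "(\<forall>w1 w2. lattice_basis (period_lattice (M_lift \<alpha>1 \<alpha>2 \<alpha>3 a1 a2 c2)) w1 w2 \<longrightarrow>
            energy (M_lift \<alpha>1 \<alpha>2 \<alpha>3 a1 a2 c2) w1 w2 > 4 * pi\<^sup>2 / (3 * sqrt 3))
       \<and> (\<forall>w1 w2. lattice_basis (period_lattice clifford_lift) w1 w2 \<longrightarrow>
            energy clifford_lift w1 w2 = 4 * pi\<^sup>2 / (3 * sqrt 3))"
proof (intro conjI allI impI)
  fix w1 w2 assume "lattice_basis (period_lattice clifford_lift) w1 w2"
  then show "energy clifford_lift w1 w2 = 4 * pi\<^sup>2 / (3 * sqrt 3)" by (rule clifford_energy)
next
  fix w1 w2
  assume L: "lattice_basis (period_lattice (M_lift \<alpha>1 \<alpha>2 \<alpha>3 a1 a2 c2)) w1 w2"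
  interpret S: hm_surface "of_int \<alpha>1" "of_int \<alpha>2" "of_int \<alpha>3" a1 a2 c2
  proof
    show "(a1 - a2)\<^sup>2 * c2^4 + 2 * MP \<alpha>1 \<alpha>2 \<alpha>3 a1 a2 * c2\<^sup>2 + (MQ \<alpha>1 \<alpha>2 \<alpha>3 a1 a2)\<^sup>2 = 0"
      by (rule root)
  qed (use dist a12 c2nz rad den in auto)
  have pos: "t \<in> {a1, a2} \<Longrightarrow> (t + \<alpha>2 * \<alpha>3) / ((\<alpha>1 - \<alpha>2) * (\<alpha>1 - \<alpha>3)) > 0
      \<and> (t + \<alpha>3 * \<alpha>1) / ((\<alpha>2 - \<alpha>3) * (\<alpha>2 - \<alpha>1)) > 0 \<and> (t + \<alpha>1 * \<alpha>2) / ((\<alpha>3 - \<alpha>1) * (\<alpha>3 - \<alpha>2)) > 0" for t :: real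
  proof -
    assume t: "t \<in> {a1, a2}"
    \<comment> \<open>Both \<open>a1\<close> and \<open>a2\<close> are values of \<open>h\<close>,
      at the amplitudes 0 and \<open>pi / 2\<close>, so positivity along the surface transfers to
      them.\<close>
    obtain x where "t = S.hh x"
    proof (cases "t = a1")
      case True
      have "S.hh 0 = a1" by (simp add: S.hh_def S.th_def S.ell.am_0)
      then show thesis using True by (intro that[of 0]) simp
    next
      case False
      have "S.hh (ellF S.k (pi / 2) / S.LL) = a2"
        using S.LL_pos by (simp add: S.hh_def S.th_def S.ell.am_ellF S.dd_def)
      then show thesis using False t by (intro that[of "ellF S.k (pi / 2) / S.LL"]) simp
    qed
    then show ?thesis using S.q_pos[of x] by simp
  qed
  have nz: "\<alpha>1 \<noteq> 0" "\<alpha>2 \<noteq> 0" "\<alpha>3 \<noteq> 0" using S.al_nz by auto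
  note bounds = symmetric_bounds[OF dist nz a12(2,1) pos]
  have B: "a2 > 1" "a1 + S.c \<le> S.b\<^sup>2 / 4" "- 4 * S.c \<le> (a1 + a2 + S.b\<^sup>2 / 4)\<^sup>2"
    "one_neg a1 a2 (of_int \<alpha>2 * of_int \<alpha>3) (of_int \<alpha>3 * of_int \<alpha>1) (of_int \<alpha>1 * of_int \<alpha>2)
      \<or> one_neg a1 a2 (of_int \<alpha>3 * of_int \<alpha>1) (of_int \<alpha>1 * of_int \<alpha>2) (of_int \<alpha>2 * of_int \<alpha>3)
      \<or> one_neg a1 a2 (of_int \<alpha>1 * of_int \<alpha>2) (of_int \<alpha>2 * of_int \<alpha>3) (of_int \<alpha>3 * of_int \<alpha>1)"
    using bounds by (simp_all add: S.b_def S.c_def)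
  obtain P Q where dens: "\<And>p. energy_dens (M_lift \<alpha>1 \<alpha>2 \<alpha>3 a1 a2 c2) p \<ge> P + Q * (cos (S.th (fst p)))\<^sup>2"
    and PQ: "P + Q / 2 > 2 / (3 * sqrt 3) * S.LL"
    by (rule S.energy_dens_lower_bound[OF B]) (rule that)
  have y: "\<exists>n::int. y = 2 * pi * of_int n" if yL: "(0, y) \<in> period_lattice (M_lift \<alpha>1 \<alpha>2 \<alpha>3 a1 a2 c2)" for y
  proof -
    obtain m n :: int where m: "(of_int \<alpha>1 - of_int \<alpha>3) * y = 2 * pi * of_int m"
      and n: "(of_int \<alpha>2 - of_int \<alpha>3) * y = 2 * pi * of_int n"
      using S.period_snd[OF yL] cis_eq_1_imp by meson
    \<comment> \<open>Bezout coefficients combine the two congruences for the differences of the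
      \<alpha>'s into one for \<open>y\<close> itself.\<close>
    obtain u v :: int where "u * (\<alpha>1 - \<alpha>3) + v * (\<alpha>2 - \<alpha>3) = 1"
      using cop bezout_int[of "\<alpha>1 - \<alpha>3" "\<alpha>2 - \<alpha>3"] by auto
    then have "of_int u * (of_int \<alpha>1 - of_int \<alpha>3) + of_int v * (of_int \<alpha>2 - of_int \<alpha>3) = (1::real)"
      by (metis of_int_1 of_int_add of_int_diff of_int_mult)
    then have "y = of_int u * ((of_int \<alpha>1 - of_int \<alpha>3) * y) + of_int v * ((of_int \<alpha>2 - of_int \<alpha>3) * y)"
      by (metis distrib_right mult.assoc mult_1)
    also have "\<dots> = 2 * pi * of_int (u * m + v * n)"
      unfolding m n by (simp add: algebra_simps)
    finally show ?thesis by blast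
  qed
  have "0 < 2 / (3 * sqrt 3) * S.LL" using S.LL_pos by simp
  then have PQ0: "P + Q / 2 \<ge> 0" using PQ by linarith
  have "4 * pi\<^sup>2 / (3 * sqrt 3) = 2 * pi * ((2 / (3 * sqrt 3) * S.LL) * pi / S.LL)"
    using S.LL_pos by (simp add: power2_eq_square)
  also have "\<dots> < 2 * pi * ((P + Q / 2) * pi / S.LL)"
    using PQ S.LL_pos by (intro mult_strict_left_mono divide_strict_right_mono mult_strict_right_mono) auto
  also have "\<dots> \<le> energy (M_lift \<alpha>1 \<alpha>2 \<alpha>3 a1 a2 c2) w1 w2"
    by (rule S.energy_ge[OF L y dens PQ0])
  finally show "4 * pi\<^sup>2 / (3 * sqrt 3) < energy (M_lift \<alpha>1 \<alpha>2 \<alpha>3 a1 a2 c2) w1 w2" .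
qed

end
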